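(* Let $f:\mathbb{R}^2\to\mathbb{R}$ satisfy (f1)–(f7), let $\Delta:\mathbb{R}\to\mathbb{R}$ be an $L^\infty$ function with finite asymptotic limits $\delta_\pm:=\lim_{t\to\pm\infty}\Delta(t)$, and assume that $x'=f(t,x)$ has an attractor-repeller pair $(\tilde a,\tilde r)$. Consider the equation $$x'=f(t,x-\Delta(t)),\qquad (E_\Delta)$$ and let $x_\Delta(t,s,x_0)$ be its maximal solution with $x_\Delta(s,s,x_0)=x_0$. Then: (i) There exist the solutions $\mathfrak{a}_\Delta$ and $\mathfrak{r}_\Delta$ of $(E_\Delta)$ (the upper solution bounded in the past and the lower solution bounded in the future, as defined in the context). (ii) $\lim_{t\to-\infty}|\mathfrak{a}_\Delta(t)-(\tilde a(t)+\delta_-)|=0$; $\lim_{t\to-\infty}|x_\Delta(t,s,x_0)-(\tilde r(t)+\delta_-)|=0$ whenever $\mathfrak{a}_\Delta(s)$ exists and $x_0<\mathfrak{a}_\Delta(s)$; $\lim_{t\to+\infty}|\mathfrak{r}_\Delta(t)-(\tilde r(t)+\delta_+)|=0$; and $\lim_{t\to+\infty}|x_\Delta(t,s,x_0)-(\tilde a(t)+\delta_+)|=0$ whenever $\mathfrak{r}_\Delta(s)$ exists and $x_0>\mathfrak{r}_\Delta(s)$. (iii) The solutions $\mathfrak{a}_\Delta$ and $\mathfrak{r}_\Delta$ are respectively locally pullback attractive and locally pullback repulsive. (iv) $\mathfrak{a}_\Delta$ and $\mathfrak{r}_\Delta$ are (globally defined and) uniformly separated if and only if they are globally defined and different; i.e.,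 if and only if $(\mathfrak{a}_\Delta,\mathfrak{r}_\Delta)$ is an attractor-repeller pair for $(E_\Delta)$. (v) If the equation $(E_\Delta)$ has no hyperbolic solutions, then it has at most one bounded solution $\mathfrak{a}_\Delta=\mathfrak{r}_\Delta$.
   Context: Conditions on a function $f:\mathbb{R}^2\to\mathbb{R}$ ("a.e. $t$" refers to Lebesgue measure on $\mathbb{R}$): (f1) $f$ is Borel measurable; (f2) for all $j\in\mathbb{N}$ there exists $m_j\in\mathbb{R}$ such that $\sup_{x\in[-j,j]}|f(t,x)|\le m_j$ for a.e. $t$; (f3) for all $j\in\mathbb{N}$ there exists $l_j\in\mathbb{R}$ such that $\sup_{x_1,x_2\in[-j,j],\,x_1\ne x_2}|f(t,x_2)-f(t,x_1)|/|x_2-x_1|\le l_j$ for a.e. $t$; (f4) for a.e. $t$, the map $x\mapsto f(t,x)$ is $C^1$; (f5) $f_x=\partial f/\partial x$ satisfies condition (f3); (f6) there exist a subset $\mathcal{R}\subseteq\mathbb{R}$ with full Lebesgue measure and $\delta>0$ such that $\limsup_{x\to\pm\infty}f(t,x)/x^2<-\delta$ uniformly on $t\in\mathcal{R}$; (f7) for all $j\in\mathbb{N}$ there exists $\delta_j>0$ such that $\sup_{x_1,x_2\in[-j,j],\,x_1\ne x_2}(f_x(t,x_2)-f_x(t,x_1))/(x_2-x_1)<-\delta_j$ for a.e. $t$. If $f$ satisfies these conditions, so does $(t,x)\mapsto f(t,x-\Delta(t))$. Solutions are Carathéodory solutions (absolutely continuous on compact intervals, satisfying the equation for a.e. $t$).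 Special solutions. For an equation $x'=g(t,x)$ with $g$ satisfying (f1)–(f7), let $x(t,s,x_0)$ be the maximal solution with value $x_0$ at $s$. If some solution is bounded as time decreases to $-\infty$, there is a unique maximal solution $a:\mathcal{R}^-\to\mathbb{R}$, with $\mathcal{R}^-$ equal to $\mathbb{R}$ or to an open half-line unbounded below, such that for $s\in\mathcal{R}^-$, $x(t,s,x_0)$ remains bounded as $t\to-\infty$ iff $x_0\le a(s)$, and $a(t)\to-\infty$ as $t\to(\sup\mathcal{R}^-)^-$ if $\sup\mathcal{R}^-<\infty$. If some solution is bounded as time increases to $+\infty$, there is a unique maximal solution $r:\mathcal{R}^+\to\mathbb{R}$, with $\mathcal{R}^+$ equal to $\mathbb{R}$ or to an open half-line unbounded above, such that for $s\in\mathcal{R}^+$, $x(t,s,x_0)$ remains bounded as $t\to+\infty$ iff $x_0\ge r(s)$, and $r(t)\to\infty$ as $t\to(\inf\mathcal{R}^+)^+$ if $\inf\mathcal{R}^+>-\infty$. For $(E_\Delta)$, $a$ and $r$ are denoted $\mathfrak{a}_\Delta$ and $\mathfrak{r}_\Delta$. If bounded solutions exist, $a$ and $r$ are globally defined and bounded, $r\le a$, and the bounded solutions are exactly those lying between $r$ and $a$. A bounded solution $\tilde b:\mathbb{R}\to\mathbb{R}$ of $x'=g(t,x)$ is hyperbolic attractive (resp. repulsive) if there exist $k\ge1$, $\beta>0$ with $\exp\int_s^t g_x(l,\tilde b(l))\,dl\le k\,e^{-\beta(t-s)}$ for all $t\ge s$ (resp. $\le k\,e^{\beta(t-s)}$ for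 all $t\le s$). An attractor-repeller pair for $x'=g(t,x)$ is the pair $(a,r)$ above when both are globally defined bounded hyperbolic solutions, $a$ attractive and $r$ repulsive; this is equivalent to $a,r$ being globally defined with $\inf_{t\in\mathbb{R}}(a(t)-r(t))>0$ (uniform separation). A solution $\bar a:(-\infty,\beta)\to\mathbb{R}$ ($\beta\le\infty$) is locally pullback attractive if there exist $s_0<\beta$ and $\delta>0$ such that, if $s\le s_0$, the solutions $x(t,s,\bar a(s)\pm\delta)$ are defined on $[s,s_0]$ and $\lim_{s\to-\infty}|\bar a(t)-x(t,s,\bar a(s)\pm\delta)|=0$ for all $t\le s_0$. A solution $\bar r:(\alpha,\infty)\to\mathbb{R}$ ($\alpha\ge-\infty$) is locally pullback repulsive if there exist $s_0>\alpha$ and $\delta>0$ such that, if $s\ge s_0$, the solutions $x(t,s,\bar r(s)\pm\delta)$ are defined on $[s_0,s]$ and $\lim_{s\to\infty}|\bar r(t)-x(t,s,\bar r(s)\pm\delta)|=0$ for all $t\ge s_0$. *)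

theory Defs
  imports "HOL-Analysis.Analysis"
begin

text \<open>
  The suprema in (f2), (f3), (f6) and (f7) are taken in \<^typ>\<open>ereal\<close>, so that an unbounded set
  has supremum \<open>\<infinity>\<close> (on \<^typ>\<open>real\<close> it would have an unspecified value) and the empty set, which
  occurs for \<open>j = 0\<close>, has supremum \<open>- \<infinity>\<close>.
\<close>

definition partial_x :: "(real \<Rightarrow> real \<Rightarrow> real) \<Rightarrow> real \<Rightarrow> real \<Rightarrow> real" where
  "partial_x f t x = deriv (f t) x"

definition cond_f1 :: "(real \<Rightarrow> real \<Rightarrow> real) \<Rightarrow> bool" where
  "cond_f1 f \<longleftrightarrow> (\<lambda>(t, x). f t x) \<in> borel_measurable borel"

definition cond_f2 :: "(real \<Rightarrow> real \<Rightarrow> real) \<Rightarrow> bool" where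
  "cond_f2 f \<longleftrightarrow>
     (\<forall>j::nat. \<exists>m::real. AE t in lebesgue.
        (SUP x\<in>{- real j..real j}. ereal \<bar>f t x\<bar>) \<le> ereal m)"

definition distinct_pairs :: "nat \<Rightarrow> (real \<times> real) set" where
  "distinct_pairs j =
     {(x1, x2). x1 \<in> {- real j..real j} \<and> x2 \<in> {- real j..real j} \<and> x1 \<noteq> x2}"

definition cond_f3 :: "(real \<Rightarrow> real \<Rightarrow> real) \<Rightarrow> bool" where
  "cond_f3 f \<longleftrightarrow>
     (\<forall>j::nat. \<exists>l::real. AE t in lebesgue.
        (SUP (x1, x2)\<in>distinct_pairs j. ereal (\<bar>f t x2 - f t x1\<bar> / \<bar>x2 - x1\<bar>)) \<le> ereal l)"

definition cond_f4 :: "(real \<Rightarrow> real \<Rightarrow> real) \<Rightarrow> bool" where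
  "cond_f4 f \<longleftrightarrow> (AE t in lebesgue. f t C1_differentiable_on UNIV)"

definition cond_f5 :: "(real \<Rightarrow> real \<Rightarrow> real) \<Rightarrow> bool" where
  "cond_f5 f \<longleftrightarrow> cond_f3 (partial_x f)"

text \<open>Uniformity in \<open>t\<close> of the upper limit: it is the upper limit of the supremum over \<open>t\<close>.\<close>

definition cond_f6 :: "(real \<Rightarrow> real \<Rightarrow> real) \<Rightarrow> bool" where
  "cond_f6 f \<longleftrightarrow>
     (\<exists>(R :: real set) (\<delta> :: real). - R \<in> null_sets lebesgue \<and> \<delta> > 0 \<and>
        Limsup at_top (\<lambda>x. SUP t\<in>R. ereal (f t x / x\<^sup>2)) < ereal (- \<delta>) \<and>
        Limsup at_bot (\<lambda>x. SUP t\<in>R. ereal (f t x / x\<^sup>2)) < ereal (- \<delta>))"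

definition cond_f7 :: "(real \<Rightarrow> real \<Rightarrow> real) \<Rightarrow> bool" where
  "cond_f7 f \<longleftrightarrow>
     (\<forall>j::nat. \<exists>\<delta>::real. \<delta> > 0 \<and> (AE t in lebesgue.
        (SUP (x1, x2)\<in>distinct_pairs j.
           ereal ((partial_x f t x2 - partial_x f t x1) / (x2 - x1))) < ereal (- \<delta>)))"

definition conditions_f1_f7 :: "(real \<Rightarrow> real \<Rightarrow> real) \<Rightarrow> bool" where
  "conditions_f1_f7 f \<longleftrightarrow>
     cond_f1 f \<and> cond_f2 f \<and> cond_f3 f \<and> cond_f4 f \<and> cond_f5 f \<and> cond_f6 f \<and> cond_f7 f"

text \<open>
  \<open>\<Delta>\<close> is an actual function, not an a.e.-class, since its pointwise limits at infinity are used.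
\<close>

definition L_infinity :: "(real \<Rightarrow> real) \<Rightarrow> bool" where
  "L_infinity \<Delta> \<longleftrightarrow>
     \<Delta> \<in> borel_measurable lebesgue \<and> (\<exists>M. AE t in lebesgue. \<bar>\<Delta> t\<bar> \<le> M)"

definition shifted :: "(real \<Rightarrow> real \<Rightarrow> real) \<Rightarrow> (real \<Rightarrow> real) \<Rightarrow> real \<Rightarrow> real \<Rightarrow> real" where
  "shifted f \<Delta> t x = f t (x - \<Delta> t)"

text \<open>A finite family of non-overlapping intervals is given by its set of pairs of end points.\<close>

definition absolutely_continuous_fun_on :: "real \<Rightarrow> real \<Rightarrow> (real \<Rightarrow> real) \<Rightarrow> bool" where
  "absolutely_continuous_fun_on c d x \<longleftrightarrow>
     (\<forall>\<epsilon>>0. \<exists>\<delta>>0. \<forall>I :: (real \<times> real) set.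
        finite I \<and> (\<forall>(u, v)\<in>I. c \<le> u \<and> u < v \<and> v \<le> d) \<and>
        disjoint_family_on (\<lambda>(u, v). {u<..<v}) I \<and> (\<Sum>(u, v)\<in>I. v - u) < \<delta> \<longrightarrow>
        (\<Sum>(u, v)\<in>I. \<bar>x v - x u\<bar>) < \<epsilon>)"

text \<open>
  A solution is a pair of a domain \<open>J\<close> and a total function \<open>x\<close>, whose values outside \<open>J\<close> are
  irrelevant.
\<close>

definition solution_on :: "(real \<Rightarrow> real \<Rightarrow> real) \<Rightarrow> real set \<Rightarrow> (real \<Rightarrow> real) \<Rightarrow> bool" where
  "solution_on g J x \<longleftrightarrow>
     is_interval J \<and>
     (\<forall>c d. {c..d} \<subseteq> J \<longrightarrow> absolutely_continuous_fun_on c d x) \<and>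
     (AE t in lebesgue. t \<in> J \<longrightarrow> (x has_real_derivative g t (x t)) (at t within J))"

definition maximal_solution :: "(real \<Rightarrow> real \<Rightarrow> real) \<Rightarrow> real set \<Rightarrow> (real \<Rightarrow> real) \<Rightarrow> bool" where
  "maximal_solution g J x \<longleftrightarrow>
     solution_on g J x \<and>
     (\<forall>K y. solution_on g K y \<and> J \<subseteq> K \<and> (\<forall>t\<in>J. y t = x t) \<longrightarrow> K = J)"

text \<open>
  Domain and values of the maximal solution \<open>t \<mapsto> x(t, s, x0)\<close>. Under (f1)--(f3) the domain, and the
  values on it, do not depend on the choice made by the \<open>SOME\<close> operator.
\<close>

definition maximal_solution_from ::
    "(real \<Rightarrow> real \<Rightarrow> real) \<Rightarrow> real \<Rightarrow> real \<Rightarrow> real set \<times> (real \<Rightarrow> real)" where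
  "maximal_solution_from g s x0 = (SOME (J, x). maximal_solution g J x \<and> s \<in> J \<and> x s = x0)"

definition sol_dom :: "(real \<Rightarrow> real \<Rightarrow> real) \<Rightarrow> real \<Rightarrow> real \<Rightarrow> real set" where
  "sol_dom g s x0 = fst (maximal_solution_from g s x0)"

definition sol :: "(real \<Rightarrow> real \<Rightarrow> real) \<Rightarrow> real \<Rightarrow> real \<Rightarrow> real \<Rightarrow> real" where
  "sol g s x0 = snd (maximal_solution_from g s x0)"

definition bounded_solution :: "(real \<Rightarrow> real \<Rightarrow> real) \<Rightarrow> (real \<Rightarrow> real) \<Rightarrow> bool" where
  "bounded_solution g b \<longleftrightarrow> solution_on g UNIV b \<and> bounded (range b)"

definition bounded_in_past :: "real set \<Rightarrow> (real \<Rightarrow> real) \<Rightarrow> bool" where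
  "bounded_in_past J x \<longleftrightarrow> (\<exists>T. {..T} \<subseteq> J \<and> bounded (x ` {..T}))"

definition bounded_in_future :: "real set \<Rightarrow> (real \<Rightarrow> real) \<Rightarrow> bool" where
  "bounded_in_future J x \<longleftrightarrow> (\<exists>T. {T..} \<subseteq> J \<and> bounded (x ` {T..}))"

text \<open>\<open>upper_past_solution g J a\<close> says that \<open>a\<close>, with domain \<open>J\<close>, is the upper solution bounded in
  the past of \<open>x' = g(t, x)\<close>; \<open>lower_future_solution g J r\<close> is the counterpart in the future.\<close>

definition upper_past_solution :: "(real \<Rightarrow> real \<Rightarrow> real) \<Rightarrow> real set \<Rightarrow> (real \<Rightarrow> real) \<Rightarrow> bool" where
  "upper_past_solution g J a \<longleftrightarrow>
     (J = UNIV \<or> (\<exists>\<beta>. J = {..<\<beta>})) \<and>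
     maximal_solution g J a \<and>
     (\<forall>s\<in>J. \<forall>x0. bounded_in_past (sol_dom g s x0) (sol g s x0) \<longleftrightarrow> x0 \<le> a s) \<and>
     (\<forall>\<beta>. J = {..<\<beta>} \<longrightarrow> filterlim a at_bot (at_left \<beta>))"

definition lower_future_solution :: "(real \<Rightarrow> real \<Rightarrow> real) \<Rightarrow> real set \<Rightarrow> (real \<Rightarrow> real) \<Rightarrow> bool" where
  "lower_future_solution g J r \<longleftrightarrow>
     (J = UNIV \<or> (\<exists>\<alpha>. J = {\<alpha><..})) \<and>
     maximal_solution g J r \<and>
     (\<forall>s\<in>J. \<forall>x0. bounded_in_future (sol_dom g s x0) (sol g s x0) \<longleftrightarrow> x0 \<ge> r s) \<and>
     (\<forall>\<alpha>. J = {\<alpha><..} \<longrightarrow> filterlim r at_top (at_right \<alpha>))"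

text \<open>
  The integral is oriented, so it equals minus the integral over \<open>{t..s}\<close> if \<open>t \<le> s\<close>. It is taken
  with respect to \<^term>\<open>lebesgue\<close> and not \<^term>\<open>lborel\<close>: on the null set of those \<open>l\<close> for which \<open>g l\<close> is
  not differentiable, \<^const>\<open>deriv\<close> is arbitrary, so that the integrand need not be Borel measurable.
\<close>

definition hyperbolic_attractive :: "(real \<Rightarrow> real \<Rightarrow> real) \<Rightarrow> (real \<Rightarrow> real) \<Rightarrow> bool" where
  "hyperbolic_attractive g b \<longleftrightarrow>
     bounded_solution g b \<and>
     (\<exists>k \<beta>. k \<ge> 1 \<and> \<beta> > 0 \<and> (\<forall>s t. t \<ge> s \<longrightarrow>
        exp (LINT l=ereal s..ereal t|lebesgue. partial_x g l (b l)) \<le> k * exp (- \<beta> * (t - s))))"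

definition hyperbolic_repulsive :: "(real \<Rightarrow> real \<Rightarrow> real) \<Rightarrow> (real \<Rightarrow> real) \<Rightarrow> bool" where
  "hyperbolic_repulsive g b \<longleftrightarrow>
     bounded_solution g b \<and>
     (\<exists>k \<beta>. k \<ge> 1 \<and> \<beta> > 0 \<and> (\<forall>s t. t \<le> s \<longrightarrow>
        exp (LINT l=ereal s..ereal t|lebesgue. partial_x g l (b l)) \<le> k * exp (\<beta> * (t - s))))"

definition hyperbolic_solution :: "(real \<Rightarrow> real \<Rightarrow> real) \<Rightarrow> (real \<Rightarrow> real) \<Rightarrow> bool" where
  "hyperbolic_solution g b \<longleftrightarrow> hyperbolic_attractive g b \<or> hyperbolic_repulsive g b"

definition attractor_repeller_pair ::
    "(real \<Rightarrow> real \<Rightarrow> real) \<Rightarrow> (real \<Rightarrow> real) \<Rightarrow> (real \<Rightarrow> real) \<Rightarrow> bool" where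
  "attractor_repeller_pair g a r \<longleftrightarrow>
     upper_past_solution g UNIV a \<and> lower_future_solution g UNIV r \<and>
     hyperbolic_attractive g a \<and> hyperbolic_repulsive g r"

definition uniformly_separated :: "(real \<Rightarrow> real) \<Rightarrow> (real \<Rightarrow> real) \<Rightarrow> bool" where
  "uniformly_separated a r \<longleftrightarrow> (INF t. ereal (a t - r t)) > 0"

definition locally_pullback_attractive ::
    "(real \<Rightarrow> real \<Rightarrow> real) \<Rightarrow> real set \<Rightarrow> (real \<Rightarrow> real) \<Rightarrow> bool" where
  "locally_pullback_attractive g J a \<longleftrightarrow>
     (J = UNIV \<or> (\<exists>\<beta>. J = {..<\<beta>})) \<and> solution_on g J a \<and>
     (\<exists>s0\<in>J. \<exists>\<delta>>0. \<forall>\<sigma>\<in>{\<delta>, - \<delta>}.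
        (\<forall>s\<le>s0. {s..s0} \<subseteq> sol_dom g s (a s + \<sigma>)) \<and>
        (\<forall>t\<le>s0. ((\<lambda>s. \<bar>a t - sol g s (a s + \<sigma>) t\<bar>) \<longlongrightarrow> 0) at_bot))"

definition locally_pullback_repulsive ::
    "(real \<Rightarrow> real \<Rightarrow> real) \<Rightarrow> real set \<Rightarrow> (real \<Rightarrow> real) \<Rightarrow> bool" where
  "locally_pullback_repulsive g J r \<longleftrightarrow>
     (J = UNIV \<or> (\<exists>\<alpha>. J = {\<alpha><..})) \<and> solution_on g J r \<and>
     (\<exists>s0\<in>J. \<exists>\<delta>>0. \<forall>\<sigma>\<in>{\<delta>, - \<delta>}.
        (\<forall>s\<ge>s0. {s0..s} \<subseteq> sol_dom g s (r s + \<sigma>)) \<and>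
        (\<forall>t\<ge>s0. ((\<lambda>s. \<bar>r t - sol g s (r s + \<sigma>) t\<bar>) \<longlongrightarrow> 0) at_top))"

end

theory Submission
  imports Defs
begin

text \<open>
  Put \<open>y = r + \<lambda> (a - r)\<close>. By strict concavity the chord defect of \<open>f(t, \<cdot>)\<close> makes \<open>y\<close>, for constant
  \<open>\<lambda>\<close>, a strict subsolution of \<open>x' = f(t, x)\<close> if \<open>0 < \<lambda> < 1\<close> and a strict supersolution if \<open>\<lambda> < 0\<close> or
  \<open>\<lambda> > 1\<close>. In the past \<open>(E\<^sub>\<Delta>)\<close> is the equation \<open>x' = f(t, x - \<delta>\<^sub>-)\<close> up to an error of the order of
  \<open>\<Delta>(t) - \<delta>\<^sub>-\<close>, so the coordinate \<open>\<lambda>\<close> of \<open>x - \<delta>\<^sub>-\<close> satisfies \<open>\<lambda>' \<ge> c \<lambda> (1 - \<lambda>) - o(1)\<close> for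
  \<open>0 \<le> \<lambda> \<le> 1\<close> and the opposite inequality, with \<open>+ o(1)\<close>, elsewhere. The resulting barriers give a
  solution bounded in the past and force \<open>\<lambda>\<close> to tend to \<open>1\<close> along the upper one and to \<open>0\<close> along those
  below it; a contraction near \<open>\<lambda> = 1\<close> excludes other limits and gives pullback attraction. The
  statements for the future follow by the time reversal \<open>x(t) \<mapsto> - x(- t)\<close>. If both special solutions are
  global and different, they follow \<open>a\<close> and \<open>r\<close> at both ends, so they are separated and inherit the
  exponents of \<open>a\<close> and \<open>r\<close>.
\<close>

section \<open>Absolutely continuous and Lipschitz functions\<close>

text \<open>Dividing by \<open>a - r\<close> needs a uniform gap, but a pair is defined by
  exponents, so the gap has to be derived from them. As \<open>a\<close> and \<open>r\<close> solve
  the same equation, all linear terms cancel in the derivative of \<lambda>, and only the chord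
  defect and the error of replacing \<Delta> by its limit remain. Barriers alone leave two
  possibilities for a solution below the upper one: \<lambda> tends to 0, or it stays near 1 at all
  past times. In the second case two solutions would stay close to \<open>a\<close>; forward
  contraction means exponential separation backward, which contradicts their staying close. Since
  \<Delta> is merely Lebesgue measurable, the shifted field need not be Borel; the theory of
  solutions therefore rests on measurability of the field along functions. The field is bounded on
  bounded sets, uniformly in almost every \<open>t\<close>; hence solutions are locally Lipschitz
  and existence times are uniform. Changing both signs in the reversal keeps concavity and
  dissipation and exchanges the roles of \<open>a\<close> and \<open>r\<close>. Exponents survive
  the perturbation because the linearizations differ by at most \<epsilon> outside a compact
  interval, which costs half of the exponent and a larger constant.\<close>

lemma absolutely_continuous_fun_on_has_integral:
  fixes x h :: "real \<Rightarrow> real"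
  assumes cd: "c \<le> d" and ac: "absolutely_continuous_fun_on c d x"
    and der: "AE t in lebesgue. t \<in> {c<..<d} \<longrightarrow> (x has_real_derivative h t) (at t)"
  shows "(h has_integral (x d - x c)) {c..d}"
proof -
  obtain N0 where N0: "negligible N0"
      and N0d: "\<And>t. t \<notin> N0 \<Longrightarrow> t \<in> {c<..<d} \<Longrightarrow> (x has_real_derivative h t) (at t)"
    using der unfolding eventually_ae_filter_negligible by blast
  \<comment> \<open>The end points join the null set because differentiability is assumed only
    inside.\<close>
  define N where "N = N0 \<union> {c, d}"
  have N: "negligible N" unfolding N_def using N0 by (simp add: negligible_Un)
  have Nd: "(x has_real_derivative h t) (at t)" if "t \<notin> N" "t \<in> {c..d}" for t
    using that N0d unfolding N_def by auto
  define h' where "h' t = (if t \<in> N then 0 else h t)" for t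
  have "(h' has_integral (x d - x c)) {c..d}"
    unfolding has_integral_real
  proof (intro allI impI)
    fix e :: real assume e: "e > 0"
    define e' where "e' = e / (2 * (d - c + 1))"
    have e': "e' > 0" "e' * (d - c) < e / 2"
      using e cd unfolding e'_def by (auto simp: field_simps)
    obtain \<delta> where \<delta>: "\<delta> > 0" and ac\<delta>: "\<forall>I :: (real \<times> real) set.
        finite I \<and> (\<forall>(u, v)\<in>I. c \<le> u \<and> u < v \<and> v \<le> d) \<and>
        disjoint_family_on (\<lambda>(u, v). {u<..<v}) I \<and> (\<Sum>(u, v)\<in>I. v - u) < \<delta> \<longrightarrow>
        (\<Sum>(u, v)\<in>I. \<bar>x v - x u\<bar>) < e / 2"
      using ac[unfolded absolutely_continuous_fun_on_def, THEN spec, THEN mp, OF half_gt_zero[OF e]]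
      by blast
    \<comment> \<open>Outer regularity of Lebesgue measure. Fine intervals tagged in
      \<open>N\<close> lie in \<open>U\<close>, so their total length is below the \<delta> of
      absolute continuity.\<close>
    obtain U where U: "open U" "N \<subseteq> U" "U \<in> lmeasurable" "measure lebesgue U < \<delta>"
    proof -
      have N2: "N \<in> lmeasurable" "measure lebesgue N = 0"
        using N negligible_iff_measure by auto
      then obtain U where U: "open U" "N \<subseteq> U" "U - N \<in> lmeasurable" "emeasure lebesgue (U - N) < ennreal \<delta>"
        using sets_lebesgue_outer_open[of N \<delta>] \<delta> by blast
      have "U = N \<union> (U - N)" using U by blast
      then have "U \<in> lmeasurable" using N2 U by (metis fmeasurable.Un)
      moreover have "measure lebesgue (U - N) < \<delta>"
        using U \<delta> by (simp add: emeasure_eq_measure2 ennreal_less_iff)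
      then have "measure lebesgue U < \<delta>"
        using measure_Un_le[of N lebesgue "U - N"] N2 U \<open>U = N \<union> (U - N)\<close> by auto
      ultimately show ?thesis using that U by blast
    qed
    have "\<exists>\<eta>>0. \<forall>u. \<bar>u - t\<bar> < \<eta> \<longrightarrow> \<bar>x u - x t - h t * (u - t)\<bar> \<le> e' * \<bar>u - t\<bar>"
      if "t \<notin> N" "t \<in> {c..d}" for t
    proof -
      have "(x has_derivative (*) (h t)) (at t)"
        using Nd[OF that] by (simp add: has_field_derivative_def)
      then have "\<forall>e>0. \<exists>d>0. \<forall>u. norm (u - t) < d \<longrightarrow>
          norm (x u - x t - h t * (u - t)) \<le> e * norm (u - t)"
        unfolding has_derivative_at_alt by blast
      then show ?thesis using e' by auto
    qed
    then obtain \<eta> where \<eta>0: "\<And>t. t \<notin> N \<Longrightarrow> t \<in> {c..d} \<Longrightarrow> \<eta> t > 0"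
      and \<eta>: "\<And>t u. t \<notin> N \<Longrightarrow> t \<in> {c..d} \<Longrightarrow> \<bar>u - t\<bar> < \<eta> t \<Longrightarrow>
         \<bar>x u - x t - h t * (u - t)\<bar> \<le> e' * \<bar>u - t\<bar>"
      by metis
    define \<gamma> where "\<gamma> t = (if t \<in> N then U else if t \<in> {c..d} then ball t (\<eta> t) else UNIV)" for t
    have "gauge \<gamma>"
      unfolding gauge_def \<gamma>_def using U \<eta>0 by (auto simp: subset_iff)
    moreover have "norm (sum (\<lambda>(t,k). measure lborel k *\<^sub>R h' t) D - (x d - x c)) < e"
      if D: "D tagged_division_of {c..d}" and fine: "\<gamma> fine D" for D
    proof -
      note td = tagged_division_ofD[OF D]
      have fin: "finite D" using td(1) .
      have K: "\<exists>u v. k = {u..v} \<and> u \<le> t \<and> t \<le> v \<and> Inf k = u \<and> Sup k = v \<and> c \<le> u \<and> v \<le> d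
          \<and> measure lborel k = v - u \<and> t \<in> {c..d}"
        if tk: "(t, k) \<in> D" for t k
      proof -
        obtain u v where k: "k = cbox u v" using td(4)[OF tk] by blast
        have t: "t \<in> k" using td(2)[OF tk] .
        have "k \<subseteq> {c..d}" using td(3)[OF tk] .
        with k t show ?thesis by (intro exI[of _ u] exI[of _ v]) auto
      qed
      \<comment> \<open>Degenerate intervals are left out: they have no increment, absolute
        continuity speaks only of \<open>u < v\<close>, and the passage to end points is injective
        only without them.\<close>
      define I where "I = (\<lambda>(t, k). (Inf k, Sup k)) ` {(t, k) \<in> D. t \<in> N \<and> Inf k < Sup k}"
      let ?D1 = "{(t, k) \<in> D. t \<in> N \<and> Inf k < Sup k}"
      have finD1: "finite ?D1" using fin by (rule rev_finite_subset) auto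
      have disj: "{Inf k<..<Sup k} \<inter> {Inf k'<..<Sup k'} = {}"
        if "(t, k) \<in> D" "(t', k') \<in> D" "(t, k) \<noteq> (t', k')" for t k t' k'
      proof -
        have "interior k \<inter> interior k' = {}" using td(5) that by blast
        moreover have "k = {Inf k..Sup k}" "k' = {Inf k'..Sup k'}"
          using K[OF that(1)] K[OF that(2)] by auto
        ultimately show ?thesis using interior_atLeastAtMost_real by metis
      qed
      have inj: "inj_on (\<lambda>(t, k). (Inf k, Sup k)) ?D1"
      proof (rule inj_onI, clarify)
        fix t k t' k' assume *: "(t, k) \<in> D" "(t', k') \<in> D" "Inf k < Sup k"
          "Inf k = Inf k'" "Sup k = Sup k'"
        show "t = t' \<and> k = k'"
        proof (rule ccontr)
          assume "\<not> (t = t' \<and> k = k')"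
          then have "{Inf k<..<Sup k} \<inter> {Inf k'<..<Sup k'} = {}" using disj * by blast
          then show False using * by simp
        qed
      qed
      have finI: "finite I" unfolding I_def using finD1 by blast
      have I1: "\<forall>(u, v)\<in>I. c \<le> u \<and> u < v \<and> v \<le> d"
      proof
        fix p assume "p \<in> I"
        then obtain t k where *: "(t, k) \<in> D" "p = (Inf k, Sup k)" "Inf k < Sup k"
          unfolding I_def by auto
        show "case p of (u, v) \<Rightarrow> c \<le> u \<and> u < v \<and> v \<le> d" using K[OF *(1)] *(2,3) by auto
      qed
      have dI: "disjoint_family_on (\<lambda>(u, v). {u<..<v}) I"
        unfolding disjoint_family_on_def I_def
      proof (intro ballI impI)
        fix p q assume "p \<in> (\<lambda>(t, k). (Inf k, Sup k)) ` ?D1"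
          and "q \<in> (\<lambda>(t, k). (Inf k, Sup k)) ` ?D1" and "p \<noteq> q"
        then obtain t k t' k' where *: "(t, k) \<in> D" "(t', k') \<in> D"
            "p = (Inf k, Sup k)" "q = (Inf k', Sup k')" "(t, k) \<noteq> (t', k')"
          by auto
        show "(case p of (u, v) \<Rightarrow> {u<..<v}) \<inter> (case q of (u, v) \<Rightarrow> {u<..<v}) = {}"
          using disj[OF *(1,2,5)] *(3,4) by (simp only: prod.case)
      qed
      have "(\<Sum>(u, v)\<in>I. v - u) = (\<Sum>p\<in>I. measure lebesgue (case p of (u, v) \<Rightarrow> {u<..<v}))"
        using I1 by (intro sum.cong) auto
      also have "\<dots> = measure lebesgue (\<Union>p\<in>I. case p of (u, v) \<Rightarrow> {u<..<v})"
      proof (rule measure_finite_Union[symmetric, OF finI _ dI])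
        show "emeasure lebesgue (case p of (u, v) \<Rightarrow> {u<..<v}) \<noteq> \<infinity>" if "p \<in> I" for p
          using I1 that by (cases p) (auto simp: emeasure_lborel_Ioo)
      qed auto
      also have "\<dots> \<le> measure lebesgue U"
      proof (rule measure_mono_fmeasurable)
        show "(\<Union>p\<in>I. case p of (u, v) \<Rightarrow> {u<..<v}) \<subseteq> U"
        proof
          fix y assume "y \<in> (\<Union>p\<in>I. case p of (u, v) \<Rightarrow> {u<..<v})"
          then obtain t k where tk: "(t, k) \<in> D" "t \<in> N" "y \<in> {Inf k<..<Sup k}"
            unfolding I_def by auto
          have "k \<subseteq> \<gamma> t" using fine tk unfolding fine_def by blast
          then show "y \<in> U" using tk K[OF tk(1)] unfolding \<gamma>_def by auto
        qed
        show "(\<Union>p\<in>I. case p of (u, v) \<Rightarrow> {u<..<v}) \<in> sets lebesgue"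
          using finI by (intro sets.finite_UN) (auto split: prod.splits)
      qed fact
      also have "\<dots> < \<delta>" by fact
      finally have "(\<Sum>(u, v)\<in>I. \<bar>x v - x u\<bar>) < e / 2"
        using ac\<delta>[rule_format, OF conjI[OF finI conjI[OF I1 conjI[OF dI]]]] by simp
      moreover have "(\<Sum>(u, v)\<in>I. \<bar>x v - x u\<bar>) = (\<Sum>(t, k)\<in>?D1. \<bar>x (Sup k) - x (Inf k)\<bar>)"
        unfolding I_def by (subst sum.reindex[OF inj]) (auto intro!: sum.cong)
      ultimately have s1: "(\<Sum>(t, k)\<in>?D1. \<bar>x (Sup k) - x (Inf k)\<bar>) < e / 2" by simp
      \<comment> \<open>For a tag in \<open>N\<close> the integrand is 0 and the error is the
        increment itself, controlled through \<open>U\<close>. Otherwise the straddle estimate at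
        the tag bounds the error by \<open>e'\<close> times the length.\<close>
      have bd: "\<bar>measure lborel k *\<^sub>R h' t - (x (Sup k) - x (Inf k))\<bar> \<le>
          (if (t, k) \<in> ?D1 then \<bar>x (Sup k) - x (Inf k)\<bar> else 0) + e' * (Sup k - Inf k)"
        if tk: "(t, k) \<in> D" for t k
      proof -
        obtain u v where uv: "k = {u..v}" "u \<le> t" "t \<le> v" "Inf k = u" "Sup k = v"
          "measure lborel k = v - u" "t \<in> {c..d}" using K[OF tk] by blast
        show ?thesis
        proof (cases "t \<in> N")
          case True
          have "e' * (v - u) \<ge> 0" using e' uv by simp
          then show ?thesis using True uv tk unfolding h'_def by (cases "u = v") auto
        next
          case False
          have "k \<subseteq> \<gamma> t" using fine tk unfolding fine_def by blast
          then have "u \<in> ball t (\<eta> t)" "v \<in> ball t (\<eta> t)"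
            using False uv unfolding \<gamma>_def by (auto simp: subset_iff simp del: mem_ball)
          then have "\<bar>u - t\<bar> < \<eta> t" "\<bar>v - t\<bar> < \<eta> t"
            by (auto simp: dist_real_def)
          then have "\<bar>x u - x t - h t * (u - t)\<bar> \<le> e' * \<bar>u - t\<bar>"
              "\<bar>x v - x t - h t * (v - t)\<bar> \<le> e' * \<bar>v - t\<bar>"
            using \<eta>[OF False uv(7)] by simp_all
          moreover have "e' * \<bar>u - t\<bar> + e' * \<bar>v - t\<bar> = e' * (v - u)"
            using uv by (simp add: algebra_simps)
          moreover have "(v - u) * h t - (x v - x u) =
              (x u - x t - h t * (u - t)) - (x v - x t - h t * (v - t))"
            by (simp add: algebra_simps)
          ultimately show ?thesis using False uv unfolding h'_def by auto
        qed
      qed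
      have "x d - x c = (\<Sum>(t, k)\<in>D. x (Sup k) - x (Inf k))"
        using additive_tagged_division_1[OF cd D, of x] by simp
      then have "norm (sum (\<lambda>(t,k). measure lborel k *\<^sub>R h' t) D - (x d - x c)) =
          \<bar>\<Sum>(t, k)\<in>D. measure lborel k *\<^sub>R h' t - (x (Sup k) - x (Inf k))\<bar>"
        by (simp add: sum_subtractf case_prod_unfold)
      also have "\<dots> \<le> (\<Sum>(t, k)\<in>D. \<bar>measure lborel k *\<^sub>R h' t - (x (Sup k) - x (Inf k))\<bar>)"
        by (rule order_trans[OF sum_abs]) (simp add: case_prod_unfold)
      also have "\<dots> \<le> (\<Sum>(t, k)\<in>D. (if (t, k) \<in> ?D1 then \<bar>x (Sup k) - x (Inf k)\<bar> else 0)
          + e' * (Sup k - Inf k))"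
        by (rule sum_mono) (use bd in \<open>auto\<close>)
      also have "\<dots> = (\<Sum>(t, k)\<in>?D1. \<bar>x (Sup k) - x (Inf k)\<bar>) + e' * (\<Sum>(t, k)\<in>D. Sup k - Inf k)"
      proof -
        have "(\<Sum>p\<in>D. if p \<in> ?D1 then \<bar>x (Sup (snd p)) - x (Inf (snd p))\<bar> else 0)
            = (\<Sum>p\<in>D \<inter> ?D1. \<bar>x (Sup (snd p)) - x (Inf (snd p))\<bar>)"
          using fin by (rule sum.inter_restrict[symmetric])
        moreover have "D \<inter> ?D1 = ?D1" by auto
        ultimately show ?thesis
          by (simp add: sum.distrib case_prod_unfold sum_distrib_left)
      qed
      also have "(\<Sum>(t, k)\<in>D. Sup k - Inf k) = d - c"
        using additive_tagged_division_1[OF cd D, of "\<lambda>x. x"] by simp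
      finally show ?thesis using s1 e' by linarith
    qed
    ultimately show "\<exists>\<gamma>. gauge \<gamma> \<and> (\<forall>D. D tagged_division_of {c..d} \<and> \<gamma> fine D \<longrightarrow>
        norm (sum (\<lambda>(x,k). measure lborel k *\<^sub>R h' x) D - (x d - x c)) < e)"
      by (intro exI[of _ \<gamma>] conjI allI impI) simp_all
  qed
  then show ?thesis
    by (rule has_integral_spike[OF N, rotated]) (auto simp: h'_def)
qed


lemma AE_lebesgue_reflect:
  assumes "AE t in lebesgue. P (t::real)"
  shows "AE t in lebesgue. P (- t)"
proof -
  obtain N where N: "negligible N" "{t. \<not> P t} \<subseteq> N"
    using assms unfolding eventually_ae_filter_negligible by auto
  have "negligible (uminus ` N)"
    by (rule negligible_differentiable_image_negligible[OF _ N(1)])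
       (auto intro!: differentiable_on_minus differentiable_on_id)
  moreover have "{t. \<not> P (- t)} \<subseteq> uminus ` N"
    using N(2) by (force simp: image_iff)
  ultimately show ?thesis unfolding eventually_ae_filter_negligible by auto
qed

lemma AE_lebesgue_not_in: "negligible N \<Longrightarrow> AE t in lebesgue. t \<notin> N"
  unfolding eventually_ae_filter_negligible by auto

lemma AE_lebesgue_neq: "AE t in lebesgue. t \<noteq> (c::real)"
  using AE_lebesgue_not_in[of "{c}"] by simp

section \<open>Calculus of Lipschitz functions on compact intervals\<close>

text \<open>Solutions are locally Lipschitz, so this class suffices for all differential
  inequalities below. The predicate holds trivially if \<open>d < c\<close>.\<close>

definition lip_on :: "real \<Rightarrow> real \<Rightarrow> (real \<Rightarrow> real) \<Rightarrow> bool" where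
  "lip_on c d x \<longleftrightarrow> (\<exists>L. L-lipschitz_on {c..d} x)"

lemma lip_onE:
  assumes "lip_on c d x"
  obtains L where "L \<ge> 0" "\<And>u v. u \<in> {c..d} \<Longrightarrow> v \<in> {c..d} \<Longrightarrow> \<bar>x u - x v\<bar> \<le> L * \<bar>u - v\<bar>"
  using assms unfolding lip_on_def lipschitz_on_def dist_real_def by blast

lemma lip_onI:
  assumes "\<And>u v. c \<le> u \<Longrightarrow> u < v \<Longrightarrow> v \<le> d \<Longrightarrow> \<bar>x v - x u\<bar> \<le> L * (v - u)"
  shows "lip_on c d x"
  unfolding lip_on_def
proof (intro exI lipschitz_onI)
  fix u v assume uv: "u \<in> {c..d}" "v \<in> {c..d}"
  have *: "L * r \<le> max L 0 * r" if "r \<ge> 0" for r using that by (simp add: mult_right_mono)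
  consider "u < v" | "u = v" | "v < u" by linarith
  then show "dist (x u) (x v) \<le> max L 0 * dist u v"
  proof cases
    case 1
    then show ?thesis using order_trans[OF assms[of u v] *[of "v - u"]] uv
      by (simp add: dist_real_def abs_minus_commute)
  next
    case 3
    then show ?thesis using order_trans[OF assms[of v u] *[of "u - v"]] uv
      by (simp add: dist_real_def abs_minus_commute)
  qed simp
qed simp

lemma lip_on_subset: "lip_on c d x \<Longrightarrow> {c'..d'} \<subseteq> {c..d} \<Longrightarrow> lip_on c' d' x"
  unfolding lip_on_def using lipschitz_on_subset by blast

lemma lip_on_continuous: "lip_on c d x \<Longrightarrow> continuous_on {c..d} x"
  unfolding lip_on_def using lipschitz_on_continuous_on by blast

lemma lip_on_bounded:
  assumes "lip_on c d x"
  obtains B where "B \<ge> 0" "\<And>t. t \<in> {c..d} \<Longrightarrow> \<bar>x t\<bar> \<le> B"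
proof -
  have "bounded (x ` {c..d})"
    using lip_on_continuous[OF assms] compact_continuous_image compact_imp_bounded by blast
  then obtain B where B: "\<forall>y\<in>x ` {c..d}. norm y \<le> B"
    unfolding bounded_iff by blast
  show ?thesis by (rule that[of "max B 0"]) (use B in force)+
qed

lemma lip_on_const: "lip_on c d (\<lambda>t. k)"
  by (rule lip_onI[of _ _ _ 0]) auto

lemma lip_on_ident: "lip_on c d (\<lambda>t. t)"
  by (rule lip_onI[of _ _ _ 1]) auto

lemma lip_on_add: "lip_on c d x \<Longrightarrow> lip_on c d y \<Longrightarrow> lip_on c d (\<lambda>t. x t + y t)"
  unfolding lip_on_def using lipschitz_on_add by blast

lemma lip_on_diff: "lip_on c d x \<Longrightarrow> lip_on c d y \<Longrightarrow> lip_on c d (\<lambda>t. x t - y t)"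
  unfolding lip_on_def using lipschitz_on_diff by blast

lemma lip_on_mult:
  assumes "lip_on c d x" "lip_on c d y"
  shows "lip_on c d (\<lambda>t. x t * y t)"
proof -
  obtain A B where A: "A \<ge> 0" "\<And>t. t \<in> {c..d} \<Longrightarrow> \<bar>x t\<bar> \<le> A"
    and B: "B \<ge> 0" "\<And>t. t \<in> {c..d} \<Longrightarrow> \<bar>y t\<bar> \<le> B"
    using lip_on_bounded[OF assms(1)] lip_on_bounded[OF assms(2)] by metis
  obtain L M where L: "L \<ge> 0" "\<And>u v. u \<in> {c..d} \<Longrightarrow> v \<in> {c..d} \<Longrightarrow> \<bar>x u - x v\<bar> \<le> L * \<bar>u - v\<bar>"
    and M: "M \<ge> 0" "\<And>u v. u \<in> {c..d} \<Longrightarrow> v \<in> {c..d} \<Longrightarrow> \<bar>y u - y v\<bar> \<le> M * \<bar>u - v\<bar>"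
    using lip_onE[OF assms(1)] lip_onE[OF assms(2)] by metis
  show ?thesis
  proof (rule lip_onI[where L = "A * M + B * L"])
    fix u v assume uv: "c \<le> u" "u < v" "v \<le> d"
    then have m: "u \<in> {c..d}" "v \<in> {c..d}" by auto
    have "x v * y v - x u * y u = x v * (y v - y u) + (x v - x u) * y u" by (simp add: algebra_simps)
    then have "\<bar>x v * y v - x u * y u\<bar> \<le> \<bar>x v\<bar> * \<bar>y v - y u\<bar> + \<bar>x v - x u\<bar> * \<bar>y u\<bar>"
      by (metis abs_mult abs_triangle_ineq)
    also have "\<dots> \<le> A * (M * (v - u)) + (L * (v - u)) * B"
      using A(2)[OF m(2)] B(2)[OF m(1)] M(2)[OF m(2,1)] L(2)[OF m(2,1)] uv A(1) L(1)
      by (intro add_mono mult_mono) auto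
    finally show "\<bar>x v * y v - x u * y u\<bar> \<le> (A * M + B * L) * (v - u)"
      by (simp add: algebra_simps)
  qed
qed

lemma lip_on_compose_C1:
  assumes x: "lip_on c d x" and xS: "\<And>t. t \<in> {c..d} \<Longrightarrow> x t \<in> {p..q}"
    and F: "\<And>y. y \<in> {p..q} \<Longrightarrow> (F has_real_derivative F' y) (at y)"
    and F': "\<And>y. y \<in> {p..q} \<Longrightarrow> \<bar>F' y\<bar> \<le> M"
  shows "lip_on c d (\<lambda>t. F (x t))"
proof (cases "c \<le> d")
  case True
  then have "\<bar>F' (x c)\<bar> \<le> M" by (intro F' xS) simp
  then have "M \<ge> 0" by linarith
  obtain L where L: "L \<ge> 0" "\<And>u v. u \<in> {c..d} \<Longrightarrow> v \<in> {c..d} \<Longrightarrow> \<bar>x u - x v\<bar> \<le> L * \<bar>u - v\<bar>"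
    using lip_onE[OF x] by metis
  show ?thesis
  proof (rule lip_onI[where L = "M * L"])
    fix u v assume uv: "c \<le> u" "u < v" "v \<le> d"
    have "norm (F (x v) - F (x u)) \<le> M * norm (x v - x u)"
    proof (rule field_differentiable_bound[of "{p..q}"])
      show "(F has_field_derivative F' y) (at y within {p..q})" if "y \<in> {p..q}" for y
        using F[OF that] has_field_derivative_at_within by blast
    qed (use F' xS uv in auto)
    also have "\<dots> \<le> M * (L * (v - u))"
      using L(2)[of v u] uv \<open>M \<ge> 0\<close> by (intro mult_left_mono) auto
    finally show "\<bar>F (x v) - F (x u)\<bar> \<le> M * L * (v - u)" by (simp add: algebra_simps)
  qed
qed (auto simp: lip_on_def intro: exI[of _ 0])

lemma lip_on_exp:
  assumes x: "lip_on c d x"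
  shows "lip_on c d (\<lambda>t. exp (x t))"
proof -
  obtain B where B: "\<And>t. t \<in> {c..d} \<Longrightarrow> \<bar>x t\<bar> \<le> B" using lip_on_bounded[OF x] by blast
  show ?thesis
  proof (rule lip_on_compose_C1[OF x, where F = exp and F' = exp and p = "- B" and q = B and M = "exp B"])
    show "x t \<in> {- B..B}" if "t \<in> {c..d}" for t
      using B[OF that] by (simp add: abs_le_iff minus_le_iff)
  qed (auto intro: DERIV_exp)
qed

lemma lip_on_inverse:
  assumes x: "lip_on c d x" and m: "m > 0" "\<And>t. t \<in> {c..d} \<Longrightarrow> x t \<ge> m"
  shows "lip_on c d (\<lambda>t. inverse (x t))"
proof -
  obtain B where B: "\<And>t. t \<in> {c..d} \<Longrightarrow> \<bar>x t\<bar> \<le> B" using lip_on_bounded[OF x] by blast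
  show ?thesis
  proof (rule lip_on_compose_C1[OF x, where F = inverse and p = m and q = B and M = "inverse (m\<^sup>2)"])
    show "x t \<in> {m..B}" if "t \<in> {c..d}" for t using m(2)[OF that] B[OF that] by auto
    show "(inverse has_real_derivative - (inverse (y\<^sup>2))) (at y)" if "y \<in> {m..B}" for y
      using that m(1) DERIV_inverse[of y] by (simp add: power2_eq_square)
    show "\<bar>- inverse (y\<^sup>2)\<bar> \<le> inverse (m\<^sup>2)" if "y \<in> {m..B}" for y
      using that m(1) by (simp add: power_mono le_imp_inverse_le)
  qed
qed

lemmas lip_on_intros = lip_on_const lip_on_ident lip_on_add lip_on_diff lip_on_mult lip_on_exp

lemma lip_on_union:
  assumes "lip_on c s x" "lip_on s d x" "c \<le> s" "s \<le> d"
  shows "lip_on c d x"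
proof -
  obtain L M where L: "L \<ge> 0" "\<And>u v. u \<in> {c..s} \<Longrightarrow> v \<in> {c..s} \<Longrightarrow> \<bar>x u - x v\<bar> \<le> L * \<bar>u - v\<bar>"
    and M: "M \<ge> 0" "\<And>u v. u \<in> {s..d} \<Longrightarrow> v \<in> {s..d} \<Longrightarrow> \<bar>x u - x v\<bar> \<le> M * \<bar>u - v\<bar>"
    using lip_onE[OF assms(1)] lip_onE[OF assms(2)] by metis
  show ?thesis
  proof (rule lip_onI[where L = "L + M"])
    fix u v assume uv: "c \<le> u" "u < v" "v \<le> d"
    have nn: "L * (v - u) \<ge> 0" "M * (v - u) \<ge> 0" using L M uv by auto
    consider "v \<le> s" | "s \<le> u" | "u < s" "s < v" by linarith
    then show "\<bar>x v - x u\<bar> \<le> (L + M) * (v - u)"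
    proof cases
      case 1 then show ?thesis using L(2)[of v u] uv nn by (auto simp: algebra_simps)
    next
      case 2 then show ?thesis using M(2)[of v u] uv nn by (auto simp: algebra_simps)
    next
      case 3
      have "\<bar>x s - x u\<bar> \<le> L * (s - u)" "\<bar>x v - x s\<bar> \<le> M * (v - s)"
        using L(2)[of s u] M(2)[of v s] 3 uv by auto
      moreover have "L * (s - u) \<le> L * (v - u)" "M * (v - s) \<le> M * (v - u)"
        using L M 3 by (auto intro!: mult_left_mono)
      ultimately show ?thesis by (auto simp: algebra_simps)
    qed
  qed
qed

lemma lip_on_absolutely_continuous:
  assumes "lip_on c d x"
  shows "absolutely_continuous_fun_on c d x"
proof -
  obtain L where L: "L \<ge> 0" "\<And>u v. u \<in> {c..d} \<Longrightarrow> v \<in> {c..d} \<Longrightarrow> \<bar>x u - x v\<bar> \<le> L * \<bar>u - v\<bar>"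
    using lip_onE[OF assms] by metis
  show ?thesis
    unfolding absolutely_continuous_fun_on_def
  proof (intro allI impI)
    fix e :: real assume e: "e > 0"
    show "\<exists>\<delta>>0. \<forall>I. finite I \<and> (\<forall>(u, v)\<in>I. c \<le> u \<and> u < v \<and> v \<le> d) \<and>
        disjoint_family_on (\<lambda>(u, v). {u<..<v}) I \<and> (\<Sum>(u, v)\<in>I. v - u) < \<delta> \<longrightarrow>
        (\<Sum>(u, v)\<in>I. \<bar>x v - x u\<bar>) < e"
    proof (intro exI[of _ "e / (L + 1)"] conjI allI impI)
      fix I :: "(real \<times> real) set"
      assume I: "finite I \<and> (\<forall>(u, v)\<in>I. c \<le> u \<and> u < v \<and> v \<le> d) \<and>
        disjoint_family_on (\<lambda>(u, v). {u<..<v}) I \<and> (\<Sum>(u, v)\<in>I. v - u) < e / (L + 1)"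
      have s0: "(\<Sum>(u, v)\<in>I. v - u) \<ge> 0" using I by (intro sum_nonneg) auto
      have "(\<Sum>(u, v)\<in>I. \<bar>x v - x u\<bar>) \<le> (\<Sum>(u, v)\<in>I. L * (v - u))"
      proof (rule sum_mono)
        fix p assume "p \<in> I"
        then show "(case p of (u, v) \<Rightarrow> \<bar>x v - x u\<bar>) \<le> (case p of (u, v) \<Rightarrow> L * (v - u))"
          using I L(2)[of "snd p" "fst p"] by (cases p) fastforce
      qed
      also have "\<dots> = L * (\<Sum>(u, v)\<in>I. v - u)"
        by (simp add: sum_distrib_left case_prod_unfold)
      also have "\<dots> \<le> (L + 1) * (\<Sum>(u, v)\<in>I. v - u)" using s0 by (simp add: mult_right_mono)
      also have "\<dots> < e" using I L(1) by (simp add: pos_less_divide_eq mult.commute)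
      finally show "(\<Sum>(u, v)\<in>I. \<bar>x v - x u\<bar>) < e" .
    qed (use e L in auto)
  qed
qed

lemma lip_on_has_integral:
  assumes "c \<le> d" "lip_on c d x"
    and "AE t in lebesgue. t \<in> {c<..<d} \<longrightarrow> (x has_real_derivative h t) (at t)"
  shows "(h has_integral (x d - x c)) {c..d}"
  using absolutely_continuous_fun_on_has_integral lip_on_absolutely_continuous assms by blast

section \<open>Differential inequalities that hold almost everywhere\<close>

lemma lip_on_nonincreasing:
  assumes cd: "c \<le> d" and w: "lip_on c d w"
    and der: "AE t in lebesgue. t \<in> {c<..<d} \<longrightarrow> (\<exists>D\<le>0. (w has_real_derivative D) (at t))"
  shows "w d \<le> w c"
proof -
  \<comment> \<open>The minimum makes \<open>h\<close> nonpositive everywhere, also on the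
    exceptional set, where \<open>deriv\<close> is arbitrary.\<close>
  define h where "h t = min 0 (deriv w t)" for t
  have "(h has_integral (w d - w c)) {c..d}"
  proof (rule lip_on_has_integral[OF cd w])
    show "AE t in lebesgue. t \<in> {c<..<d} \<longrightarrow> (w has_real_derivative h t) (at t)"
      using der
    proof eventually_elim
      case (elim t)
      show ?case
      proof
        assume "t \<in> {c<..<d}"
        then obtain D where D: "D \<le> 0" "(w has_real_derivative D) (at t)" using elim by blast
        then have "h t = D" unfolding h_def using DERIV_imp_deriv[OF D(2)] by simp
        with D show "(w has_real_derivative h t) (at t)" by simp
      qed
    qed
  qed
  then show ?thesis
    using has_integral_le[OF _ has_integral_0[of "{c..d}"], of h "w d - w c"] by (simp add: h_def)
qed

text \<open>After the last time with \<open>w \<le> 0\<close> the function lies, for a short while,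
  strictly between 0 and \<open>h\<close> by continuity, where it cannot increase. So the sign of
  the derivative matters only in a thin strip above the level, which is what makes bootstrap
  arguments possible.\<close>

lemma lip_on_barrier:
  assumes cd: "c \<le> d" and w: "lip_on c d w" and w0: "w c \<le> 0" and h: "h > 0"
    and der: "AE t in lebesgue. t \<in> {c<..<d} \<longrightarrow> 0 < w t \<longrightarrow> w t < h \<longrightarrow>
        (\<exists>D\<le>0. (w has_real_derivative D) (at t))"
  shows "w d \<le> 0"
proof (rule ccontr)
  assume neg: "\<not> w d \<le> 0"
  have cw: "continuous_on {c..d} w" using lip_on_continuous[OF w] .
  define S where "S = {t \<in> {c..d}. w t \<le> 0}"
  have "closed S"
  proof -
    have "S = {c..d} \<inter> w -` {..0}" unfolding S_def by auto
    then show ?thesis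
      using continuous_closed_preimage[OF cw closed_atLeastAtMost closed_atMost, of 0] by simp
  qed
  moreover have bdd: "bdd_above S" and "S \<noteq> {}" unfolding S_def using w0 cd by (auto intro!: bdd_aboveI)
  ultimately have sS: "Sup S \<in> S" using closed_contains_Sup by blast
  define s where "s = Sup S"
  have s: "s \<in> {c..d}" "w s \<le> 0" using sS unfolding S_def s_def by auto
  have sd: "s < d" using s neg by (cases "s = d") auto
  have pos: "w t > 0" if "t \<in> {s<..d}" for t
  proof (rule ccontr)
    assume "\<not> w t > 0"
    then have "t \<in> S" using that s unfolding S_def by auto
    then have "t \<le> s" unfolding s_def using bdd cSup_upper by blast
    then show False using that by simp
  qed
  obtain \<eta> where \<eta>: "\<eta> > 0" "\<And>t. t \<in> {c..d} \<Longrightarrow> dist t s < \<eta> \<Longrightarrow> dist (w t) (w s) < h"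
    using cw s(1) h unfolding continuous_on_iff by blast
  define e where "e = min d (s + \<eta> / 2)"
  have e: "s < e" "e \<le> d" using sd \<eta> unfolding e_def by auto
  have small: "w t < h" if "t \<in> {s..e}" for t
  proof -
    have "dist (w t) (w s) < h"
      using that e s \<eta>(1) by (intro \<eta>(2)) (auto simp: e_def dist_real_def)
    then show ?thesis using s(2) by (simp add: dist_real_def)
  qed
  have "w e \<le> w s"
  proof (rule lip_on_nonincreasing[of s e w])
    show "lip_on s e w" using w by (rule lip_on_subset) (use s e in auto)
    show "AE t in lebesgue. t \<in> {s<..<e} \<longrightarrow> (\<exists>D\<le>0. (w has_real_derivative D) (at t))"
      using der by eventually_elim (use s e pos small in auto)
  qed (use e in simp)
  then show False using pos[of e] e s(2) by simp
qed

lemma lip_on_linear_decrease: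
  assumes st: "s \<le> t" and w: "lip_on s t w"
    and der: "AE u in lebesgue. u \<in> {s<..<t} \<longrightarrow> (\<exists>D\<le>- c. (w has_real_derivative D) (at u))"
  shows "w t \<le> w s - c * (t - s)"
proof -
  have "w t + c * t \<le> w s + c * s"
  proof (rule lip_on_nonincreasing[OF st, of "\<lambda>u. w u + c * u"])
    show "lip_on s t (\<lambda>u. w u + c * u)" using w by (intro lip_on_intros)
    show "AE u in lebesgue. u \<in> {s<..<t} \<longrightarrow> (\<exists>D\<le>0. ((\<lambda>u. w u + c * u) has_real_derivative D) (at u))"
      using der
    proof eventually_elim
      case (elim u)
      show ?case
      proof
        assume "u \<in> {s<..<t}"
        then obtain D where "D \<le> - c" "(w has_real_derivative D) (at u)" using elim by blast
        then show "\<exists>D\<le>0. ((\<lambda>u. w u + c * u) has_real_derivative D) (at u)"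
          by (intro exI[of _ "D + c"]) (auto intro!: derivative_eq_intros)
      qed
    qed
  qed
  then show ?thesis by (simp add: algebra_simps)
qed

lemma lip_on_exponential_decrease:
  assumes st: "s \<le> t" and w: "lip_on s t w"
    and der: "AE u in lebesgue. u \<in> {s<..<t} \<longrightarrow> (\<exists>D\<le>- c * w u. (w has_real_derivative D) (at u))"
  shows "w t \<le> exp (- c * (t - s)) * w s"
proof -
  have "exp (c * t) * w t \<le> exp (c * s) * w s"
  proof (rule lip_on_nonincreasing[OF st, of "\<lambda>u. exp (c * u) * w u"])
    show "lip_on s t (\<lambda>u. exp (c * u) * w u)" using w by (intro lip_on_intros)
    show "AE u in lebesgue. u \<in> {s<..<t} \<longrightarrow> (\<exists>D\<le>0. ((\<lambda>u. exp (c * u) * w u) has_real_derivative D) (at u))"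
      using der
    proof eventually_elim
      case (elim u)
      show ?case
      proof
        assume "u \<in> {s<..<t}"
        then obtain D where D: "D \<le> - c * w u" "(w has_real_derivative D) (at u)" using elim by blast
        have "((\<lambda>u. exp (c * u) * w u) has_real_derivative exp (c * u) * (D + c * w u)) (at u)"
          using D(2) by (auto intro!: derivative_eq_intros simp: algebra_simps)
        moreover have "exp (c * u) * (D + c * w u) \<le> 0" using D(1) by (intro mult_nonneg_nonpos) auto
        ultimately show "\<exists>D\<le>0. ((\<lambda>u. exp (c * u) * w u) has_real_derivative D) (at u)" by blast
      qed
    qed
  qed
  then have "exp (- (c * t)) * (exp (c * t) * w t) \<le> exp (- (c * t)) * (exp (c * s) * w s)"
    by (intro mult_left_mono) auto
  moreover have "exp (- (c * t)) * (exp (c * t) * w t) = w t" by (simp flip: mult.assoc exp_add)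
  moreover have "exp (- (c * t)) * (exp (c * s) * w s) = exp (- c * (t - s)) * w s"
    by (simp add: algebra_simps flip: mult.assoc exp_add)
  ultimately show ?thesis by simp
qed

text \<open>Lebesgue differentiation over the intervals \<open>{x..x + k}\<close> gives the right
  derivative only; the left one comes from the same statement for the reflected function. The
  exceptional set does not depend on the lower limit \<open>c\<close>.\<close>

lemma integral_derivative_AE:
  fixes h :: "real \<Rightarrow> real"
  assumes int: "\<And>a b. h integrable_on {a..b}"
  shows "AE t in lebesgue. \<forall>c<t. ((\<lambda>u. integral {c..u} h) has_real_derivative h t) (at t)"
proof -
  have ex: "\<exists>N. negligible N \<and> (\<forall>x e. x \<notin> N \<longrightarrow> 0 < e \<longrightarrow>
      (\<exists>d>0. \<forall>k. 0 < k \<and> k < d \<longrightarrow> norm (integral {x..x + k} p / k - p x) < e))"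
    if "\<And>a b. p integrable_on {a..b}" for p :: "real \<Rightarrow> real"
  proof -
    have "p integrable_on cbox a b" for a b using that by simp
    then obtain N where N: "negligible N" and N': "\<And>x e. \<lbrakk>x \<notin> N; 0 < e\<rbrakk> \<Longrightarrow> \<exists>d>0. \<forall>k. 0 < k \<and> k < d \<longrightarrow>
        norm (integral (cbox x (x + k *\<^sub>R One)) p /\<^sub>R k ^ DIM(real) - p x) < e"
      using integrable_ccontinuous_explicit[of p] by blast
    have "integral (cbox x (x + k *\<^sub>R One)) p /\<^sub>R k ^ DIM(real) = integral {x..x + k} p / k" for x k
      by (simp add: divide_inverse mult.commute)
    then show ?thesis using N N' by (intro exI[of _ N]) simp
  qed
  obtain N where N: "negligible N" and Nd: "\<And>x e. \<lbrakk>x \<notin> N; 0 < e\<rbrakk> \<Longrightarrow>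
      \<exists>d>0. \<forall>k. 0 < k \<and> k < d \<longrightarrow> norm (integral {x..x + k} h / k - h x) < e"
    using ex[OF int] by blast
  have int': "(\<lambda>x. h (- x)) integrable_on {a..b}" for a b
    using int[of "- b" "- a"] Henstock_Kurzweil_Integration.integrable_reflect_real[where f = h and a = "- b" and b = "- a"] by simp
  obtain N' where N': "negligible N'" and Nd': "\<And>x e. \<lbrakk>x \<notin> N'; 0 < e\<rbrakk> \<Longrightarrow>
      \<exists>d>0. \<forall>k. 0 < k \<and> k < d \<longrightarrow> norm (integral {x..x + k} (\<lambda>x. h (- x)) / k - h (- x)) < e"
    using ex[OF int'] by blast
  have "AE t in lebesgue. t \<notin> N" using N by (rule AE_lebesgue_not_in)
  moreover have "AE t in lebesgue. - t \<notin> N'" using AE_lebesgue_reflect[OF AE_lebesgue_not_in[OF N']] .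
  ultimately show ?thesis
  proof eventually_elim
    case (elim t)
    show ?case
    proof (intro allI impI)
      fix c assume c: "c < t"
      let ?F = "\<lambda>u. integral {c..u} h"
      show "(?F has_real_derivative h t) (at t)"
        unfolding has_field_derivative_iff LIM_def
      proof (intro allI impI)
        fix e :: real assume e: "e > 0"
        obtain d1 where d1: "d1 > 0" "\<forall>k. 0 < k \<and> k < d1 \<longrightarrow> norm (integral {t..t + k} h / k - h t) < e"
          using Nd[OF elim(1) e] by blast
        obtain d2 where d2: "d2 > 0" "\<forall>k. 0 < k \<and> k < d2 \<longrightarrow>
            norm (integral {- t..- t + k} (\<lambda>x. h (- x)) / k - h t) < e"
          using Nd'[OF elim(2) e] unfolding minus_minus by blast
        show "\<exists>s>0. \<forall>u. u \<noteq> t \<and> dist u t < s \<longrightarrow> dist ((?F u - ?F t) / (u - t)) (h t) < e"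
        proof (intro exI[of _ "min (min d1 d2) (t - c)"] conjI allI impI)
          fix u assume u: "u \<noteq> t \<and> dist u t < min (min d1 d2) (t - c)"
          show "dist ((?F u - ?F t) / (u - t)) (h t) < e"
          proof (cases "u > t")
            case True
            have "?F t + integral {t..u} h = ?F u"
              using True c by (intro Henstock_Kurzweil_Integration.integral_combine int) linarith+
            then have "?F u - ?F t = integral {t..t + (u - t)} h" by simp
            moreover have "norm (integral {t..t + (u - t)} h / (u - t) - h t) < e"
              using True u by (intro d1(2)[rule_format]) (simp_all add: dist_real_def)
            ultimately show ?thesis by (simp only: dist_norm)
          next
            case False
            then have ut: "u < t" "c < u" using u by (auto simp: dist_real_def)
            have "?F u + integral {u..t} h = ?F t"
              using ut by (intro Henstock_Kurzweil_Integration.integral_combine int) linarith+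
            moreover have "integral {- t..- t + (t - u)} (\<lambda>x. h (- x)) = integral {u..t} h"
              using Henstock_Kurzweil_Integration.integral_reflect_real[where f = h and a = u and b = t] by simp
            moreover have "(?F u - ?F t) / (u - t) = (?F t - ?F u) / (t - u)"
              by (metis minus_diff_eq minus_divide_divide)
            ultimately have "(?F u - ?F t) / (u - t) = integral {- t..- t + (t - u)} (\<lambda>x. h (- x)) / (t - u)"
              by (metis add_diff_cancel_left')
            moreover have "norm (integral {- t..- t + (t - u)} (\<lambda>x. h (- x)) / (t - u) - h t) < e"
              using ut u by (intro d2(2)[rule_format]) (simp_all add: dist_real_def)
            ultimately show ?thesis by (simp only: dist_norm)
          qed
        qed (use d1 d2 c in auto)
      qed
    qed
  qed
qed

lemma bounded_measurable_integrable:
  fixes h :: "real \<Rightarrow> real"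
  assumes h: "h \<in> borel_measurable lebesgue" and K: "AE t in lebesgue. \<bar>h t\<bar> \<le> K"
  shows "h integrable_on {a..b}"
proof -
  obtain N where N: "negligible N" "{t. \<not> \<bar>h t\<bar> \<le> K} \<subseteq> N"
    using K unfolding eventually_ae_filter_negligible by auto
  \<comment> \<open>The truncation is bounded at every point, not just almost everywhere, and agrees
    with \<open>h\<close> off a null set.\<close>
  define h' where "h' t = max (- K) (min K (h t))" for t
  have eq: "h' t = h t" if "t \<notin> N" for t
  proof -
    have "\<bar>h t\<bar> \<le> K" using that N by auto
    then show ?thesis unfolding h'_def by auto
  qed
  have "h' integrable_on {a..b}"
  proof (rule measurable_bounded_by_integrable_imp_integrable_real)
    have "h' \<in> borel_measurable lebesgue" unfolding h'_def using h by measurable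
    then show "h' \<in> borel_measurable (lebesgue_on {a..b})"
      by (simp add: measurable_restrict_space1)
    show "(\<lambda>t. \<bar>K\<bar>) integrable_on {a..b}" by (rule integrable_const_ivl)
  qed (auto simp: h'_def)
  then show ?thesis using integrable_spike[OF _ N(1)] eq by (metis DiffD2)
qed

lemma has_integral_AE_le:
  fixes p q :: "real \<Rightarrow> real"
  assumes "(p has_integral P) {a..b}" "(q has_integral Q) {a..b}" "AE t in lebesgue. t \<in> {a..b} \<longrightarrow> p t \<le> q t"
  shows "P \<le> Q"
proof -
  obtain N where N: "negligible N" "{t. \<not> (t \<in> {a..b} \<longrightarrow> p t \<le> q t)} \<subseteq> N"
    using assms(3) unfolding eventually_ae_filter_negligible by auto
  have "((\<lambda>t. if t \<in> N then q t else p t) has_integral P) {a..b}"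
    by (rule has_integral_spike[OF N(1) _ assms(1)]) auto
  then show ?thesis by (rule has_integral_le[OF _ assms(2)]) (use N(2) in auto)
qed

section \<open>Caratheodory equations\<close>

lemma interval_subset: "is_interval J \<Longrightarrow> s \<in> J \<Longrightarrow> t \<in> J \<Longrightarrow> {s..t} \<subseteq> (J :: real set)"
  unfolding is_interval_1 by fastforce

text \<open>Countably many compact subintervals, those with rational end points, already cover the
  interior, so the exceptional sets unite to a null set; the frontier of an interval is null as
  well. Thus one-sided derivatives at end points never matter.\<close>

lemma AE_on_interval:
  fixes J :: "real set"
  assumes J: "is_interval J"
    and P: "\<And>c d. c < d \<Longrightarrow> {c..d} \<subseteq> J \<Longrightarrow> AE t in lebesgue. t \<in> {c<..<d} \<longrightarrow> P t"
  shows "AE t in lebesgue. t \<in> J \<longrightarrow> t \<in> interior J \<and> P t"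
proof -
  have 1: "AE t in lebesgue. t \<notin> frontier J"
    using J by (intro AE_lebesgue_not_in negligible_convex_frontier is_interval_convex)
  have "AE t in lebesgue. \<forall>c\<in>\<rat>. \<forall>d\<in>\<rat>. c < d \<and> {c..d} \<subseteq> J \<longrightarrow> t \<in> {c<..<d} \<longrightarrow> P t"
    using P by (auto simp: AE_ball_countable countable_rat)
  with 1 show ?thesis
  proof eventually_elim
    case (elim t)
    show ?case
    proof
      assume t: "t \<in> J"
      then have ti: "t \<in> interior J" using elim(1) closure_subset unfolding frontier_def by blast
      then obtain e where e: "e > 0" "cball t e \<subseteq> J" unfolding mem_interior_cball by blast
      obtain c d where cd: "c \<in> \<rat>" "t - e < c" "c < t" "d \<in> \<rat>" "t < d" "d < t + e"
        using Rats_dense_in_real[of "t - e" t] Rats_dense_in_real[of t "t + e"] e by auto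
      then have "{c..d} \<subseteq> J" using e by (intro order_trans[OF _ e(2)]) (auto simp: dist_real_def)
      then show "t \<in> interior J \<and> P t" using elim(2) cd ti by auto
    qed
  qed
qed

lemma absolutely_continuous_fun_on_continuous:
  assumes "absolutely_continuous_fun_on c d x"
  shows "continuous_on {c..d} x"
  unfolding continuous_on_iff
proof (intro ballI allI impI)
  fix s e :: real assume s: "s \<in> {c..d}" and e: "e > 0"
  obtain \<delta> where \<delta>: "\<delta> > 0" "\<forall>I :: (real \<times> real) set.
        finite I \<and> (\<forall>(u, v)\<in>I. c \<le> u \<and> u < v \<and> v \<le> d) \<and>
        disjoint_family_on (\<lambda>(u, v). {u<..<v}) I \<and> (\<Sum>(u, v)\<in>I. v - u) < \<delta> \<longrightarrow>
        (\<Sum>(u, v)\<in>I. \<bar>x v - x u\<bar>) < e"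
    using assms e unfolding absolutely_continuous_fun_on_def by blast
  have *: "\<bar>x v - x u\<bar> < e" if "c \<le> u" "u < v" "v \<le> d" "v - u < \<delta>" for u v
    using \<delta>(2)[rule_format, of "{(u, v)}"] that by (simp add: disjoint_family_on_def)
  show "\<exists>\<eta>>0. \<forall>t\<in>{c..d}. dist t s < \<eta> \<longrightarrow> dist (x t) (x s) < e"
  proof (intro exI[of _ \<delta>] conjI ballI impI)
    fix t assume t: "t \<in> {c..d}" "dist t s < \<delta>"
    consider "t < s" | "t = s" | "s < t" by linarith
    then show "dist (x t) (x s) < e"
    proof cases
      case 1
      then show ?thesis using *[of t s] t s by (simp add: dist_real_def abs_minus_commute)
    next
      case 3
      then show ?thesis using *[of s t] t s by (simp add: dist_real_def)
    qed (use e in simp)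
  qed (fact \<delta>(1))
qed

text \<open>A solution on a compact interval, with two-sided derivatives at interior points only.
  End points carry no condition, so pieces restrict and glue without side conditions on
  derivatives.\<close>

definition piece :: "(real \<Rightarrow> real \<Rightarrow> real) \<Rightarrow> real \<Rightarrow> real \<Rightarrow> (real \<Rightarrow> real) \<Rightarrow> bool" where
  "piece g c d x \<longleftrightarrow> lip_on c d x \<and>
     (AE t in lebesgue. t \<in> {c<..<d} \<longrightarrow> (x has_real_derivative g t (x t)) (at t))"

lemma piece_lip_on: "piece g c d x \<Longrightarrow> lip_on c d x"
  unfolding piece_def by blast

lemma piece_derivative: "piece g c d x \<Longrightarrow>
    AE t in lebesgue. t \<in> {c<..<d} \<longrightarrow> (x has_real_derivative g t (x t)) (at t)"
  unfolding piece_def by blast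

lemma piece_subset:
  assumes "piece g c d x" "{c'..d'} \<subseteq> {c..d}"
  shows "piece g c' d' x"
proof (cases "c' \<le> d'")
  case True
  then have "{c'<..<d'} \<subseteq> {c<..<d}" using assms(2) by auto
  then show ?thesis using assms unfolding piece_def
    by (auto intro: lip_on_subset elim!: eventually_mono)
qed (auto simp: piece_def lip_on_def intro: exI[of _ 0])

lemma piece_cong:
  assumes p: "piece g c d x" and eq: "\<And>t. t \<in> {c..d} \<Longrightarrow> y t = x t"
  shows "piece g c d y"
  unfolding piece_def
proof
  obtain L where L: "\<And>u v. u \<in> {c..d} \<Longrightarrow> v \<in> {c..d} \<Longrightarrow> \<bar>x u - x v\<bar> \<le> L * \<bar>u - v\<bar>"
    using p lip_onE unfolding piece_def by blast
  show "lip_on c d y"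
  proof (rule lip_onI[of _ _ _ L])
    fix u v assume "c \<le> u" "u < v" "v \<le> d"
    then show "\<bar>y v - y u\<bar> \<le> L * (v - u)" using L[of v u] eq[of u] eq[of v] by simp
  qed
  show "AE t in lebesgue. t \<in> {c<..<d} \<longrightarrow> (y has_real_derivative g t (y t)) (at t)"
    using piece_derivative[OF p]
  proof eventually_elim
    case (elim t)
    show ?case
    proof
      assume t: "t \<in> {c<..<d}"
      then have "(x has_real_derivative g t (y t)) (at t)" using eq elim by simp
      then show "(y has_real_derivative g t (y t)) (at t)"
        by (rule has_field_derivative_transform_within_open[of _ _ _ "{c<..<d}"]) (use t eq in auto)
    qed
  qed
qed

lemma piece_union:
  assumes "piece g c s x" "piece g s d x" "c \<le> s" "s \<le> d"
  shows "piece g c d x"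
  unfolding piece_def
proof
  show "lip_on c d x" using assms lip_on_union unfolding piece_def by blast
  have "AE t in lebesgue. t \<noteq> s" by (rule AE_lebesgue_neq)
  with piece_derivative[OF assms(1)] piece_derivative[OF assms(2)]
  show "AE t in lebesgue. t \<in> {c<..<d} \<longrightarrow> (x has_real_derivative g t (x t)) (at t)"
    by eventually_elim auto
qed

text \<open>The square of the difference is differentiable where its absolute value may not be, and
  its derivative is at most \<open>2 * K\<close> times it in modulus. Applied to
  \<open>w * w\<close> this gives the forward bound, applied to \<open>- w * w\<close> the backward
  one.\<close>

lemma gronwall_piece:
  assumes cd: "c \<le> d" and x: "piece g c d x" and y: "piece g c d y"
    and xB: "\<And>t. t \<in> {c..d} \<Longrightarrow> \<bar>x t\<bar> \<le> B" and yB: "\<And>t. t \<in> {c..d} \<Longrightarrow> \<bar>y t\<bar> \<le> B"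
    and K: "AE t in lebesgue. \<forall>u\<in>{- B..B}. \<forall>v\<in>{- B..B}. \<bar>g t u - g t v\<bar> \<le> K * \<bar>u - v\<bar>"
  shows "\<bar>x d - y d\<bar> \<le> exp (K * (d - c)) * \<bar>x c - y c\<bar>"
    and "\<bar>x c - y c\<bar> \<le> exp (K * (d - c)) * \<bar>x d - y d\<bar>"
proof -
  define w where "w t = x t - y t" for t
  have lw: "lip_on c d w" using x y unfolding piece_def w_def by (blast intro: lip_on_diff)
  have dw: "AE t in lebesgue. t \<in> {c<..<d} \<longrightarrow>
      (\<exists>D. (w has_real_derivative D) (at t) \<and> \<bar>w t * D\<bar> \<le> K * (w t * w t))"
    using piece_derivative[OF x] piece_derivative[OF y] K
  proof eventually_elim
    case (elim t)
    show ?case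
    proof
      assume t: "t \<in> {c<..<d}"
      have tc: "x t \<in> {- B..B}" "y t \<in> {- B..B}"
        using xB[of t] yB[of t] t by (auto simp: abs_le_iff minus_le_iff)
      have "(w has_real_derivative g t (x t) - g t (y t)) (at t)"
        unfolding w_def using elim t by (intro DERIV_diff) auto
      moreover have "\<bar>w t\<bar> * \<bar>g t (x t) - g t (y t)\<bar> \<le> \<bar>w t\<bar> * (K * \<bar>w t\<bar>)"
        using elim(3) tc unfolding w_def by (intro mult_left_mono) auto
      then have "\<bar>w t * (g t (x t) - g t (y t))\<bar> \<le> K * (w t * w t)"
        by (simp add: abs_mult mult.left_commute)
      ultimately show "\<exists>D. (w has_real_derivative D) (at t) \<and> \<bar>w t * D\<bar> \<le> K * (w t * w t)" by blast
    qed
  qed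
  have e2: "(exp (K * a))\<^sup>2 = exp (2 * K * a)" for a
    by (simp add: power2_eq_square flip: exp_add)
  have root: "\<bar>p\<bar> \<le> exp (K * a) * \<bar>q\<bar>" if "p\<^sup>2 \<le> exp (2 * K * a) * q\<^sup>2" for p q a :: real
  proof (rule power2_le_imp_le)
    show "\<bar>p\<bar>\<^sup>2 \<le> (exp (K * a) * \<bar>q\<bar>)\<^sup>2" using that by (simp add: power_mult_distrib e2)
  qed simp
  have "w d * w d \<le> exp (- (- 2 * K) * (d - c)) * (w c * w c)"
  proof (rule lip_on_exponential_decrease[OF cd, of "\<lambda>t. w t * w t"])
    show "lip_on c d (\<lambda>t. w t * w t)" using lw by (intro lip_on_intros)
    show "AE t in lebesgue. t \<in> {c<..<d} \<longrightarrow>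
        (\<exists>D\<le>- (- 2 * K) * (w t * w t). ((\<lambda>t. w t * w t) has_real_derivative D) (at t))"
      using dw
    proof eventually_elim
      case (elim t)
      show ?case
      proof
        assume "t \<in> {c<..<d}"
        then obtain D where D: "(w has_real_derivative D) (at t)" "\<bar>w t * D\<bar> \<le> K * (w t * w t)"
          using elim by blast
        have "((\<lambda>t. w t * w t) has_real_derivative 2 * (w t * D)) (at t)"
          using D(1) by (auto intro!: derivative_eq_intros)
        then show "\<exists>D\<le>- (- 2 * K) * (w t * w t). ((\<lambda>t. w t * w t) has_real_derivative D) (at t)"
          using abs_le_D1[OF D(2)] by (intro exI[of _ "2 * (w t * D)"]) simp
      qed
    qed
  qed
  then show "\<bar>x d - y d\<bar> \<le> exp (K * (d - c)) * \<bar>x c - y c\<bar>"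
    unfolding w_def[symmetric] by (intro root) (simp add: power2_eq_square algebra_simps)
  have "0 - w d * w d \<le> exp (- (2 * K) * (d - c)) * (0 - w c * w c)"
  proof (rule lip_on_exponential_decrease[OF cd, of "\<lambda>t. 0 - w t * w t"])
    show "lip_on c d (\<lambda>t. 0 - w t * w t)" using lw by (intro lip_on_intros)
    show "AE t in lebesgue. t \<in> {c<..<d} \<longrightarrow>
        (\<exists>D\<le>- (2 * K) * (0 - w t * w t). ((\<lambda>t. 0 - w t * w t) has_real_derivative D) (at t))"
      using dw
    proof eventually_elim
      case (elim t)
      show ?case
      proof
        assume "t \<in> {c<..<d}"
        then obtain D where D: "(w has_real_derivative D) (at t)" "\<bar>w t * D\<bar> \<le> K * (w t * w t)"
          using elim by blast
        have "((\<lambda>t. 0 - w t * w t) has_real_derivative - 2 * (w t * D)) (at t)"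
          using D(1) by (auto intro!: derivative_eq_intros)
        then show "\<exists>D\<le>- (2 * K) * (0 - w t * w t). ((\<lambda>t. 0 - w t * w t) has_real_derivative D) (at t)"
          using abs_le_D2[OF D(2)] by (intro exI[of _ "- 2 * (w t * D)"]) (simp add: mult.commute)
      qed
    qed
  qed
  then have "exp (2 * K * (d - c)) * (exp (- (2 * K * (d - c))) * (w c * w c)) \<le> exp (2 * K * (d - c)) * (w d * w d)"
    by (intro mult_left_mono) auto
  then have "(w c)\<^sup>2 \<le> exp (2 * K * (d - c)) * (w d)\<^sup>2"
    by (simp add: power2_eq_square flip: mult.assoc exp_add)
  then show "\<bar>x c - y c\<bar> \<le> exp (K * (d - c)) * \<bar>x d - y d\<bar>"
    unfolding w_def[symmetric] by (rule root)
qed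

lemma measurable_lebesgue_reflect:
  fixes h :: "real \<Rightarrow> real"
  assumes "h \<in> borel_measurable lebesgue"
  shows "(\<lambda>t. h (- t)) \<in> borel_measurable lebesgue"
proof -
  have "(\<lambda>x::real. 0 + (\<Sum>j\<in>Basis. (- 1 * (x \<bullet> j)) *\<^sub>R j)) \<in> lebesgue \<rightarrow>\<^sub>M lebesgue"
    by (rule lebesgue_affine_measurable) simp
  then have "uminus \<in> lebesgue \<rightarrow>\<^sub>M (lebesgue :: real measure)" by simp
  from measurable_compose[OF this assms] show ?thesis .
qed

text \<open>Measurability is required along functions of \<open>t\<close> rather than jointly,
  because a shift by a Lebesgue measurable \<Delta> destroys Borel measurability. The local bounds
  are uniform in \<open>t\<close>, so that existence times depend only on the size of the initial
  value.\<close>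

locale caratheodory =
  fixes g :: "real \<Rightarrow> real \<Rightarrow> real"
  assumes superposition_measurable:
      "\<And>x. x \<in> borel_measurable lebesgue \<Longrightarrow> (\<lambda>t. g t (x t)) \<in> borel_measurable lebesgue"
    and locally_lipschitz: "\<And>B. \<exists>K\<ge>0. AE t in lebesgue. \<forall>u\<in>{- B..B}.
      \<bar>g t u\<bar> \<le> K \<and> (\<forall>v\<in>{- B..B}. \<bar>g t u - g t v\<bar> \<le> K * \<bar>u - v\<bar>)"
begin

text \<open>An absolutely continuous solution is bounded on a compact interval, so its derivative is
  bounded almost everywhere; integrating it gives a Lipschitz constant. In the other direction the
  derivatives on compact subintervals are patched together by \<open>AE_on_interval\<close>.\<close>

lemma solution_on_iff:
  "solution_on g J x \<longleftrightarrow> is_interval J \<and> (\<forall>c d. c < d \<longrightarrow> {c..d} \<subseteq> J \<longrightarrow> piece g c d x)"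
proof (intro iffI conjI allI impI)
  assume s: "solution_on g J x"
  then show "is_interval J" unfolding solution_on_def by blast
  fix c d assume cd: "c < d" "{c..d} \<subseteq> J"
  have der: "AE t in lebesgue. t \<in> {c<..<d} \<longrightarrow> (x has_real_derivative g t (x t)) (at t)"
  proof -
    have "AE t in lebesgue. t \<in> J \<longrightarrow> (x has_real_derivative g t (x t)) (at t within J)"
      using s unfolding solution_on_def by blast
    then show ?thesis
    proof eventually_elim
      case (elim t)
      have "{c<..<d} \<subseteq> interior J" using cd by (intro interior_maximal) auto
      then show ?case using elim cd at_within_interior[of t J] interior_subset[of J] by auto
    qed
  qed
  have ac: "absolutely_continuous_fun_on u v x" if "{u..v} \<subseteq> {c..d}" for u v
    using s that cd unfolding solution_on_def by blast
  have "bounded (x ` {c..d})"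
    using absolutely_continuous_fun_on_continuous[OF ac[OF order_refl]]
    by (intro compact_imp_bounded compact_continuous_image) auto
  then obtain B where B: "\<forall>y\<in>x ` {c..d}. norm y \<le> B" unfolding bounded_iff by blast
  obtain K where K: "K \<ge> 0" "AE t in lebesgue. \<forall>u\<in>{- B..B}.
      \<bar>g t u\<bar> \<le> K \<and> (\<forall>v\<in>{- B..B}. \<bar>g t u - g t v\<bar> \<le> K * \<bar>u - v\<bar>)"
    using locally_lipschitz by blast
  have gK: "AE t in lebesgue. t \<in> {c..d} \<longrightarrow> \<bar>g t (x t)\<bar> \<le> K"
    using K(2)
  proof eventually_elim
    case (elim t)
    show ?case
    proof
      assume "t \<in> {c..d}"
      then have "x t \<in> {- B..B}" using B by (auto simp: abs_le_iff minus_le_iff)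
      then show "\<bar>g t (x t)\<bar> \<le> K" using elim by blast
    qed
  qed
  show "piece g c d x"
    unfolding piece_def
  proof (intro conjI der lip_onI)
    fix u v assume uv: "c \<le> u" "u < v" "v \<le> d"
    have i: "((\<lambda>t. g t (x t)) has_integral (x v - x u)) {u..v}"
    proof (rule absolutely_continuous_fun_on_has_integral)
      show "absolutely_continuous_fun_on u v x" using ac uv by simp
      show "AE t in lebesgue. t \<in> {u<..<v} \<longrightarrow> (x has_real_derivative g t (x t)) (at t)"
        using der by eventually_elim (use uv in auto)
    qed (use uv in simp)
    have c: "((\<lambda>t. k) has_integral (v - u) * k) {u..v}" for k
      using has_integral_const_real[of k u v] uv by simp
    have "x v - x u \<le> (v - u) * K"
      by (rule has_integral_AE_le[OF i c]) (use gK in eventually_elim, use uv in auto)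
    moreover have "(v - u) * (- K) \<le> x v - x u"
      by (rule has_integral_AE_le[OF c i]) (use gK in eventually_elim, use uv in auto)
    ultimately show "\<bar>x v - x u\<bar> \<le> K * (v - u)" by (simp add: abs_le_iff algebra_simps)
  qed
next
  assume *: "is_interval J \<and> (\<forall>c d. c < d \<longrightarrow> {c..d} \<subseteq> J \<longrightarrow> piece g c d x)"
  have "absolutely_continuous_fun_on c d x" if "{c..d} \<subseteq> J" for c d
  proof (cases "c < d")
    case True
    then show ?thesis using * that lip_on_absolutely_continuous unfolding piece_def by blast
  next
    case False
    then show ?thesis by (intro lip_on_absolutely_continuous lip_onI[of _ _ _ 0]) auto
  qed
  moreover have "AE t in lebesgue. t \<in> J \<longrightarrow> t \<in> interior J \<and> (x has_real_derivative g t (x t)) (at t)"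
    by (rule AE_on_interval) (use * in \<open>auto simp: piece_def\<close>)
  then have "AE t in lebesgue. t \<in> J \<longrightarrow> (x has_real_derivative g t (x t)) (at t within J)"
    by eventually_elim (auto intro: has_field_derivative_at_within)
  ultimately show "solution_on g J x" using * unfolding solution_on_def by blast
qed

lemma solution_on_piece: "solution_on g J x \<Longrightarrow> {c..d} \<subseteq> J \<Longrightarrow> piece g c d x"
  using solution_on_iff piece_subset[of g c c x] 
  by (cases "c < d") (auto simp: piece_def intro: lip_onI[of _ _ _ 0])

lemma solution_on_interval: "solution_on g J x \<Longrightarrow> is_interval J"
  unfolding solution_on_def by blast

lemma solution_on_mem: "solution_on g J x \<Longrightarrow> s \<in> J \<Longrightarrow> t \<in> J \<Longrightarrow> s \<le> u \<Longrightarrow> u \<le> t \<Longrightarrow> u \<in> J"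
  using interval_subset[OF solution_on_interval] by fastforce

lemma solution_on_subset:
  "solution_on g J x \<Longrightarrow> K \<subseteq> J \<Longrightarrow> is_interval K \<Longrightarrow> solution_on g K x"
  unfolding solution_on_iff by blast

lemma solution_on_cong:
  assumes "solution_on g J x" "\<And>t. t \<in> J \<Longrightarrow> y t = x t"
  shows "solution_on g J y"
  using assms piece_cong unfolding solution_on_iff by (metis subset_iff)

lemma solution_on_union:
  assumes J: "solution_on g J x" and K: "solution_on g K x" and s: "s \<in> J" "s \<in> K"
  shows "solution_on g (J \<union> K) x"
proof -
  have iJ: "\<And>a b. a \<in> J \<Longrightarrow> b \<in> J \<Longrightarrow> {a..b} \<subseteq> J" and iK: "\<And>a b. a \<in> K \<Longrightarrow> b \<in> K \<Longrightarrow> {a..b} \<subseteq> K"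
    using J K solution_on_interval interval_subset by blast+
  show ?thesis
    unfolding solution_on_iff
  proof (intro conjI allI impI)
    have "connected (J \<union> K)"
      using J K s by (intro connected_Un) (auto intro: is_interval_connected dest: solution_on_interval)
    then show "is_interval (J \<union> K)" by (simp add: is_interval_connected_1)
    fix c d assume cd: "c < d" "{c..d} \<subseteq> J \<union> K"
    \<comment> \<open>Either \<open>{c..d}\<close> lies on one side of the common point
      \<open>s\<close>, and then in one of the domains, or it is cut at \<open>s\<close>.\<close>
    have 1: "piece g c d x" if S: "solution_on g S x" "solution_on g T x" "s \<in> S" "s \<in> T" "c \<in> S" "d \<in> T" for S T
    proof -
      have iS: "\<And>a b. a \<in> S \<Longrightarrow> b \<in> S \<Longrightarrow> {a..b} \<subseteq> S" and iT: "\<And>a b. a \<in> T \<Longrightarrow> b \<in> T \<Longrightarrow> {a..b} \<subseteq> T"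
        using S solution_on_interval interval_subset by blast+
      consider "s < c" | "d < s" | "c \<le> s" "s \<le> d" by linarith
      then show ?thesis
      proof cases
        case 1
        then have "{c..d} \<subseteq> T" using iT[OF S(4,6)] by auto
        then show ?thesis using S solution_on_piece by blast
      next
        case 2
        then have "{c..d} \<subseteq> S" using iS[OF S(5,3)] by auto
        then show ?thesis using S solution_on_piece by blast
      next
        case 3
        then show ?thesis using S iS iT solution_on_piece by (intro piece_union[of g c s x d]) blast+
      qed
    qed
    have "c \<in> J \<union> K" "d \<in> J \<union> K" using cd(1) subsetD[OF cd(2)] by simp_all
    then show "piece g c d x" using 1 J K s by blast
  qed
qed

lemma solution_on_lip_on:
  assumes "solution_on g J x" "s \<in> J" "t \<in> J"
  shows "lip_on s t x"
  using assms solution_on_piece interval_subset solution_on_interval piece_lip_on by metis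

lemma solution_on_continuous:
  assumes "solution_on g J x" "s \<in> J" "t \<in> J"
  shows "continuous_on {s..t} x"
  using solution_on_lip_on[OF assms] by (rule lip_on_continuous)

lemma solution_on_locally_bounded:
  assumes "solution_on g J x" "s \<in> J" "t \<in> J"
  obtains B where "\<And>u. u \<in> {s..t} \<Longrightarrow> \<bar>x u\<bar> \<le> B"
  using lip_on_bounded[OF solution_on_lip_on[OF assms]] by metis

lemma solution_unique_le:
  assumes "solution_on g J x" "solution_on g J y" "s \<in> J" "t \<in> J" "s \<le> t"
  shows "x s = y s \<longleftrightarrow> x t = y t"
proof -
  obtain B1 B2 where B: "\<And>u. u \<in> {s..t} \<Longrightarrow> \<bar>x u\<bar> \<le> B1" "\<And>u. u \<in> {s..t} \<Longrightarrow> \<bar>y u\<bar> \<le> B2"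
    using assms solution_on_locally_bounded by metis
  define B where "B = max B1 B2"
  obtain K where "AE t in lebesgue. \<forall>u\<in>{- B..B}.
      \<bar>g t u\<bar> \<le> K \<and> (\<forall>v\<in>{- B..B}. \<bar>g t u - g t v\<bar> \<le> K * \<bar>u - v\<bar>)"
    using locally_lipschitz by blast
  then have K: "AE t in lebesgue. \<forall>u\<in>{- B..B}. \<forall>v\<in>{- B..B}. \<bar>g t u - g t v\<bar> \<le> K * \<bar>u - v\<bar>"
    by eventually_elim blast
  have st: "{s..t} \<subseteq> J" using assms interval_subset solution_on_interval by blast
  have bb: "\<bar>x u\<bar> \<le> B" "\<bar>y u\<bar> \<le> B" if "u \<in> {s..t}" for u
    using B[OF that] unfolding B_def by auto
  note gr = gronwall_piece[OF assms(5) solution_on_piece[OF assms(1) st] solution_on_piece[OF assms(2) st] bb K]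
  show ?thesis
  proof
    assume "x s = y s" then show "x t = y t" using gr(1) by simp
  next
    assume "x t = y t" then show "x s = y s" using gr(2) by simp
  qed
qed

lemma solution_unique:
  assumes "solution_on g J x" "solution_on g J y" "s \<in> J" "t \<in> J" "x s = y s"
  shows "x t = y t"
proof (cases "s \<le> t")
  case True
  then show ?thesis using solution_unique_le[OF assms(1-4)] assms(5) by simp
next
  case False
  then show ?thesis using solution_unique_le[OF assms(1,2,4,3)] assms(5) by simp
qed

text \<open>If the order changed, the intermediate value theorem would give a common value, and
  uniqueness would make the two solutions equal at \<open>s\<close>.\<close>

lemma solution_less:
  assumes "solution_on g J x" "solution_on g J y" "s \<in> J" "t \<in> J" "x s < y s"
  shows "x t < y t"
proof (rule ccontr)
  assume n: "\<not> x t < y t"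
  have c: "continuous_on {a..b} (\<lambda>u. y u - x u)" if "a \<in> J" "b \<in> J" for a b
    using that assms by (intro continuous_on_diff solution_on_continuous)
  have "\<exists>u. u \<in> J \<and> y u - x u = 0"
  proof (cases "s \<le> t")
    case True
    then obtain u where "s \<le> u" "u \<le> t" "y u - x u = 0"
      using IVT2'[of "\<lambda>u. y u - x u" t 0 s] c[OF assms(3,4)] n assms(5) by auto
    then show ?thesis using solution_on_mem[OF assms(1)] assms(3,4) by blast
  next
    case False
    then obtain u where "t \<le> u" "u \<le> s" "y u - x u = 0"
      using IVT'[of "\<lambda>u. y u - x u" t 0 s] c[OF assms(4,3)] n assms(5) by auto
    then show ?thesis using solution_on_mem[OF assms(1)] assms(3,4) by blast
  qed
  then obtain u where "u \<in> J" "x u = y u" by auto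
  then have "x s = y s" using solution_unique[OF assms(1,2) _ assms(3), of u] by simp
  then show False using assms by simp
qed

lemma solution_le:
  assumes "solution_on g J x" "solution_on g J y" "s \<in> J" "t \<in> J" "x s \<le> y s"
  shows "x t \<le> y t"
proof (cases "x s = y s")
  case True
  then show ?thesis using solution_unique[OF assms(1-4)] by simp
next
  case False
  then show ?thesis using solution_less[OF assms(1-4)] assms(5) by simp
qed


section \<open>Existence, maximal solutions and continuation\<close>

text \<open>Picard iteration in the complete space of bounded continuous functions on the line. The
  point is that \<tau> depends on \<open>B\<close> alone and not on \<open>s\<close>, which is what
  continuation needs.\<close>

lemma local_existence:
  "\<exists>\<tau>>0. \<forall>s x0. \<bar>x0\<bar> \<le> B \<longrightarrow> (\<exists>y. solution_on g {s..s + \<tau>} y \<and> y s = x0)"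
proof -
  define C where "C = B + 1"
  obtain K where K0: "K \<ge> 0" and K: "AE t in lebesgue. \<forall>u\<in>{- C..C}.
      \<bar>g t u\<bar> \<le> K \<and> (\<forall>v\<in>{- C..C}. \<bar>g t u - g t v\<bar> \<le> K * \<bar>u - v\<bar>)"
    using locally_lipschitz by blast
  \<comment> \<open>\<open>K * \<tau> \<le> 1 / 2\<close> serves twice: the operator contracts with
    factor 1/2, and its fixed point moves by at most 1/2, hence stays inside the margin 1 between
    \<open>B\<close> and \<open>C\<close>.\<close>
  define \<tau> where "\<tau> = 1 / (2 * (K + 1))"
  have \<tau>: "\<tau> > 0" "K * \<tau> \<le> 1 / 2" using K0 unfolding \<tau>_def by (auto simp: field_simps)
  have "\<exists>y. solution_on g {s..s + \<tau>} y \<and> y s = x0" if x0: "\<bar>x0\<bar> \<le> B" for s x0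
  proof -
    have C: "C \<ge> 1" using x0 unfolding C_def by simp
    \<comment> \<open>Clamping values makes the field globally bounded and Lipschitz; the fixed
      point stays in the range where the clamp is the identity.\<close>
    define cl where "cl v = max (- C) (min C v)" for v
    have cl: "cl v \<in> {- C..C}" for v using C unfolding cl_def by auto
    have cl_lip: "\<bar>cl u - cl v\<bar> \<le> \<bar>u - v\<bar>" for u v unfolding cl_def by auto
    \<comment> \<open>Clamping time makes the Picard operator act on functions on the whole
      line.\<close>
    define p where "p t = max s (min (s + \<tau>) t)" for t
    have p: "p t \<in> {s..s + \<tau>}" for t using \<tau> unfolding p_def by auto
    define h where "h y t = g t (cl (apply_bcontfun y t))" for y t
    have hm: "h y \<in> borel_measurable lebesgue" for y
      unfolding h_def
    proof (rule superposition_measurable)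
      have "continuous_on UNIV (\<lambda>t. cl (apply_bcontfun y t))"
        unfolding cl_def by (intro continuous_intros) auto
      then have "(\<lambda>t. cl (apply_bcontfun y t)) \<in> borel_measurable borel"
        by (rule borel_measurable_continuous_onI)
      then show "(\<lambda>t. cl (apply_bcontfun y t)) \<in> borel_measurable lebesgue"
        by (simp add: measurable_completion)
    qed
    have hK: "AE t in lebesgue. \<bar>h y t\<bar> \<le> K" for y
      using K by eventually_elim (use cl in \<open>auto simp: h_def\<close>)
    have hi: "h y integrable_on {a..b}" for y a b
      using bounded_measurable_integrable[OF hm hK] .
    have hI: "(h y has_integral integral {a..b} (h y)) {a..b}" for y a b
      using hi by blast
    have const: "((\<lambda>t. k) has_integral (b - a) * k) {a..b}" if "a \<le> b" for a b k :: real
      using has_integral_const_real[of k a b] that by simp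
    have ib: "\<bar>integral {a..b} (h y)\<bar> \<le> K * (b - a)" if "a \<le> b" for y a b
    proof -
      have "integral {a..b} (h y) \<le> (b - a) * K"
        by (rule has_integral_AE_le[OF hI const[OF that]]) (use hK[of y] in eventually_elim, auto)
      moreover have "(b - a) * (- K) \<le> integral {a..b} (h y)"
        by (rule has_integral_AE_le[OF const[OF that] hI]) (use hK[of y] in eventually_elim, auto)
      ultimately show ?thesis by (simp add: abs_le_iff algebra_simps)
    qed
    define F where "F y t = x0 + integral {s..p t} (h y)" for y t
    have "F y \<in> bcontfun" for y
    proof (rule bcontfun_normI)
      have "continuous_on UNIV (\<lambda>t. integral {s..p t} (h y))"
      proof (rule continuous_on_compose2[OF indefinite_integral_continuous_1[OF hi]])
        show "continuous_on UNIV p" unfolding p_def by (intro continuous_intros)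
      qed (use p in blast)
      then show "continuous_on UNIV (F y)" unfolding F_def by (intro continuous_intros)
      fix t
      have "\<bar>integral {s..p t} (h y)\<bar> \<le> K * (p t - s)" using p by (intro ib) auto
      also have "\<dots> \<le> K * \<tau>" using p[of t] K0 by (intro mult_left_mono) auto
      finally show "norm (F y t) \<le> \<bar>x0\<bar> + K * \<tau>" unfolding F_def by simp
    qed
    then have aF: "apply_bcontfun (Bcontfun (F y)) = F y" for y by (simp add: Bcontfun_inverse)
    have "\<exists>!y. Bcontfun (F y) = y"
    proof (rule banach_fix_type)
      show "\<forall>y z. dist (Bcontfun (F y)) (Bcontfun (F z)) \<le> 1 / 2 * dist y z"
      proof (intro allI dist_bound)
        fix y z t
        have d: "\<bar>h y u - h z u\<bar> \<le> K * dist y z" if "\<forall>a\<in>{- C..C}. \<bar>g u a\<bar> \<le> K \<and>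
            (\<forall>b\<in>{- C..C}. \<bar>g u a - g u b\<bar> \<le> K * \<bar>a - b\<bar>)" for u
        proof -
          have "\<bar>h y u - h z u\<bar> \<le> K * \<bar>cl (apply_bcontfun y u) - cl (apply_bcontfun z u)\<bar>"
            using that cl unfolding h_def by blast
          also have "\<dots> \<le> K * dist y z"
            using K0 order_trans[OF cl_lip dist_bounded[of y u z, unfolded dist_real_def]]
            by (intro mult_left_mono)
          finally show ?thesis .
        qed
        have sp: "s \<le> p t" using p[of t] by simp
        have di: "((\<lambda>u. h y u - h z u) has_integral F y t - F z t) {s..p t}"
          using has_integral_diff[OF hI[of y s "p t"] hI[of z s "p t"]] unfolding F_def by simp
        have "F y t - F z t \<le> (p t - s) * (K * dist y z)"
          by (rule has_integral_AE_le[OF di const[OF sp]]) (use K in eventually_elim, use d in \<open>auto simp: abs_le_iff\<close>)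
        moreover have "(p t - s) * (- (K * dist y z)) \<le> F y t - F z t"
          by (rule has_integral_AE_le[OF const[OF sp] di]) (use K in eventually_elim, use d in \<open>fastforce simp: abs_le_iff\<close>)
        ultimately have "\<bar>F y t - F z t\<bar> \<le> (p t - s) * (K * dist y z)" by (simp add: abs_le_iff)
        also have "\<dots> \<le> \<tau> * (K * dist y z)" using p[of t] K0 by (intro mult_right_mono) auto
        also have "\<dots> = (K * \<tau>) * dist y z" by simp
        also have "\<dots> \<le> 1 / 2 * dist y z" using \<tau> by (intro mult_right_mono) auto
        finally show "dist (apply_bcontfun (Bcontfun (F y)) t) (apply_bcontfun (Bcontfun (F z)) t) \<le> 1 / 2 * dist y z"
          by (simp add: aF dist_real_def)
      qed
    qed auto
    then obtain Y where Y: "Bcontfun (F Y) = Y" by blast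
    define y where "y = apply_bcontfun Y"
    have yF: "y t = F Y t" for t using aF[of Y] unfolding y_def Y by simp
    have y_eq: "y t = x0 + integral {s..t} (h Y)" if "t \<in> {s..s + \<tau>}" for t
      using that yF unfolding F_def p_def by simp
    have yC: "\<bar>y t\<bar> \<le> C" if "t \<in> {s..s + \<tau>}" for t
    proof -
      have "\<bar>integral {s..t} (h Y)\<bar> \<le> K * (t - s)" using that by (intro ib) auto
      also have "\<dots> \<le> K * \<tau>" using that K0 by (intro mult_left_mono) auto
      finally show ?thesis using y_eq[OF that] x0 \<tau>(2) unfolding C_def by linarith
    qed
    have hY: "h Y t = g t (y t)" if "t \<in> {s..s + \<tau>}" for t
      using yC[OF that] unfolding h_def y_def cl_def by auto
    have "piece g s (s + \<tau>) y"
      unfolding piece_def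
    proof (intro conjI lip_onI)
      fix u v assume uv: "s \<le> u" "u < v" "v \<le> s + \<tau>"
      have "integral {s..u} (h Y) + integral {u..v} (h Y) = integral {s..v} (h Y)"
        using uv by (intro Henstock_Kurzweil_Integration.integral_combine hi) auto
      then have "y v - y u = integral {u..v} (h Y)" using y_eq[of u] y_eq[of v] uv by auto
      then show "\<bar>y v - y u\<bar> \<le> K * (v - u)" using ib[of u v Y] uv by simp
    next
      have "AE t in lebesgue. \<forall>c<t. ((\<lambda>u. integral {c..u} (h Y)) has_real_derivative h Y t) (at t)"
        using hi by (rule integral_derivative_AE)
      then show "AE t in lebesgue. t \<in> {s<..<s + \<tau>} \<longrightarrow> (y has_real_derivative g t (y t)) (at t)"
      proof eventually_elim
        case (elim t)
        show ?case
        proof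
          assume t: "t \<in> {s<..<s + \<tau>}"
          have "((\<lambda>u. x0 + integral {s..u} (h Y)) has_real_derivative h Y t) (at t)"
            using elim t by (auto intro!: derivative_eq_intros)
          then have "(y has_real_derivative h Y t) (at t)"
            by (rule has_field_derivative_transform_within_open[of _ _ _ "{s<..<s + \<tau>}"]) (use t y_eq in auto)
          then show "(y has_real_derivative g t (y t)) (at t)" using hY t by simp
        qed
      qed
    qed
    then have "solution_on g {s..s + \<tau>} y"
      unfolding solution_on_iff by (auto intro: piece_subset is_interval_cc)
    moreover have "y s = x0" using y_eq[of s] \<tau> by simp
    ultimately show ?thesis by blast
  qed
  then show ?thesis using \<tau>(1) by blast
qed


text \<open>By uniqueness all solutions through the given point agree on common parts of their
  domains, so their union is a solution and no choice of a maximal chain is needed.\<close>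

lemma maximal_solution_exists:
  "\<exists>J x. maximal_solution g J x \<and> s \<in> J \<and> x s = x0"
proof -
  define S where "S = {(K, y). solution_on g K y \<and> s \<in> K \<and> y s = x0}"
  define J where "J = \<Union> (fst ` S)"
  have SD: "solution_on g K y" "s \<in> K" "y s = x0" if "(K, y) \<in> S" for K y
    using that unfolding S_def by auto
  \<comment> \<open>A one-point domain is an interval and carries no condition, so that the family
    is not empty.\<close>
  have "({s}, \<lambda>_. x0) \<in> S"
    unfolding S_def solution_on_iff by (auto simp: is_interval_1 subset_singleton_iff Icc_eq_Icc)
  then have sJ: "s \<in> J" unfolding J_def by force
  have "\<forall>t\<in>J. \<exists>K y. (K, y) \<in> S \<and> t \<in> K" unfolding J_def by auto
  then obtain KK yy where KK: "\<And>t. t \<in> J \<Longrightarrow> (KK t, yy t) \<in> S" "\<And>t. t \<in> J \<Longrightarrow> t \<in> KK t" by metis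
  define x where "x t = yy t t" for t
  have xy: "x t = y t" if "(K, y) \<in> S" "t \<in> K" for K y t
  proof -
    have tJ: "t \<in> J" using that unfolding J_def by force
    let ?K = "K \<inter> KK t"
    have iK: "is_interval ?K"
      using SD[OF that(1)] SD[OF KK(1)[OF tJ]] solution_on_interval is_interval_Int by blast
    have "solution_on g ?K (yy t)" "solution_on g ?K y"
      using solution_on_subset[OF SD(1)[OF KK(1)[OF tJ]] _ iK] solution_on_subset[OF SD(1)[OF that(1)] _ iK]
      by auto
    then have "yy t t = y t"
      by (rule solution_unique[where s = s and x = "yy t" and y = y]) (use SD[OF that(1)] SD[OF KK(1)[OF tJ]] KK(2)[OF tJ] that in auto)
    then show ?thesis unfolding x_def .
  qed
  have xsol: "solution_on g K x" if "(K, y) \<in> S" for K y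
    using solution_on_cong[OF SD(1)[OF that]] xy[OF that] by blast
  have "solution_on g J x"
    unfolding solution_on_iff
  proof (intro conjI allI impI)
    have "connected (\<Union> (fst ` S))"
    proof (rule connected_Union)
      show "connected K" if KS: "K \<in> fst ` S" for K
      proof -
        obtain y where "(K, y) \<in> S" using KS by force
        then show ?thesis using SD(1) solution_on_interval is_interval_connected_1 by blast
      qed
      have "s \<in> \<Inter> (fst ` S)" using SD(2) by auto
      then show "\<Inter> (fst ` S) \<noteq> {}" by blast
    qed
    then show "is_interval J" unfolding J_def is_interval_connected_1 .
    fix c d assume cd: "c < d" "{c..d} \<subseteq> J"
    then have "c \<in> J" "d \<in> J" by auto
    then have K: "solution_on g (KK c) x" "solution_on g (KK d) x" "s \<in> KK c" "s \<in> KK d" "c \<in> KK c" "d \<in> KK d"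
      using KK xsol SD(2) by blast+
    have U: "solution_on g (KK c \<union> KK d) x" using solution_on_union[OF K(1-4)] .
    have "{c..d} \<subseteq> KK c \<union> KK d"
      using interval_subset[OF solution_on_interval[OF U]] K(5,6) by blast
    with U show "piece g c d x" by (rule solution_on_piece)
  qed
  moreover have "K = J" if "solution_on g K y" "J \<subseteq> K" "\<forall>t\<in>J. y t = x t" for K y
  proof -
    have "x s = x0" using xy[OF KK(1)[OF sJ]] SD[OF KK(1)[OF sJ]] by metis
    then have "(K, y) \<in> S" using that sJ unfolding S_def by auto
    then show ?thesis using that(2) unfolding J_def by force
  qed
  moreover have "x s = x0" using xy[OF KK(1)[OF sJ]] SD[OF KK(1)[OF sJ]] by metis
  ultimately show ?thesis using sJ unfolding maximal_solution_def by blast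
qed

lemma maximal_solution_sol: "maximal_solution g (sol_dom g s x0) (sol g s x0)"
  and in_sol_dom: "s \<in> sol_dom g s x0"
  and sol_initial: "sol g s x0 s = x0"
proof -
  have "case maximal_solution_from g s x0 of (J, x) \<Rightarrow> maximal_solution g J x \<and> s \<in> J \<and> x s = x0"
    unfolding maximal_solution_from_def
    by (rule someI_ex) (use maximal_solution_exists[of s x0] in auto)
  then show "maximal_solution g (sol_dom g s x0) (sol g s x0)" "s \<in> sol_dom g s x0" "sol g s x0 s = x0"
    unfolding sol_dom_def sol_def by (auto simp: case_prod_unfold)
qed

lemma maximal_solutionD: "maximal_solution g J x \<Longrightarrow> solution_on g J x"
  unfolding maximal_solution_def by blast

lemma solution_on_sol: "solution_on g (sol_dom g s x0) (sol g s x0)"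
  using maximal_solution_sol maximal_solutionD by blast

text \<open>Any solution that meets a maximal one can be glued to it, so it is a restriction of it.
  This makes \<open>sol_dom\<close> and the values of \<open>sol\<close> independent of the choice
  operator.\<close>

lemma maximal_solution_extends:
  assumes J: "maximal_solution g J x" and K: "solution_on g K y" and s: "s \<in> J" "s \<in> K" "y s = x s"
  shows "K \<subseteq> J" and "\<And>t. t \<in> K \<Longrightarrow> y t = x t"
proof -
  define z where "z t = (if t \<in> J then x t else y t)" for t
  have iK: "is_interval (J \<inter> K)"
    using maximal_solutionD[OF J] K solution_on_interval is_interval_Int by blast
  have eq: "x t = y t" if "t \<in> J" "t \<in> K" for t
  proof (rule solution_unique[where J = "J \<inter> K" and s = s and x = x and y = y])
    show "solution_on g (J \<inter> K) x" "solution_on g (J \<inter> K) y"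
      using solution_on_subset[OF maximal_solutionD[OF J] _ iK] solution_on_subset[OF K _ iK] by auto
  qed (use that s in auto)
  have "solution_on g J z" using maximal_solutionD[OF J] by (rule solution_on_cong) (simp add: z_def)
  moreover have "solution_on g K z" using K by (rule solution_on_cong) (use eq in \<open>auto simp: z_def\<close>)
  ultimately have "solution_on g (J \<union> K) z" using s by (intro solution_on_union)
  moreover have "\<forall>t\<in>J. z t = x t" unfolding z_def by simp
  ultimately have "J \<union> K = J" using J unfolding maximal_solution_def by blast
  then show "K \<subseteq> J" by blast
  with eq show "\<And>t. t \<in> K \<Longrightarrow> y t = x t" by auto
qed

lemma maximal_solution_unique:
  assumes J: "maximal_solution g J x" and s: "s \<in> J"
  shows "sol_dom g s (x s) = J" and "\<And>t. t \<in> J \<Longrightarrow> sol g s (x s) t = x t"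
proof -
  have "sol_dom g s (x s) \<subseteq> J"
    using maximal_solution_extends(1)[OF J solution_on_sol s in_sol_dom sol_initial] .
  moreover have *: "x s = sol g s (x s) s" by (simp add: sol_initial)
  have "J \<subseteq> sol_dom g s (x s)"
    using maximal_solution_extends(1)[OF maximal_solution_sol maximal_solutionD[OF J] in_sol_dom s *] .
  ultimately show "sol_dom g s (x s) = J" by blast
  show "\<And>t. t \<in> J \<Longrightarrow> sol g s (x s) t = x t"
    using maximal_solution_extends(2)[OF maximal_solution_sol maximal_solutionD[OF J] in_sol_dom s *] by simp
qed

lemma sol_extends:
  assumes "solution_on g K y" "s \<in> K"
  shows "K \<subseteq> sol_dom g s (y s)" and "\<And>t. t \<in> K \<Longrightarrow> sol g s (y s) t = y t"
proof -
  have *: "y s = sol g s (y s) s" by (simp add: sol_initial)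
  show "K \<subseteq> sol_dom g s (y s)"
    using maximal_solution_extends(1)[OF maximal_solution_sol assms(1) in_sol_dom assms(2) *] .
  show "\<And>t. t \<in> K \<Longrightarrow> sol g s (y s) t = y t"
    using maximal_solution_extends(2)[OF maximal_solution_sol assms(1) in_sol_dom assms(2) *] by simp
qed

text \<open>The uniform existence time of \<open>local_existence\<close>: a bounded solution
  restarted closer than \<tau> to a finite supremum of its domain would pass that supremum.\<close>

lemma maximal_solution_forward:
  assumes J: "maximal_solution g J x" and s: "s \<in> J" "s \<le> e"
    and B: "\<And>t. t \<in> J \<Longrightarrow> s \<le> t \<Longrightarrow> t \<le> e \<Longrightarrow> \<bar>x t\<bar> \<le> B"
  shows "\<exists>\<epsilon>>0. {s..e + \<epsilon>} \<subseteq> J"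
proof (cases "\<exists>t\<in>J. t > e")
  case True
  then obtain t where t: "t \<in> J" "t > e" by blast
  have "{s..t} \<subseteq> J" using interval_subset solution_on_interval maximal_solutionD J s t by blast
  then show ?thesis using t by (intro exI[of _ "t - e"]) simp
next
  case False
  then have Je: "\<And>t. t \<in> J \<Longrightarrow> t \<le> e" by force
  then have bdd: "bdd_above J" by (auto intro!: bdd_aboveI)
  obtain \<tau> where \<tau>: "\<tau> > 0" "\<And>s x0. \<bar>x0\<bar> \<le> B \<Longrightarrow> \<exists>y. solution_on g {s..s + \<tau>} y \<and> y s = x0"
    using local_existence[of B] by blast
  obtain t0 where t0: "t0 \<in> J" "Sup J - \<tau> < t0"
    using less_cSupE[of "Sup J - \<tau>" J] \<tau> s by auto
  define t where "t = max t0 s"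
  have t: "t \<in> J" "s \<le> t" "Sup J < t + \<tau>" using t0 s unfolding t_def by (auto simp: max_def)
  obtain y where y: "solution_on g {t..t + \<tau>} y" "y t = x t"
    using \<tau>(2)[OF B[OF t(1,2) Je[OF t(1)]]] by blast
  have "{t..t + \<tau>} \<subseteq> J" using maximal_solution_extends(1)[OF J y(1) t(1) _ y(2)] \<tau> by simp
  then have "t + \<tau> \<in> J" using \<tau> by auto
  then have "t + \<tau> \<le> Sup J" using bdd by (rule cSup_upper)
  then show ?thesis using t by simp
qed

end


section \<open>Time reversal\<close>

definition rv :: "(real \<Rightarrow> real) \<Rightarrow> real \<Rightarrow> real" where
  "rv x t = - x (- t)"

text \<open>The derivative of \<open>- x (- t)\<close> is that of \<open>x\<close> at
  \<open>- t\<close>, so the field gets no sign in front: \<open>rv\<close> turns solutions of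
  \<open>g\<close> into solutions of \<open>rev_field g\<close>. A function of \<open>x\<close> and
  its reflection in 0 are concave together, and the sign at infinity is kept.\<close>

definition rev_field :: "(real \<Rightarrow> real \<Rightarrow> real) \<Rightarrow> real \<Rightarrow> real \<Rightarrow> real" where
  "rev_field g t x = g (- t) (- x)"

lemma rv_rv [simp]: "rv (rv x) = x"
  unfolding rv_def by auto

lemma rev_field_rev_field [simp]: "rev_field (rev_field g) = g"
  unfolding rev_field_def by auto

lemma uminus_uminus_image [simp]: "uminus ` uminus ` J = (J :: real set)"
  by (auto simp: image_image)

lemma mem_uminus_image_iff: "t \<in> uminus ` J \<longleftrightarrow> - t \<in> (J :: real set)"
  by (metis (no_types, opaque_lifting) add.inverse_inverse image_iff)

lemma rv_derivative:
  assumes "(x has_real_derivative D) (at (- t))"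
  shows "(rv x has_real_derivative D) (at t)"
proof -
  have "((\<lambda>u. x (- u)) has_real_derivative D * (- 1)) (at t)"
    using DERIV_chain2[of x D "\<lambda>u. - u" t "- 1" UNIV] assms by (simp add: DERIV_minus[OF DERIV_ident])
  from DERIV_minus[OF this] have "((\<lambda>u. - x (- u)) has_real_derivative D) (at t)" by simp
  then show ?thesis unfolding rv_def[abs_def] .
qed

lemma piece_rv:
  assumes p: "piece g c d x"
  shows "piece (rev_field g) (- d) (- c) (rv x)"
  unfolding piece_def
proof
  obtain L where L: "\<And>u v. u \<in> {c..d} \<Longrightarrow> v \<in> {c..d} \<Longrightarrow> \<bar>x u - x v\<bar> \<le> L * \<bar>u - v\<bar>"
    using lip_onE[OF piece_lip_on[OF p]] by metis
  show "lip_on (- d) (- c) (rv x)"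
  proof (rule lip_onI[of _ _ _ L])
    fix u v assume "- d \<le> u" "u < v" "v \<le> - c"
    then show "\<bar>rv x v - rv x u\<bar> \<le> L * (v - u)" using L[of "- u" "- v"] by (simp add: rv_def)
  qed
  show "AE t in lebesgue. t \<in> {- d<..<- c} \<longrightarrow> (rv x has_real_derivative rev_field g t (rv x t)) (at t)"
    using AE_lebesgue_reflect[OF piece_derivative[OF p]]
    by eventually_elim (auto simp: rev_field_def rv_def[of x] intro!: rv_derivative)
qed

context caratheodory
begin

lemma caratheodory_rev_field: "caratheodory (rev_field g)"
proof
  fix x :: "real \<Rightarrow> real" assume "x \<in> borel_measurable lebesgue"
  then have "(\<lambda>t. - x (- t)) \<in> borel_measurable lebesgue"
    using measurable_lebesgue_reflect by (intro borel_measurable_uminus)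
  from measurable_lebesgue_reflect[OF superposition_measurable[OF this]]
  show "(\<lambda>t. rev_field g t (x t)) \<in> borel_measurable lebesgue"
    unfolding rev_field_def by simp
next
  fix B
  obtain K where K: "K \<ge> 0" "AE t in lebesgue. \<forall>u\<in>{- B..B}.
      \<bar>g t u\<bar> \<le> K \<and> (\<forall>v\<in>{- B..B}. \<bar>g t u - g t v\<bar> \<le> K * \<bar>u - v\<bar>)"
    using locally_lipschitz by blast
  have "AE t in lebesgue. \<forall>u\<in>{- B..B}. \<bar>rev_field g t u\<bar> \<le> K \<and>
      (\<forall>v\<in>{- B..B}. \<bar>rev_field g t u - rev_field g t v\<bar> \<le> K * \<bar>u - v\<bar>)"
    using AE_lebesgue_reflect[OF K(2)]
  proof eventually_elim
    case (elim t)
    show ?case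
    proof (intro ballI conjI)
      fix u v assume u: "u \<in> {- B..B}" and v: "v \<in> {- B..B}"
      have "- u \<in> {- B..B}" "- v \<in> {- B..B}" using u v by auto
      with elim have "\<bar>g (- t) (- u) - g (- t) (- v)\<bar> \<le> K * \<bar>- u - - v\<bar>" by blast
      then show "\<bar>rev_field g t u - rev_field g t v\<bar> \<le> K * \<bar>u - v\<bar>"
        unfolding rev_field_def by (simp add: abs_minus_commute)
    next
      fix u assume u: "u \<in> {- B..B}"
      have "- u \<in> {- B..B}" using u by auto
      with elim show "\<bar>rev_field g t u\<bar> \<le> K" unfolding rev_field_def by blast
    qed
  qed
  then show "\<exists>K\<ge>0. AE t in lebesgue. \<forall>u\<in>{- B..B}. \<bar>rev_field g t u\<bar> \<le> K \<and>
      (\<forall>v\<in>{- B..B}. \<bar>rev_field g t u - rev_field g t v\<bar> \<le> K * \<bar>u - v\<bar>)"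
    using K(1) by blast
qed

lemma solution_on_rv:
  assumes "solution_on g J x"
  shows "solution_on (rev_field g) (uminus ` J) (rv x)"
  unfolding caratheodory.solution_on_iff[OF caratheodory_rev_field]
proof (intro conjI allI impI)
  have "is_interval J" using assms by (rule solution_on_interval)
  then show "is_interval (uminus ` J)" by simp
  fix c d assume "c < d" "{c..d} \<subseteq> uminus ` J"
  then have "uminus ` {c..d} \<subseteq> J" by fastforce
  then have "{- d..- c} \<subseteq> J" by simp
  then show "piece (rev_field g) c d (rv x)"
    using piece_rv[OF solution_on_piece[OF assms], of "- d" "- c"] by simp
qed

lemma solution_on_rv_iff: "solution_on (rev_field g) (uminus ` J) (rv x) \<longleftrightarrow> solution_on g J x"
  using solution_on_rv caratheodory.solution_on_rv[OF caratheodory_rev_field, of "uminus ` J" "rv x"] by auto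

lemma maximal_solution_rv:
  assumes m: "maximal_solution g J x"
  shows "maximal_solution (rev_field g) (uminus ` J) (rv x)"
  unfolding maximal_solution_def
proof (intro conjI allI impI; (elim conjE)?)
  show "solution_on (rev_field g) (uminus ` J) (rv x)"
    using maximal_solutionD[OF m] by (rule solution_on_rv)
  fix K y assume K: "solution_on (rev_field g) K y" "uminus ` J \<subseteq> K" "\<forall>t\<in>uminus ` J. y t = rv x t"
  have "solution_on g (uminus ` K) (rv y)"
    using K(1) solution_on_rv_iff[of "uminus ` K" "rv y"] by simp
  moreover have "J \<subseteq> uminus ` K" using K(2) image_mono[OF K(2), of uminus] by simp
  moreover have "\<forall>t\<in>J. rv y t = x t" using K(3) by (auto simp: rv_def)
  ultimately have "uminus ` K = J" using m unfolding maximal_solution_def by blast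
  then show "K = uminus ` J" by auto
qed

lemma sol_rev_field:
  "sol_dom (rev_field g) (- s) (- x0) = uminus ` sol_dom g s x0"
  "t \<in> sol_dom g s x0 \<Longrightarrow> sol (rev_field g) (- s) (- x0) (- t) = - sol g s x0 t"
proof -
  let ?x = "rv (sol g s x0)"
  have m: "maximal_solution (rev_field g) (uminus ` sol_dom g s x0) ?x"
    by (rule maximal_solution_rv[OF maximal_solution_sol])
  have s: "- s \<in> uminus ` sol_dom g s x0" using in_sol_dom by blast
  have eq: "?x (- s) = - x0" by (simp add: rv_def sol_initial)
  note u = caratheodory.maximal_solution_unique[OF caratheodory_rev_field m s, unfolded eq]
  show "sol_dom (rev_field g) (- s) (- x0) = uminus ` sol_dom g s x0" by (rule u(1))
  show "sol (rev_field g) (- s) (- x0) (- t) = - sol g s x0 t" if "t \<in> sol_dom g s x0"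
    using u(2)[of "- t"] that by (simp add: rv_def)
qed

lemma bounded_in_past_rev_field:
  "bounded_in_past (sol_dom (rev_field g) (- s) (- x0)) (sol (rev_field g) (- s) (- x0)) \<longleftrightarrow>
     bounded_in_future (sol_dom g s x0) (sol g s x0)"
proof -
  have 1: "{..T} \<subseteq> uminus ` J \<longleftrightarrow> {- T..} \<subseteq> J" for T and J :: "real set"
    by (metis image_mono image_uminus_atMost uminus_uminus_image)
  have 2: "bounded (sol (rev_field g) (- s) (- x0) ` {..- T}) \<longleftrightarrow> bounded (sol g s x0 ` {T..})"
    if "{T..} \<subseteq> sol_dom g s x0" for T
  proof -
    have "sol (rev_field g) (- s) (- x0) ` {..- T} = (\<lambda>t. sol (rev_field g) (- s) (- x0) (- t)) ` {T..}"
      by (simp add: image_image flip: image_uminus_atLeast)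
    also have "\<dots> = uminus ` sol g s x0 ` {T..}"
      unfolding image_image using that sol_rev_field(2) by (intro image_cong) auto
    finally show ?thesis by simp
  qed
  show ?thesis
    unfolding bounded_in_past_def bounded_in_future_def sol_rev_field(1) 1 using 2
    by (metis add.inverse_inverse)
qed

lemma maximal_solution_backward:
  assumes J: "maximal_solution g J x" and s: "s \<in> J" "e \<le> s"
    and B: "\<And>t. t \<in> J \<Longrightarrow> e \<le> t \<Longrightarrow> t \<le> s \<Longrightarrow> \<bar>x t\<bar> \<le> B"
  shows "\<exists>\<epsilon>>0. {e - \<epsilon>..s} \<subseteq> J"
proof -
  have "\<exists>\<epsilon>>0. {- s..- e + \<epsilon>} \<subseteq> uminus ` J"
  proof (rule caratheodory.maximal_solution_forward[OF caratheodory_rev_field maximal_solution_rv[OF J]])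
    show "\<bar>rv x t\<bar> \<le> B" if "t \<in> uminus ` J" "- s \<le> t" "t \<le> - e" for t
      using B[of "- t"] that by (auto simp: rv_def)
  qed (use s in auto)
  then obtain \<epsilon> where \<epsilon>: "\<epsilon> > 0" "{- s..- e + \<epsilon>} \<subseteq> uminus ` J" by blast
  then have "uminus ` {- s..- e + \<epsilon>} \<subseteq> J" using image_mono[OF \<epsilon>(2), of uminus] by simp
  then show ?thesis using \<epsilon>(1) by (intro exI[of _ \<epsilon>]) simp
qed

text \<open>Dictionary between past and future: each fact on upper past solutions, read for the
  reversed equation, becomes one on lower future solutions.\<close>

lemma upper_past_solution_rv:
  "upper_past_solution (rev_field g) (uminus ` J) (rv r) \<longleftrightarrow> lower_future_solution g J r"
proof -
  have 1: "(uminus ` J = UNIV \<or> (\<exists>\<beta>. uminus ` J = {..<\<beta>})) \<longleftrightarrow> (J = UNIV \<or> (\<exists>\<alpha>. J = {\<alpha><..}))"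
    by (metis image_uminus_greaterThan image_uminus_lessThan surj_uminus uminus_uminus_image)
  have 2: "maximal_solution (rev_field g) (uminus ` J) (rv r) \<longleftrightarrow> maximal_solution g J r"
    using maximal_solution_rv caratheodory.maximal_solution_rv[OF caratheodory_rev_field, of "uminus ` J" "rv r"]
    by auto
  have 3: "(\<forall>s\<in>uminus ` J. \<forall>x0. bounded_in_past (sol_dom (rev_field g) s x0) (sol (rev_field g) s x0) \<longleftrightarrow> x0 \<le> rv r s)
      \<longleftrightarrow> (\<forall>s\<in>J. \<forall>x0. bounded_in_future (sol_dom g s x0) (sol g s x0) \<longleftrightarrow> x0 \<ge> r s)" (is "?L \<longleftrightarrow> ?R")
  proof
    assume L: ?L
    show ?R
    proof (intro ballI allI)
      fix s x0 assume "s \<in> J"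
      then have "bounded_in_past (sol_dom (rev_field g) (- s) (- x0)) (sol (rev_field g) (- s) (- x0)) \<longleftrightarrow> - x0 \<le> rv r (- s)"
        using L by blast
      then show "bounded_in_future (sol_dom g s x0) (sol g s x0) \<longleftrightarrow> x0 \<ge> r s"
        unfolding bounded_in_past_rev_field by (simp add: rv_def)
    qed
  next
    assume R: ?R
    show ?L
    proof (intro ballI allI)
      fix s x0 assume "s \<in> uminus ` J"
      then have "bounded_in_future (sol_dom g (- s) (- x0)) (sol g (- s) (- x0)) \<longleftrightarrow> - x0 \<ge> r (- s)"
        using R by (auto simp: mem_uminus_image_iff)
      then show "bounded_in_past (sol_dom (rev_field g) s x0) (sol (rev_field g) s x0) \<longleftrightarrow> x0 \<le> rv r s"
        using bounded_in_past_rev_field[of "- s" "- x0"] by (auto simp: rv_def)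
    qed
  qed
  have f: "filterlim (rv r) at_bot (at_left (- \<alpha>)) \<longleftrightarrow> filterlim r at_top (at_right \<alpha>)" for \<alpha>
    by (simp add: rv_def filterlim_at_left_to_right[of _ _ "- \<alpha>"] filterlim_uminus_at_top[of r])
  have 4: "(\<forall>\<beta>. uminus ` J = {..<\<beta>} \<longrightarrow> filterlim (rv r) at_bot (at_left \<beta>)) \<longleftrightarrow>
      (\<forall>\<alpha>. J = {\<alpha><..} \<longrightarrow> filterlim r at_top (at_right \<alpha>))"
  proof -
    have "uminus ` J = {..<\<beta>} \<longleftrightarrow> J = {- \<beta><..}" for \<beta>
      by (metis image_uminus_lessThan uminus_uminus_image)
    then show ?thesis using f by (metis add.inverse_inverse)
  qed
  show ?thesis
    unfolding upper_past_solution_def lower_future_solution_def 1 2 3 4 ..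
qed

end

section \<open>Dissipative equations\<close>

text \<open>The field points down for large \<open>x\<close> of either sign, so solutions can
  explode only to -\<infinity> forward and only to +\<infinity> backward. The quadratic rate makes
  the backward explosion above \<rho> happen in finite time.\<close>

locale dissipative = caratheodory g for g +
  fixes \<rho> \<kappa> :: real
  assumes \<rho>: "\<rho> > 0" and \<kappa>: "\<kappa> > 0"
    and dissipation: "AE t in lebesgue. \<forall>x. \<bar>x\<bar> \<ge> \<rho> \<longrightarrow> g t x \<le> - \<kappa> * x\<^sup>2"
begin

lemma dissipative_rev_field: "dissipative (rev_field g) \<rho> \<kappa>"
proof -
  interpret R: caratheodory "rev_field g" by (rule caratheodory_rev_field)
  show ?thesis
  proof
    show "AE t in lebesgue. \<forall>x. \<bar>x\<bar> \<ge> \<rho> \<longrightarrow> rev_field g t x \<le> - \<kappa> * x\<^sup>2"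
      using AE_lebesgue_reflect[OF dissipation]
    proof eventually_elim
      case (elim t)
      show ?case
      proof (intro allI impI)
        fix x assume "\<bar>x\<bar> \<ge> \<rho>"
        then show "rev_field g t x \<le> - \<kappa> * x\<^sup>2" using elim[rule_format, of "- x"] by (simp add: rev_field_def)
      qed
    qed
  qed (rule \<rho> \<kappa>)+
qed

lemma solution_forward_upper:
  assumes x: "solution_on g J x" and st: "s \<in> J" "t \<in> J" "s \<le> t"
  shows "x t \<le> max (x s) \<rho>"
proof -
  have p: "piece g s t x"
    using solution_on_piece[OF x] interval_subset[OF solution_on_interval[OF x] st(1,2)] by blast
  have "x t - max (x s) \<rho> \<le> 0"
  proof (rule lip_on_barrier[where h = 1 and c = s and d = t and w = "\<lambda>u. x u - max (x s) \<rho>"])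
    show "lip_on s t (\<lambda>u. x u - max (x s) \<rho>)"
      using piece_lip_on[OF p] by (intro lip_on_intros)
    show "AE u in lebesgue. u \<in> {s<..<t} \<longrightarrow> 0 < x u - max (x s) \<rho> \<longrightarrow> x u - max (x s) \<rho> < 1 \<longrightarrow>
        (\<exists>D\<le>0. ((\<lambda>u. x u - max (x s) \<rho>) has_real_derivative D) (at u))"
      using piece_derivative[OF p] dissipation
    proof eventually_elim
      case (elim u)
      show ?case
      proof (intro impI)
        assume u: "u \<in> {s<..<t}" and w: "0 < x u - max (x s) \<rho>"
        have "((\<lambda>u. x u - max (x s) \<rho>) has_real_derivative g u (x u) - 0) (at u)"
          using elim(1) u by (intro DERIV_diff DERIV_const) auto
        moreover have "g u (x u) \<le> - \<kappa> * (x u)\<^sup>2" using elim(2) w by auto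
        then have "g u (x u) - 0 \<le> 0"
          using \<kappa> by (smt (verit) mult_minus_left mult_nonneg_nonneg zero_le_power2)
        ultimately show "\<exists>D\<le>0. ((\<lambda>u. x u - max (x s) \<rho>) has_real_derivative D) (at u)"
          by (intro exI[of _ "g u (x u) - 0"]) simp
      qed
    qed
  qed (use st in auto)
  then show ?thesis by simp
qed

lemma solution_backward_lower:
  assumes x: "solution_on g J x" and st: "s \<in> J" "t \<in> J" "s \<le> t"
  shows "x s \<ge> min (x t) (- \<rho>)"
proof -
  have "rv x (- s) \<le> max (rv x (- t)) \<rho>"
    using dissipative.solution_forward_upper[OF dissipative_rev_field solution_on_rv[OF x], of "- t" "- s"] st
    by simp
  then show ?thesis by (auto simp: rv_def)
qed

text \<open>Above \<open>\<rho>\<close> the function \<open>\<kappa> t - 1 / x\<close> decreases, so that \<open>x\<close> blows up in backward time.\<close>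

lemma past_solution_le:
  assumes x: "solution_on g J x" and s: "{..s} \<subseteq> J"
  shows "x s \<le> \<rho>"
proof (rule ccontr)
  assume n: "\<not> x s \<le> \<rho>"
  have big: "x t > \<rho>" if "t \<le> s" for t
    using solution_forward_upper[OF x, of t s] that s n by fastforce
  \<comment> \<open>Over this length \<open>\<kappa> * t\<close> changes by
    \<open>1 / \<rho>\<close>, more than \<open>inverse x\<close> can change while it stays between
    0 and \<open>1 / \<rho>\<close>.\<close>
  define t0 where "t0 = s - 1 / (\<kappa> * \<rho>)"
  have t0: "t0 \<le> s" "\<kappa> * (s - t0) = 1 / \<rho>" using \<rho> \<kappa> unfolding t0_def by auto
  have p: "piece g t0 s x" by (rule solution_on_piece[OF x]) (use s in auto)
  have "\<kappa> * s - inverse (x s) \<le> \<kappa> * t0 - inverse (x t0)"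
  proof (rule lip_on_nonincreasing[OF t0(1), of "\<lambda>t. \<kappa> * t - inverse (x t)"])
    show "lip_on t0 s (\<lambda>t. \<kappa> * t - inverse (x t))"
      using piece_lip_on[OF p] big \<rho> by (intro lip_on_intros lip_on_inverse[where m = \<rho>]) (auto intro: less_imp_le)
    show "AE t in lebesgue. t \<in> {t0<..<s} \<longrightarrow> (\<exists>D\<le>0. ((\<lambda>t. \<kappa> * t - inverse (x t)) has_real_derivative D) (at t))"
      using piece_derivative[OF p] dissipation
    proof eventually_elim
      case (elim t)
      show ?case
      proof
        assume t: "t \<in> {t0<..<s}"
        then have xt: "x t > \<rho>" "(x has_real_derivative g t (x t)) (at t)" using big elim by auto
        have pos: "(x t)\<^sup>2 > 0" "x t \<noteq> 0" using xt \<rho> by auto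
        have "g t (x t) \<le> - \<kappa> * (x t)\<^sup>2" using elim(2) xt by auto
        then have "g t (x t) / (x t)\<^sup>2 \<le> - \<kappa>" using pos by (simp add: pos_divide_le_eq)
        moreover have "((\<lambda>t. \<kappa> * t - inverse (x t)) has_real_derivative \<kappa> + g t (x t) / (x t)\<^sup>2) (at t)"
          using xt(2) pos(2) by (auto intro!: derivative_eq_intros simp: power2_eq_square divide_inverse mult_ac)
        ultimately show "\<exists>D\<le>0. ((\<lambda>t. \<kappa> * t - inverse (x t)) has_real_derivative D) (at t)"
          by (intro exI[of _ "\<kappa> + g t (x t) / (x t)\<^sup>2"]) simp
      qed
    qed
  qed
  moreover have "inverse (x s) < 1 / \<rho>" using big[of s] \<rho> by (simp add: divide_inverse)
  moreover have "inverse (x t0) > 0" using big[OF t0(1)] \<rho> by simp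
  moreover have "\<kappa> * s - \<kappa> * t0 = 1 / \<rho>" using t0(2) by (simp add: algebra_simps)
  ultimately show False by linarith
qed

lemma abs_le_of_bounds: "m \<le> x \<Longrightarrow> x \<le> M \<Longrightarrow> \<bar>x\<bar> \<le> \<bar>M\<bar> + \<bar>m\<bar>" for x :: real
  by linarith

text \<open>Only an upper bound is needed: in backward time dissipation itself bounds solutions from
  below.\<close>

lemma past_global_if_bounded:
  assumes "\<And>t. t \<in> sol_dom g s x0 \<Longrightarrow> t \<le> s \<Longrightarrow> sol g s x0 t \<le> C"
  shows "{..s} \<subseteq> sol_dom g s x0"
proof
  fix e assume e: "e \<in> {..s}"
  have "\<exists>\<epsilon>>0. {e - \<epsilon>..s} \<subseteq> sol_dom g s x0"
  proof (rule maximal_solution_backward[OF maximal_solution_sol in_sol_dom])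
    fix t assume t: "t \<in> sol_dom g s x0" "t \<le> s"
    have "sol g s x0 t \<ge> min x0 (- \<rho>)"
      using solution_backward_lower[OF solution_on_sol t(1) in_sol_dom t(2)] unfolding sol_initial .
    then show "\<bar>sol g s x0 t\<bar> \<le> \<bar>C\<bar> + \<bar>min x0 (- \<rho>)\<bar>"
      by (rule abs_le_of_bounds) (rule assms[OF t])
  qed (use e in simp)
  then show "e \<in> sol_dom g s x0" using e by auto
qed

lemma forward_if_bounded:
  assumes x: "maximal_solution g J x" and s: "s \<in> J" "s \<le> e"
    and C: "\<And>t. t \<in> J \<Longrightarrow> s \<le> t \<Longrightarrow> t \<le> e \<Longrightarrow> x t \<ge> C"
  shows "\<exists>\<epsilon>>0. {s..e + \<epsilon>} \<subseteq> J"
proof (rule maximal_solution_forward[OF x s])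
  fix t assume t: "t \<in> J" "s \<le> t" "t \<le> e"
  show "\<bar>x t\<bar> \<le> \<bar>max (x s) \<rho>\<bar> + \<bar>C\<bar>"
    using C[OF t] solution_forward_upper[OF maximal_solutionD[OF x] s(1) t(1,2)] by (rule abs_le_of_bounds)
qed

lemma solution_le_overlap:
  assumes x: "solution_on g J x" and y: "solution_on g K y"
    and "s \<in> J" "s \<in> K" "t \<in> J" "t \<in> K" "x s \<le> y s"
  shows "x t \<le> y t"
proof (rule solution_le[of "J \<inter> K" x y s])
  have i: "is_interval (J \<inter> K)" using x y solution_on_interval is_interval_Int by blast
  show "solution_on g (J \<inter> K) x" "solution_on g (J \<inter> K) y"
    using solution_on_subset[OF x _ i] solution_on_subset[OF y _ i] by auto
qed (use assms in auto)

lemma solution_less_overlap: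
  assumes x: "solution_on g J x" and y: "solution_on g K y"
    and "s \<in> J" "s \<in> K" "t \<in> J" "t \<in> K" "x s < y s"
  shows "x t < y t"
proof (rule solution_less[of "J \<inter> K" x y s])
  have i: "is_interval (J \<inter> K)" using x y solution_on_interval is_interval_Int by blast
  show "solution_on g (J \<inter> K) x" "solution_on g (J \<inter> K) y"
    using solution_on_subset[OF x _ i] solution_on_subset[OF y _ i] by auto
qed (use assms in auto)

lemma past_global_below:
  assumes y: "solution_on g J y" "{..s} \<subseteq> J" and x0: "x0 \<le> y s"
  shows "{..s} \<subseteq> sol_dom g s x0"
proof (rule past_global_if_bounded)
  fix t assume t: "t \<in> sol_dom g s x0" "t \<le> s"
  have "sol g s x0 t \<le> y t"
    using y t x0 in_sol_dom by - (rule solution_le_overlap[OF solution_on_sol y(1), where s = s], auto simp: sol_initial)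
  also have "y t \<le> \<rho>" by (rule past_solution_le[OF y(1)]) (use y(2) t(2) in auto)
  finally show "sol g s x0 t \<le> \<rho>" .
qed

lemma forward_above:
  assumes y: "solution_on g J y" "{s..e} \<subseteq> J" and se: "s \<le> e" and x0: "x0 \<ge> y s"
  shows "{s..e} \<subseteq> sol_dom g s x0"
proof -
  have se': "s \<in> J" "e \<in> J" using y se by auto
  obtain B where B: "\<And>u. u \<in> {s..e} \<Longrightarrow> \<bar>y u\<bar> \<le> B"
    using solution_on_locally_bounded[OF y(1) se'] by blast
  have "\<exists>\<epsilon>>0. {s..e + \<epsilon>} \<subseteq> sol_dom g s x0"
  proof (rule forward_if_bounded[OF maximal_solution_sol in_sol_dom se])
    fix t assume t: "t \<in> sol_dom g s x0" "s \<le> t" "t \<le> e"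
    have "y t \<le> sol g s x0 t"
      using y t x0 in_sol_dom se' by - (rule solution_le_overlap[OF y(1) solution_on_sol, where s = s], auto simp: sol_initial)
    moreover have "- B \<le> y t" using B[of t] t by (simp add: abs_le_iff)
    ultimately show "- B \<le> sol g s x0 t" by linarith
  qed
  then show ?thesis by auto
qed

lemma bounded_in_past_iff:
  "bounded_in_past (sol_dom g s x0) (sol g s x0) \<longleftrightarrow> {..s} \<subseteq> sol_dom g s x0"
proof
  assume "bounded_in_past (sol_dom g s x0) (sol g s x0)"
  then obtain T where T: "{..T} \<subseteq> sol_dom g s x0" unfolding bounded_in_past_def by blast
  show "{..s} \<subseteq> sol_dom g s x0"
  proof
    fix t assume "t \<in> {..s}"
    moreover have "min t T \<in> sol_dom g s x0" using T by auto
    ultimately show "t \<in> sol_dom g s x0"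
      using solution_on_mem[OF solution_on_sol _ in_sol_dom, of "min t T" s x0 t] by auto
  qed
next
  assume s: "{..s} \<subseteq> sol_dom g s x0"
  have "\<bar>sol g s x0 t\<bar> \<le> \<bar>\<rho>\<bar> + \<bar>min x0 (- \<rho>)\<bar>" if t: "t \<le> s" for t
  proof -
    have "sol g s x0 t \<le> \<rho>" by (rule past_solution_le[OF solution_on_sol]) (use s t in auto)
    moreover have "min (sol g s x0 s) (- \<rho>) \<le> sol g s x0 t"
      by (rule solution_backward_lower[OF solution_on_sol _ in_sol_dom t]) (use s t in auto)
    ultimately show ?thesis unfolding sol_initial by (intro abs_le_of_bounds)
  qed
  then have "bounded (sol g s x0 ` {..s})"
    by (intro boundedI[of _ "\<bar>\<rho>\<bar> + \<bar>min x0 (- \<rho>)\<bar>"]) auto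
  with s show "bounded_in_past (sol_dom g s x0) (sol g s x0)" unfolding bounded_in_past_def by blast
qed

text \<open>If the supremum were not attained, its solution would exceed \<open>\<rho> + 1\<close>
  at some earlier \<open>t\<close>. By continuous dependence backward, a solution from
  \<open>P\<close> that starts close enough would be above \<rho> there, or at most reach it within
  distance 1, against the strict excess.\<close>

lemma past_global_Sup:
  assumes ne: "{..s} \<subseteq> sol_dom g s x1"
  defines "P \<equiv> {x0. {..s} \<subseteq> sol_dom g s x0}"
  shows "bdd_above P" and "Sup P \<in> P"
proof -
  have le: "x0 \<le> \<rho>" if "x0 \<in> P" for x0
    using past_solution_le[OF solution_on_sol, of s s x0] that unfolding P_def by (simp add: sol_initial)
  then show bdd: "bdd_above P" by (auto intro!: bdd_aboveI)
  have "P \<noteq> {}" using ne unfolding P_def by blast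
  define a0 where "a0 = Sup P"
  let ?x = "sol g s a0"
  have "a0 \<in> P"
  proof (rule ccontr)
    assume "a0 \<notin> P"
    then obtain t where t: "t \<in> sol_dom g s a0" "t \<le> s" "?x t > \<rho> + 1"
      using past_global_if_bounded[of s a0 "\<rho> + 1"] unfolding P_def by force
    obtain B1 where B1: "\<And>u. u \<in> {t..s} \<Longrightarrow> \<bar>?x u\<bar> \<le> B1"
      using solution_on_locally_bounded[OF solution_on_sol t(1) in_sol_dom] by blast
    \<comment> \<open>Bounds from below every backward solution in \<open>P\<close> that starts
      above \<open>a0 - 1\<close>, so that \<open>B\<close>, \<open>K\<close> and \<epsilon> are
      fixed before \<open>y0\<close> is chosen.\<close>
    define m where "m = min (a0 - 1) (- \<rho>)"
    define B where "B = max B1 (\<bar>\<rho>\<bar> + \<bar>m\<bar>)"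
    obtain K where "AE t in lebesgue. \<forall>u\<in>{- B..B}.
        \<bar>g t u\<bar> \<le> K \<and> (\<forall>v\<in>{- B..B}. \<bar>g t u - g t v\<bar> \<le> K * \<bar>u - v\<bar>)"
      using locally_lipschitz by blast
    then have K: "AE t in lebesgue. \<forall>u\<in>{- B..B}. \<forall>v\<in>{- B..B}. \<bar>g t u - g t v\<bar> \<le> K * \<bar>u - v\<bar>"
      by eventually_elim blast
    \<comment> \<open>After the growth factor of \<open>gronwall_piece\<close> the distance is at
      most 1, the margin between \<open>\<rho> + 1\<close> and \<rho>.\<close>
    define \<epsilon> where "\<epsilon> = min 1 (exp (- (K * (s - t))))"
    have \<epsilon>: "\<epsilon> > 0" "\<epsilon> \<le> 1" "exp (K * (s - t)) * \<epsilon> \<le> 1"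
    proof -
      have "exp (K * (s - t)) * \<epsilon> \<le> exp (K * (s - t)) * exp (- (K * (s - t)))"
        unfolding \<epsilon>_def by (intro mult_left_mono) auto
      then show "exp (K * (s - t)) * \<epsilon> \<le> 1" by (simp flip: exp_add)
    qed (auto simp: \<epsilon>_def)
    obtain y0 where y0: "y0 \<in> P" "a0 - \<epsilon> < y0"
      using less_cSupE[of "a0 - \<epsilon>" P] \<open>P \<noteq> {}\<close> \<epsilon> unfolding a0_def by auto
    have y0a: "y0 \<le> a0" unfolding a0_def using y0 bdd by (intro cSup_upper)
    let ?y = "sol g s y0"
    have ys: "{..s} \<subseteq> sol_dom g s y0" using y0 unfolding P_def by blast
    have yB: "\<bar>?y u\<bar> \<le> B" if "u \<in> {t..s}" for u
    proof -
      have "?y u \<le> \<rho>" by (rule past_solution_le[OF solution_on_sol]) (use ys that in auto)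
      moreover have *: "min (?y s) (- \<rho>) \<le> ?y u"
        by (rule solution_backward_lower[OF solution_on_sol _ in_sol_dom]) (use ys that in auto)
      have "m \<le> min (?y s) (- \<rho>)"
        unfolding sol_initial m_def using y0(2) \<epsilon>(2) by (intro min.mono) linarith+
      then have "m \<le> ?y u" using * by (rule order_trans)
      ultimately have "\<bar>?y u\<bar> \<le> \<bar>\<rho>\<bar> + \<bar>m\<bar>" by (intro abs_le_of_bounds)
      then show ?thesis unfolding B_def by (rule max.coboundedI2)
    qed
    have xB: "\<bar>?x u\<bar> \<le> B" if "u \<in> {t..s}" for u using B1[OF that] unfolding B_def by simp
    have px: "piece g t s ?x"
      by (rule solution_on_piece[OF solution_on_sol])
        (rule interval_subset[OF solution_on_interval[OF solution_on_sol] t(1) in_sol_dom])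
    have py: "piece g t s ?y"
      by (rule solution_on_piece[OF solution_on_sol]) (use ys in auto)
    have "\<bar>?x t - ?y t\<bar> \<le> exp (K * (s - t)) * \<bar>?x s - ?y s\<bar>"
      by (rule gronwall_piece(2)[OF t(2) px py xB yB K])
    also have "\<dots> \<le> exp (K * (s - t)) * \<epsilon>"
      using y0 y0a by (intro mult_left_mono) (auto simp: sol_initial)
    also have "\<dots> \<le> 1" by fact
    finally have "?x t - ?y t \<le> 1" by simp
    moreover have "?y t \<le> \<rho>" by (rule past_solution_le[OF solution_on_sol]) (use ys t in auto)
    ultimately show False using t(3) by linarith
  qed
  then show "Sup P \<in> P" unfolding a0_def .
qed

lemma solution_stays_low:
  assumes x: "solution_on g J x" and st: "s \<in> J" "t \<in> J" "s \<le> t" and low: "x s < - \<rho>"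
  shows "x t \<le> x s"
  using solution_backward_lower[OF x st] low by linarith

text \<open>The solution through the largest initial value at \<open>s0\<close> whose past is
  global. Comparison carries the extremal property from \<open>s0\<close> to every other time of its
  domain.\<close>

lemma upper_past_solution_exists:
  assumes ne: "{..s0} \<subseteq> sol_dom g s0 x1"
  shows "\<exists>A a. upper_past_solution g A a"
proof -
  define P where "P = {x0. {..s0} \<subseteq> sol_dom g s0 x0}"
  define a0 where "a0 = Sup P"
  have bdd: "bdd_above P" and a0: "{..s0} \<subseteq> sol_dom g s0 a0"
    using past_global_Sup[OF ne] unfolding a0_def P_def by auto
  define J where "J = sol_dom g s0 a0"
  define a where "a = sol g s0 a0"
  have m: "maximal_solution g J a" unfolding J_def a_def by (rule maximal_solution_sol)
  have sJ: "solution_on g J a" using maximal_solutionD[OF m] .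
  have s0: "s0 \<in> J" "{..s0} \<subseteq> J" using a0 unfolding J_def by auto
  have mem: "t \<in> J" if "s \<in> J" "t \<le> s" for s t
  proof (cases "t \<le> s0")
    case True
    then show ?thesis using s0 by auto
  next
    case False
    then show ?thesis using solution_on_mem[OF sJ s0(1) that(1), of t] that(2) by simp
  qed
  have shape: "J = UNIV \<or> (\<exists>\<beta>. J = {..<\<beta>})"
  proof (cases "bdd_above J")
    case True
    have up: "t \<le> Sup J" if "t \<in> J" for t using that True by (rule cSup_upper)
    \<comment> \<open>The domain has no last point: up to such a point the solution would be
      bounded, so it could be continued.\<close>
    have notin: "Sup J \<notin> J"
    proof
      assume b: "Sup J \<in> J"
      have s0b: "s0 \<le> Sup J" using up[OF s0(1)] .
      obtain B where B: "\<And>u. u \<in> {s0..Sup J} \<Longrightarrow> \<bar>a u\<bar> \<le> B"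
        using solution_on_locally_bounded[OF sJ s0(1) b] by blast
      have "\<exists>\<epsilon>>0. {s0..Sup J + \<epsilon>} \<subseteq> J"
        by (rule maximal_solution_forward[OF m s0(1) s0b, of B], rule B) simp
      then obtain \<epsilon> where \<epsilon>: "\<epsilon> > 0" "{s0..Sup J + \<epsilon>} \<subseteq> J" by blast
      have "Sup J + \<epsilon> \<in> {s0..Sup J + \<epsilon>}" using \<epsilon>(1) s0b by simp
      then have "Sup J + \<epsilon> \<le> Sup J" using \<epsilon>(2) up by blast
      then show False using \<epsilon>(1) by simp
    qed
    have "t \<in> J \<longleftrightarrow> t < Sup J" for t
    proof
      assume t: "t \<in> J"
      then have "t \<noteq> Sup J" using notin by metis
      then show "t < Sup J" using up[OF t] by linarith
    next
      assume lt: "t < Sup J"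
      have "J \<noteq> {}" using s0(1) by blast
      then obtain s where "s \<in> J" "t < s" using less_cSupE[OF lt] by metis
      then show "t \<in> J" by (rule mem[OF _ less_imp_le])
    qed
    then have "J = {..<Sup J}" unfolding lessThan_def by blast
    then show ?thesis by blast
  next
    case False
    have "t \<in> J" for t
    proof -
      have "\<exists>s\<in>J. \<not> s \<le> t" using False unfolding bdd_above_def by blast
      then obtain s where "s \<in> J" "t < s" by (meson not_le)
      then show ?thesis by (rule mem[OF _ less_imp_le])
    qed
    then show ?thesis by blast
  qed
  have char: "bounded_in_past (sol_dom g s x0) (sol g s x0) \<longleftrightarrow> x0 \<le> a s" if s: "s \<in> J" for s x0
    unfolding bounded_in_past_iff
  proof
    assume "x0 \<le> a s"
    then show "{..s} \<subseteq> sol_dom g s x0" using mem s by (intro past_global_below[OF sJ]) auto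
  next
    assume g: "{..s} \<subseteq> sol_dom g s x0"
    let ?y = "sol g s x0"
    show "x0 \<le> a s"
    proof (rule ccontr)
      assume n: "\<not> x0 \<le> a s"
      \<comment> \<open>To the right of \<open>s\<close> the solution lies above \<open>a\<close>,
        so it lives at least as long as \<open>a\<close> does.\<close>
      have s0y: "{..s0} \<subseteq> sol_dom g s x0"
      proof (cases "s0 \<le> s")
        case True
        then show ?thesis using g by auto
      next
        case False
        then have "{s..s0} \<subseteq> sol_dom g s x0"
          using n mem s0 by (intro forward_above[OF sJ]) auto
        moreover have "{..s0} \<subseteq> {..s} \<union> {s..s0}" by auto
        ultimately show ?thesis using g by blast
      qed
      have "a s0 < ?y s0"
        by (rule solution_less_overlap[OF sJ solution_on_sol s in_sol_dom s0(1)]) (use s0y n in \<open>auto simp: sol_initial\<close>)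
      moreover have "{..s0} \<subseteq> sol_dom g s0 (?y s0)"
        using sol_extends(1)[OF solution_on_sol, of s0 s x0] s0y by auto
      then have "?y s0 \<le> a0" unfolding a0_def using bdd by (intro cSup_upper) (auto simp: P_def)
      ultimately show False unfolding a_def by (simp add: sol_initial)
    qed
  qed
  have lim: "filterlim a at_bot (at_left \<beta>)" if J\<beta>: "J = {..<\<beta>}" for \<beta>
    unfolding filterlim_at_bot
  proof
    fix C :: real
    \<comment> \<open>Below -\<rho> a solution can no longer rise, so one value under
      \<open>C'\<close> keeps all later values under \<open>C\<close>. Such a value exists, since a
      lower bound would allow continuation past \<beta>.\<close>
    define C' where "C' = min C (- \<rho> - 1)"
    have s0b: "s0 \<le> \<beta>" using s0 J\<beta> by auto
    obtain t where t: "t \<in> J" "a t < C'"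
    proof (rule ccontr)
      note found = that
      assume no: "\<not> thesis"
      have *: "C' \<le> a t" if "t \<in> J" for t
      proof (rule ccontr)
        assume "\<not> C' \<le> a t"
        then have "a t < C'" by simp
        then show False using no found[OF \<open>t \<in> J\<close>] by blast
      qed
      have "\<exists>\<epsilon>>0. {s0..\<beta> + \<epsilon>} \<subseteq> J"
        by (rule forward_if_bounded[OF m s0(1) s0b, of C']) (rule *)
      then obtain \<epsilon> where \<epsilon>: "\<epsilon> > 0" "{s0..\<beta> + \<epsilon>} \<subseteq> J" by blast
      have "\<beta> \<in> {s0..\<beta> + \<epsilon>}" using \<epsilon>(1) s0b by simp
      then have "\<beta> \<in> J" using \<epsilon>(2) by blast
      then show False using J\<beta> by simp
    qed
    have "a u \<le> C" if "u \<in> {t<..<\<beta>}" for u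
    proof -
      have "a u \<le> a t" by (rule solution_stays_low[OF sJ t(1)]) (use that t J\<beta> in \<open>auto simp: C'_def\<close>)
      then show ?thesis using t(2) unfolding C'_def by simp
    qed
    then show "eventually (\<lambda>u. a u \<le> C) (at_left \<beta>)"
      using t J\<beta> eventually_at_left[of t \<beta>] by auto
  qed
  have "upper_past_solution g J a"
    unfolding upper_past_solution_def by (intro conjI shape m ballI allI char impI lim)
  then show ?thesis by blast
qed

lemma upper_past_solutionD:
  assumes "upper_past_solution g A a"
  shows "maximal_solution g A a" and "solution_on g A a"
    and "\<And>s t. s \<in> A \<Longrightarrow> t \<le> s \<Longrightarrow> t \<in> A"
    and "\<And>s x0. s \<in> A \<Longrightarrow> x0 \<le> a s \<Longrightarrow> {..s} \<subseteq> sol_dom g s x0"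
    and "\<And>s x0. s \<in> A \<Longrightarrow> {..s} \<subseteq> sol_dom g s x0 \<Longrightarrow> x0 \<le> a s"
    and "A \<noteq> {}"
proof -
  have A: "A = UNIV \<or> (\<exists>\<beta>. A = {..<\<beta>})"
    and m: "maximal_solution g A a"
    and b: "\<forall>s\<in>A. \<forall>x0. {..s} \<subseteq> sol_dom g s x0 \<longleftrightarrow> x0 \<le> a s"
    using assms[unfolded upper_past_solution_def bounded_in_past_iff] by simp_all
  show "maximal_solution g A a" "solution_on g A a" using m maximal_solutionD by auto
  show "t \<in> A" if "s \<in> A" "t \<le> s" for s t using A that by auto
  show "{..s} \<subseteq> sol_dom g s x0" if "s \<in> A" "x0 \<le> a s" for s x0 using b that by blast
  show "x0 \<le> a s" if "s \<in> A" "{..s} \<subseteq> sol_dom g s x0" for s x0 using b that by blast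
  show "A \<noteq> {}" using A lessThan_non_empty by blast
qed

text \<open>Domination at common times is the extremal property. It also forces the domain of
  \<open>a\<close> to reach as far: if it ended at some \<open>\<beta> \<le> s\<close>, then
  \<open>a\<close> would tend to -\<infinity> there while staying above the bounded
  \<open>x\<close>.\<close>

lemma past_solution_le_upper:
  assumes up: "upper_past_solution g A a" and x: "solution_on g J x" "{..s} \<subseteq> J"
  shows "s \<in> A" and "x s \<le> a s"
proof -
  have le: "x t \<le> a t" if t: "t \<in> A" "t \<le> s" for t
  proof (rule upper_past_solutionD(5)[OF up t(1)])
    have "solution_on g {..t} x" by (rule solution_on_subset[OF x(1)]) (use x t in \<open>auto simp: is_interval_1\<close>)
    from sol_extends(1)[OF this] show "{..t} \<subseteq> sol_dom g t (x t)" by simp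
  qed
  show s: "s \<in> A"
  proof (rule ccontr)
    assume n: "s \<notin> A"
    then have "A \<noteq> UNIV" by auto
    moreover have "A = UNIV \<or> (\<exists>\<beta>. A = {..<\<beta>})" using up unfolding upper_past_solution_def by blast
    ultimately obtain \<beta> where "A = {..<\<beta>}" by auto
    with n have \<beta>: "A = {..<\<beta>}" "\<beta> \<le> s" by auto
    have lim: "filterlim a at_bot (at_left \<beta>)" using up \<beta> unfolding upper_past_solution_def by blast
    obtain B where B: "\<And>u. u \<in> {\<beta> - 1..s} \<Longrightarrow> \<bar>x u\<bar> \<le> B"
    proof -
      have "\<beta> - 1 \<in> J" "s \<in> J" using x(2) \<beta> by auto
      then show ?thesis using solution_on_locally_bounded[OF x(1)] that by blast
    qed
    have "eventually (\<lambda>u. a u \<le> - B - 1) (at_left \<beta>)" using lim unfolding filterlim_at_bot by blast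
    moreover have "eventually (\<lambda>u. u \<in> {\<beta> - 1<..<\<beta>}) (at_left \<beta>)"
      by (rule eventually_at_leftI[of "\<beta> - 1"]) auto
    ultimately have "eventually (\<lambda>u. a u \<le> - B - 1 \<and> u \<in> {\<beta> - 1<..<\<beta>}) (at_left \<beta>)"
      by (rule eventually_conj)
    then obtain u where u: "a u \<le> - B - 1" "u \<in> {\<beta> - 1<..<\<beta>}"
      using eventually_happens'[OF trivial_limit_at_left_real] by blast
    have "x u \<le> a u" using le[of u] u \<beta> by auto
    then show False using B[of u] u \<beta> by (auto simp: abs_le_iff)
  qed
  show "x s \<le> a s" using le s by blast
qed

lemma upper_past_solution_UNIV:
  assumes up: "upper_past_solution g A a" and x: "solution_on g UNIV x"
  shows "A = UNIV" and "\<And>t. x t \<le> a t"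
  using past_solution_le_upper[OF up x] by auto

end

section \<open>Strongly concave functions\<close>

locale strongly_concave_fun =
  fixes \<phi> \<phi>' :: "real \<Rightarrow> real" and B \<delta> :: real
  assumes deriv: "\<And>x. (\<phi> has_real_derivative \<phi>' x) (at x)"
    and slope: "\<And>u v. u \<in> {- B..B} \<Longrightarrow> v \<in> {- B..B} \<Longrightarrow> u \<le> v \<Longrightarrow> \<phi>' v - \<phi>' u \<le> - \<delta> * (v - u)"
    and \<delta>: "\<delta> > 0"
begin

text \<open>Strong concavity means that \<open>\<phi>\<close> stays concave after adding
  \<open>\<delta> / 2 * x\<^sup>2\<close>; stated with the opposite sign it is a convexity that
  Jensen's inequality can use.\<close>

lemma convex_part: "convex_on {- B..B} (\<lambda>x. - \<phi> x - \<delta> / 2 * x\<^sup>2)"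
proof (rule convex_on_realI)
  fix x show "((\<lambda>x. - \<phi> x - \<delta> / 2 * x\<^sup>2) has_real_derivative - \<phi>' x - \<delta> * x) (at x)"
    by (rule derivative_eq_intros refl deriv)+ (simp add: power2_eq_square)
next
  fix x y assume "x \<in> {- B..B}" "y \<in> {- B..B}" "x \<le> y"
  from slope[OF this] show "- \<phi>' x - \<delta> * x \<le> - \<phi>' y - \<delta> * y" by (simp add: algebra_simps)
qed auto

text \<open>Jensen's inequality for the convex part; the gain is the chord defect of the square,
  which is exactly \<open>l * (1 - l) * (a - r)\<^sup>2\<close>.\<close>

lemma chord_inside:
  assumes r: "r \<in> {- B..B}" and a: "a \<in> {- B..B}" and l: "0 \<le> l" "l \<le> 1"
  shows "\<phi> (r + l * (a - r)) - \<phi> r - l * (\<phi> a - \<phi> r) \<ge> \<delta> / 2 * (l * (1 - l) * (a - r)\<^sup>2)"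
proof -
  have "- \<phi> ((1 - l) *\<^sub>R r + l *\<^sub>R a) - \<delta> / 2 * ((1 - l) *\<^sub>R r + l *\<^sub>R a)\<^sup>2 \<le>
      (1 - l) * (- \<phi> r - \<delta> / 2 * r\<^sup>2) + l * (- \<phi> a - \<delta> / 2 * a\<^sup>2)"
    by (rule convex_onD[OF convex_part]) (use assms in auto)
  moreover have "(1 - l) *\<^sub>R r + l *\<^sub>R a = r + l * (a - r)" by (simp add: algebra_simps)
  moreover have "(1 - l) * (- \<phi> r - \<delta> / 2 * r\<^sup>2) + l * (- \<phi> a - \<delta> / 2 * a\<^sup>2) =
      - \<phi> r - l * (\<phi> a - \<phi> r) - ((1 - l) * (\<delta> / 2 * r\<^sup>2) + l * (\<delta> / 2 * a\<^sup>2))"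
    by (simp add: algebra_simps)
  moreover have "(1 - l) * (\<delta> / 2 * r\<^sup>2) + l * (\<delta> / 2 * a\<^sup>2) - \<delta> / 2 * (r + l * (a - r))\<^sup>2 =
      \<delta> / 2 * (l * (1 - l) * (a - r)\<^sup>2)"
    by (simp add: power2_eq_square field_simps)
  ultimately show ?thesis by simp
qed

text \<open>Here \<open>a\<close> lies between \<open>r\<close> and the new point, with weight
  \<open>1 / l\<close>. The inside estimate for that segment, multiplied by \<open>l\<close>, is the
  claim with both sides negated.\<close>

lemma chord_beyond:
  assumes r: "r \<in> {- B..B}" and y: "r + l * (a - r) \<in> {- B..B}" and l: "1 \<le> l"
  shows "\<phi> (r + l * (a - r)) - \<phi> r - l * (\<phi> a - \<phi> r) \<le> \<delta> / 2 * (l * (1 - l) * (a - r)\<^sup>2)"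
proof -
  define y where "y = r + l * (a - r)"
  have a: "r + (1 / l) * (y - r) = a" unfolding y_def using l by simp
  have "\<phi> a - \<phi> r - (1 / l) * (\<phi> y - \<phi> r) \<ge> \<delta> / 2 * ((1 / l) * (1 - 1 / l) * (y - r)\<^sup>2)"
    using chord_inside[of r y "1 / l"] r y l unfolding a y_def[symmetric] by simp
  then have "l * (\<phi> a - \<phi> r - (1 / l) * (\<phi> y - \<phi> r)) \<ge> l * (\<delta> / 2 * ((1 / l) * (1 - 1 / l) * (y - r)\<^sup>2))"
    using l by (intro mult_left_mono) auto
  moreover have "l * (\<phi> a - \<phi> r - (1 / l) * (\<phi> y - \<phi> r)) = l * (\<phi> a - \<phi> r) - (\<phi> y - \<phi> r)"
    using l by (simp add: algebra_simps)
  moreover have "l * (\<delta> / 2 * ((1 / l) * (1 - 1 / l) * (y - r)\<^sup>2)) = - (\<delta> / 2 * (l * (1 - l) * (a - r)\<^sup>2))"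
    using l unfolding y_def by (simp add: power2_eq_square field_simps)
  ultimately show ?thesis unfolding y_def by linarith
qed

text \<open>The case \<open>l \<le> 0\<close> is \<open>chord_beyond\<close> with \<open>r\<close>
  and \<open>a\<close> exchanged and \<open>1 - l\<close> for \<open>l\<close>.\<close>

lemma chord_outside:
  assumes r: "r \<in> {- B..B}" and a: "a \<in> {- B..B}" and y: "r + l * (a - r) \<in> {- B..B}" and l: "l \<le> 0 \<or> 1 \<le> l"
  shows "\<phi> (r + l * (a - r)) - \<phi> r - l * (\<phi> a - \<phi> r) \<le> \<delta> / 2 * (l * (1 - l) * (a - r)\<^sup>2)"
proof (cases "1 \<le> l")
  case True
  then show ?thesis using chord_beyond[OF r y] by blast
next
  case False
  then have l: "1 \<le> 1 - l" using l by simp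
  have eq: "a + (1 - l) * (r - a) = r + l * (a - r)" by (simp add: algebra_simps)
  have "\<phi> (r + l * (a - r)) - \<phi> a - (1 - l) * (\<phi> r - \<phi> a) \<le> \<delta> / 2 * ((1 - l) * (1 - (1 - l)) * (r - a)\<^sup>2)"
    using chord_beyond[of a "1 - l" r, unfolded eq, OF a y l] .
  moreover have "(1 - l) * (1 - (1 - l)) * (r - a)\<^sup>2 = l * (1 - l) * (a - r)\<^sup>2"
    by (simp add: power2_eq_square algebra_simps)
  moreover have "\<phi> (r + l * (a - r)) - \<phi> a - (1 - l) * (\<phi> r - \<phi> a) =
      \<phi> (r + l * (a - r)) - \<phi> r - l * (\<phi> a - \<phi> r)"
    by (simp add: left_diff_distrib right_diff_distrib)
  ultimately show ?thesis by (simp only:)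
qed

text \<open>After adding \<open>\<delta> / 2 * (x - a)\<^sup>2\<close> the derivative is still
  nonincreasing on the ball and unchanged at \<open>a\<close>, so its value at \<open>a\<close> is
  at most the slope of the chord.\<close>

lemma derivative_le_chord_slope:
  assumes r: "r \<in> {- B..B}" and a: "a \<in> {- B..B}" and ra: "r < a"
  shows "\<phi>' a \<le> (\<phi> a - \<phi> r) / (a - r) - \<delta> / 2 * (a - r)"
proof -
  define \<psi> where "\<psi> x = \<phi> x + \<delta> / 2 * (x - a)\<^sup>2" for x
  have d: "(\<psi> has_real_derivative \<phi>' x + \<delta> * (x - a)) (at x)" for x
    unfolding \<psi>_def by (rule derivative_eq_intros refl deriv)+ (simp add: power2_eq_square)
  obtain z where z: "r < z" "z < a" "\<psi> a - \<psi> r = (a - r) * (\<phi>' z + \<delta> * (z - a))"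
    using MVT2[OF ra, of \<psi> "\<lambda>x. \<phi>' x + \<delta> * (x - a)"] d by blast
  have "\<phi>' a - \<phi>' z \<le> - \<delta> * (a - z)" using slope[of z a] z r a by auto
  then have "\<phi>' a \<le> \<phi>' z + \<delta> * (z - a)" by (simp add: algebra_simps)
  also have "\<dots> = (\<psi> a - \<psi> r) / (a - r)" using z(3) ra by (simp add: field_simps)
  also have "\<dots> = (\<phi> a - \<phi> r) / (a - r) - \<delta> / 2 * (a - r)"
    using ra unfolding \<psi>_def by (simp add: power2_eq_square field_simps)
  finally show ?thesis .
qed

text \<open>A mean slope near \<open>a\<close> is close to \<open>\<phi>' a\<close>, which lies
  below the chord slope by \<open>\<delta> / 2 * (a - r)\<close>. Only a lower bound on
  \<open>u\<close> is asked for, since beyond \<open>a\<close> concavity lowers the derivative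
  further.\<close>

lemma contraction_near:
  assumes r: "r \<in> {- B..B}" and a: "a \<in> {- B..B}" and ra: "r < a"
    and u: "u \<in> {- B..B}" and v: "v \<in> {- B..B}" and uv: "u \<le> v" and ua: "u \<ge> a - e" "e \<ge> 0"
    and lip: "\<And>x. x \<in> {- B..B} \<Longrightarrow> \<bar>\<phi>' x - \<phi>' a\<bar> \<le> K * \<bar>x - a\<bar>" and K: "K \<ge> 0"
  shows "\<phi> v - \<phi> u - (v - u) * ((\<phi> a - \<phi> r) / (a - r)) \<le> (K * e - \<delta> / 2 * (a - r)) * (v - u)"
proof (cases "u = v")
  case False
  then have "u < v" using uv by simp
  then obtain z where z: "u < z" "z < v" "\<phi> v - \<phi> u = (v - u) * \<phi>' z"
    using MVT2[of u v \<phi> \<phi>'] deriv by blast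
  have zB: "z \<in> {- B..B}" using z u v by auto
  have "\<phi>' z \<le> \<phi>' a + K * e"
  proof (cases "a \<le> z")
    case True
    have "\<phi>' z - \<phi>' a \<le> - \<delta> * (z - a)" using slope[OF a zB True] .
    also have "\<dots> \<le> 0" using \<delta> True by (simp add: mult_nonneg_nonneg)
    finally have "\<phi>' z - \<phi>' a \<le> 0" .
    moreover have "K * e \<ge> 0" using K ua by simp
    ultimately show ?thesis by linarith
  next
    case False
    have "\<phi>' z - \<phi>' a \<le> K * \<bar>z - a\<bar>" using lip[OF zB] by linarith
    also have "\<dots> \<le> K * e" using K False z ua by (intro mult_left_mono) auto
    finally show ?thesis by linarith
  qed
  then have "\<phi>' z \<le> (\<phi> a - \<phi> r) / (a - r) + (K * e - \<delta> / 2 * (a - r))"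
    using derivative_le_chord_slope[OF r a ra] by linarith
  then have "(v - u) * \<phi>' z \<le> (v - u) * ((\<phi> a - \<phi> r) / (a - r) + (K * e - \<delta> / 2 * (a - r)))"
    using uv by (intro mult_left_mono) auto
  then show ?thesis unfolding z(3) by (simp add: algebra_simps)
qed simp

end

section \<open>The perturbed equation in the past\<close>

text \<open>Collects (f2), (f3), (f5) and (f7) at one time, on a ball of any real radius and with a
  single \<open>K\<close>, so that one almost-everywhere statement carries all local bounds.\<close>

definition regular_on :: "(real \<Rightarrow> real) \<Rightarrow> (real \<Rightarrow> real) \<Rightarrow> real \<Rightarrow> real \<Rightarrow> real \<Rightarrow> bool" where
  "regular_on \<phi> \<phi>' B K \<delta> \<longleftrightarrow> (\<forall>u\<in>{- B..B}. \<bar>\<phi> u\<bar> \<le> K \<and> \<bar>\<phi>' u\<bar> \<le> K \<and>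
     (\<forall>v\<in>{- B..B}. \<bar>\<phi> u - \<phi> v\<bar> \<le> K * \<bar>u - v\<bar> \<and> \<bar>\<phi>' u - \<phi>' v\<bar> \<le> K * \<bar>u - v\<bar> \<and>
        (u \<le> v \<longrightarrow> \<phi>' v - \<phi>' u \<le> - \<delta> * (v - u))))"

text \<open>The derivative is a parameter \<open>fx\<close> and not \<open>partial_x f\<close>, so
  that the reversed equation can be given its derivative explicitly, even at times where
  differentiability fails.\<close>

locale concave_equation =
  fixes f fx :: "real \<Rightarrow> real \<Rightarrow> real" and \<rho>0 \<kappa>0 :: real
  assumes f_measurable:
      "\<And>x. x \<in> borel_measurable lebesgue \<Longrightarrow> (\<lambda>t. f t (x t)) \<in> borel_measurable lebesgue"
    and f_derivative: "AE t in lebesgue. \<forall>x. (f t has_real_derivative fx t x) (at x)"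
    and f_regular: "\<And>B. \<exists>K\<ge>0. \<exists>\<delta>>0. AE t in lebesgue. regular_on (f t) (fx t) B K \<delta>"
    and f_dissipation: "AE t in lebesgue. \<forall>x. \<bar>x\<bar> \<ge> \<rho>0 \<longrightarrow> f t x \<le> - \<kappa>0 * x\<^sup>2"
    and \<rho>0: "\<rho>0 > 0" and \<kappa>0: "\<kappa>0 > 0"
begin

lemma dissipative_f: "dissipative f \<rho>0 \<kappa>0"
proof
  fix B
  obtain K \<delta> where K: "K \<ge> 0" "\<delta> > 0" and ae: "AE t in lebesgue. regular_on (f t) (fx t) B K \<delta>"
    using f_regular[of B] by blast
  note ae = ae[unfolded regular_on_def]
  have "AE t in lebesgue. \<forall>u\<in>{- B..B}. \<bar>f t u\<bar> \<le> K \<and> (\<forall>v\<in>{- B..B}. \<bar>f t u - f t v\<bar> \<le> K * \<bar>u - v\<bar>)"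
    using ae by eventually_elim blast
  then show "\<exists>K\<ge>0. AE t in lebesgue. \<forall>u\<in>{- B..B}. \<bar>f t u\<bar> \<le> K \<and> (\<forall>v\<in>{- B..B}. \<bar>f t u - f t v\<bar> \<le> K * \<bar>u - v\<bar>)"
    using K by blast
qed (fact f_measurable f_dissipation \<rho>0 \<kappa>0)+

end

sublocale concave_equation \<subseteq> F: dissipative f \<rho>0 \<kappa>0
  by (rule dissipative_f)

text \<open>A limit of \<Delta> is assumed in the past only; the reversed equation, with the future
  limit, is then an instance of the same locale.\<close>

locale past_perturbation = concave_equation f fx \<rho>0 \<kappa>0
  for f fx :: "real \<Rightarrow> real \<Rightarrow> real" and \<rho>0 \<kappa>0 :: real +
  fixes \<Delta> a r :: "real \<Rightarrow> real" and \<delta>m M d0 R :: real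
  assumes \<Delta>_measurable: "\<Delta> \<in> borel_measurable lebesgue"
    and \<Delta>_bounded: "AE t in lebesgue. \<bar>\<Delta> t\<bar> \<le> M" and M: "M \<ge> 0"
    and \<Delta>_limit: "(\<Delta> \<longlongrightarrow> \<delta>m) at_bot"
    and a_solution: "solution_on f UNIV a" and r_solution: "solution_on f UNIV r"
    and a_bounded: "\<And>t. \<bar>a t\<bar> \<le> R" and r_bounded: "\<And>t. \<bar>r t\<bar> \<le> R"
    and d0: "d0 > 0" and separated: "\<And>t. a t - r t \<ge> d0"
begin

abbreviation g :: "real \<Rightarrow> real \<Rightarrow> real" where "g \<equiv> shifted f \<Delta>"

end

sublocale past_perturbation \<subseteq> dissipative "shifted f \<Delta>" "\<rho>0 + 2 * M" "\<kappa>0 / 4"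
proof
  fix x :: "real \<Rightarrow> real" assume "x \<in> borel_measurable lebesgue"
  then have "(\<lambda>t. x t - \<Delta> t) \<in> borel_measurable lebesgue" using \<Delta>_measurable by (intro borel_measurable_diff)
  from f_measurable[OF this] show "(\<lambda>t. shifted f \<Delta> t (x t)) \<in> borel_measurable lebesgue"
    unfolding shifted_def .
next
  fix B
  obtain K where K: "K \<ge> 0" "AE t in lebesgue. \<forall>u\<in>{- (B + M)..B + M}.
      \<bar>f t u\<bar> \<le> K \<and> (\<forall>v\<in>{- (B + M)..B + M}. \<bar>f t u - f t v\<bar> \<le> K * \<bar>u - v\<bar>)"
    using F.locally_lipschitz by blast
  have "AE t in lebesgue. \<forall>u\<in>{- B..B}. \<bar>shifted f \<Delta> t u\<bar> \<le> K \<and>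
      (\<forall>v\<in>{- B..B}. \<bar>shifted f \<Delta> t u - shifted f \<Delta> t v\<bar> \<le> K * \<bar>u - v\<bar>)"
    using K(2) \<Delta>_bounded
  proof eventually_elim
    case (elim t)
    have m: "u - \<Delta> t \<in> {- (B + M)..B + M}" if "u \<in> {- B..B}" for u using that elim(2) by auto
    show ?case
    proof (intro ballI conjI)
      fix u assume u: "u \<in> {- B..B}"
      show "\<bar>shifted f \<Delta> t u\<bar> \<le> K" unfolding shifted_def using elim(1) m[OF u] by blast
      fix v assume v: "v \<in> {- B..B}"
      have "\<bar>f t (u - \<Delta> t) - f t (v - \<Delta> t)\<bar> \<le> K * \<bar>(u - \<Delta> t) - (v - \<Delta> t)\<bar>"
        using elim(1) m[OF u] m[OF v] by blast
      then show "\<bar>shifted f \<Delta> t u - shifted f \<Delta> t v\<bar> \<le> K * \<bar>u - v\<bar>" unfolding shifted_def by simp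
    qed
  qed
  then show "\<exists>K\<ge>0. AE t in lebesgue. \<forall>u\<in>{- B..B}. \<bar>shifted f \<Delta> t u\<bar> \<le> K \<and>
      (\<forall>v\<in>{- B..B}. \<bar>shifted f \<Delta> t u - shifted f \<Delta> t v\<bar> \<le> K * \<bar>u - v\<bar>)"
    using K(1) by blast
next
  \<comment> \<open>If \<open>\<bar>x\<bar> \<ge> \<rho>0 + 2 * M\<close> and
    \<open>\<bar>\<Delta> t\<bar> \<le> M\<close>, then \<open>x - \<Delta> t\<close> has modulus at
    least \<rho>0 and at least half of \<open>\<bar>x\<bar>\<close>; squaring the half gives the
    factor 1/4.\<close>
  show "\<rho>0 + 2 * M > 0" "\<kappa>0 / 4 > 0" using \<rho>0 \<kappa>0 M by auto
  show "AE t in lebesgue. \<forall>x. \<bar>x\<bar> \<ge> \<rho>0 + 2 * M \<longrightarrow> shifted f \<Delta> t x \<le> - (\<kappa>0 / 4) * x\<^sup>2"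
    using f_dissipation \<Delta>_bounded
  proof eventually_elim
    case (elim t)
    show ?case
    proof (intro allI impI)
      fix x :: real assume x: "\<bar>x\<bar> \<ge> \<rho>0 + 2 * M"
      have "\<bar>x\<bar> - \<bar>\<Delta> t\<bar> \<le> \<bar>x - \<Delta> t\<bar>" by (rule abs_triangle_ineq2)
      moreover have "\<bar>x / 2\<bar> = \<bar>x\<bar> / 2" by simp
      ultimately have 1: "\<bar>x - \<Delta> t\<bar> \<ge> \<rho>0" "\<bar>x / 2\<bar> \<le> \<bar>x - \<Delta> t\<bar>" using x elim(2) \<rho>0 M by linarith+
      have "(x / 2)\<^sup>2 \<le> (x - \<Delta> t)\<^sup>2" using 1(2) abs_le_square_iff[of "x / 2" "x - \<Delta> t"] by blast
      then have "\<kappa>0 * (x / 2)\<^sup>2 \<le> \<kappa>0 * (x - \<Delta> t)\<^sup>2" using \<kappa>0 by (intro mult_left_mono) auto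
      moreover have "f t (x - \<Delta> t) \<le> - \<kappa>0 * (x - \<Delta> t)\<^sup>2" using elim(1) 1(1) by blast
      ultimately show "shifted f \<Delta> t x \<le> - (\<kappa>0 / 4) * x\<^sup>2"
        unfolding shifted_def by (simp add: power2_eq_square)
    qed
  qed
qed


text \<open>The chord gain is quadratic in the gap \<open>d\<close>, and dividing by
  \<open>d\<close> leaves one factor, bounded below by \<open>d0\<close>.\<close>

lemma divide_lower_bound:
  fixes Q d d0 m \<delta> :: real
  assumes Q: "\<delta> / 2 * (m * d\<^sup>2) \<le> Q" and m: "0 \<le> m" and d: "0 < d0" "d0 \<le> d" and \<delta>: "0 < \<delta>"
  shows "\<delta> * d0 / 2 * m \<le> Q / d"
proof -
  have "(\<delta> / 2 * (m * d)) * d0 \<le> (\<delta> / 2 * (m * d)) * d" using m d \<delta> by (intro mult_left_mono) auto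
  also have "\<dots> \<le> Q" using Q by (simp add: power2_eq_square mult.assoc)
  finally have "(\<delta> * d0 / 2 * m) * d \<le> Q" by (simp add: mult_ac)
  then show ?thesis using d by (subst pos_le_divide_eq) auto
qed

lemma divide_upper_bound:
  fixes Q d d0 m \<delta> :: real
  assumes Q: "Q \<le> \<delta> / 2 * (m * d\<^sup>2)" and m: "m \<le> 0" and d: "0 < d0" "d0 \<le> d" and \<delta>: "0 < \<delta>"
  shows "Q / d \<le> \<delta> * d0 / 2 * m"
  using divide_lower_bound[of \<delta> "- m" d "- Q" d0] assms by simp

context past_perturbation
begin

text \<open>\<open>lam x t\<close> is the coordinate of \<open>x t - \<delta>m\<close> in which \<open>r t\<close> is \<open>0\<close> and \<open>a t\<close> is \<open>1\<close>; it almost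
  satisfies a logistic inequality.\<close>

definition lam :: "(real \<Rightarrow> real) \<Rightarrow> real \<Rightarrow> real" where
  "lam x t = (x t - \<delta>m - r t) / (a t - r t)"

lemma gap_pos: "a t - r t > 0" and gap_le: "a t - r t \<le> 2 * R" and R_pos: "R > 0"
  using separated[of t] d0 a_bounded[of t] r_bounded[of t] by linarith+

lemma lam_eq: "x t - \<delta>m = r t + lam x t * (a t - r t)"
  using gap_pos[of t] unfolding lam_def by (simp add: field_simps)

lemma lam_bound: "\<bar>lam x t\<bar> \<le> (\<bar>x t\<bar> + \<bar>\<delta>m\<bar> + R) / d0"
proof -
  have "\<bar>lam x t\<bar> = \<bar>x t - \<delta>m - r t\<bar> / (a t - r t)" using gap_pos[of t] unfolding lam_def by simp
  also have "\<dots> \<le> (\<bar>x t\<bar> + \<bar>\<delta>m\<bar> + R) / d0"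
    using separated[of t] d0 r_bounded[of t] by (intro frac_le) linarith+
  finally show ?thesis .
qed

lemma lam_abs_bound: "\<bar>lam x t\<bar> \<le> \<Lambda> \<Longrightarrow> \<bar>x t - \<delta>m\<bar> \<le> R + \<Lambda> * (2 * R)"
proof -
  assume l: "\<bar>lam x t\<bar> \<le> \<Lambda>"
  have "\<bar>x t - \<delta>m\<bar> \<le> \<bar>r t\<bar> + \<bar>lam x t\<bar> * \<bar>a t - r t\<bar>"
    unfolding lam_eq abs_mult[symmetric] by (rule abs_triangle_ineq)
  also have "\<dots> \<le> R + \<Lambda> * (2 * R)"
    using l gap_pos[of t] gap_le[of t] r_bounded[of t] by (intro add_mono mult_mono) auto
  finally show ?thesis .
qed

lemma lam_less_iff: "lam x t < lam y t \<longleftrightarrow> x t < y t"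
  using gap_pos[of t] unfolding lam_def by (simp add: divide_less_cancel)

lemma lip_on_lam:
  assumes "piece g s u x"
  shows "lip_on s u (lam x)"
proof -
  have a: "lip_on s u a" and r: "lip_on s u r"
    using F.solution_on_lip_on[OF a_solution] F.solution_on_lip_on[OF r_solution] by auto
  have "lip_on s u (\<lambda>t. (x t - \<delta>m - r t) * inverse (a t - r t))"
    using piece_lip_on[OF assms] a r separated d0
    by (intro lip_on_mult lip_on_diff lip_on_const lip_on_inverse[where m = d0])
  then show ?thesis unfolding lam_def[abs_def] divide_inverse .
qed

text \<open>In the quotient rule the derivatives of \<open>a\<close> and \<open>r\<close> combine
  with \<lambda> to the chord through the two solutions, so the numerator is the chord defect, up to
  the difference between \<Delta> and its limit.\<close>

lemma lam_derivative:
  assumes "piece g s u x"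
  shows "AE t in lebesgue. t \<in> {s<..<u} \<longrightarrow> (lam x has_real_derivative
      (g t (x t) - f t (r t) - lam x t * (f t (a t) - f t (r t))) / (a t - r t)) (at t)"
proof -
  have "piece f s u a" "piece f s u r"
    using F.solution_on_piece[OF a_solution] F.solution_on_piece[OF r_solution] by auto
  from piece_derivative[OF assms] this[THEN piece_derivative] show ?thesis
  proof eventually_elim
    case (elim t)
    show ?case
    proof
      assume "t \<in> {s<..<u}"
      with elim have d: "(x has_real_derivative g t (x t)) (at t)"
        "(a has_real_derivative f t (a t)) (at t)" "(r has_real_derivative f t (r t)) (at t)" by auto
      have nz: "a t - r t \<noteq> 0" using gap_pos[of t] by simp
      have "((\<lambda>t. (x t - \<delta>m - r t) / (a t - r t)) has_real_derivative
          ((g t (x t) - 0 - f t (r t)) * (a t - r t) - (x t - \<delta>m - r t) * (f t (a t) - f t (r t))) /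
          ((a t - r t) * (a t - r t))) (at t)"
        by (intro DERIV_divide DERIV_diff DERIV_const d nz)
      moreover have "((g t (x t) - 0 - f t (r t)) * (a t - r t) - (x t - \<delta>m - r t) * (f t (a t) - f t (r t))) /
          ((a t - r t) * (a t - r t)) = (g t (x t) - f t (r t) - lam x t * (f t (a t) - f t (r t))) / (a t - r t)"
        unfolding lam_def using nz by (simp add: divide_simps)
      ultimately show "(lam x has_real_derivative
          (g t (x t) - f t (r t) - lam x t * (f t (a t) - f t (r t))) / (a t - r t)) (at t)"
        unfolding lam_def[abs_def] by (simp only:)
    qed
  qed
qed

section \<open>Drift of the coordinate, barriers and contraction\<close>

text \<open>Bounding \<lambda> by \<Lambda> confines all arguments of \<open>f t\<close> to one
  ball, on which a single modulus of concavity and a single Lipschitz constant hold.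
  \<open>c1\<close> and \<open>c2\<close> precede \<epsilon> and the solution, so that \<epsilon>
  can be adapted to them.\<close>

lemma lam_logistic:
  assumes \<Lambda>: "\<Lambda> \<ge> 1"
  shows "\<exists>c1>0. \<exists>c2\<ge>0. \<forall>\<epsilon> s u x. 0 \<le> \<epsilon> \<longrightarrow> \<epsilon> \<le> 1 \<longrightarrow> (\<forall>t\<le>u. \<bar>\<Delta> t - \<delta>m\<bar> \<le> \<epsilon>) \<longrightarrow> piece g s u x \<longrightarrow>
    (AE t in lebesgue. t \<in> {s<..<u} \<longrightarrow> \<bar>lam x t\<bar> \<le> \<Lambda> \<longrightarrow> (\<exists>D. (lam x has_real_derivative D) (at t) \<and>
      (0 \<le> lam x t \<and> lam x t \<le> 1 \<longrightarrow> D \<ge> c1 * (lam x t * (1 - lam x t)) - c2 * \<epsilon>) \<and>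
      (lam x t \<le> 0 \<or> 1 \<le> lam x t \<longrightarrow> D \<le> c1 * (lam x t * (1 - lam x t)) + c2 * \<epsilon>)))"
proof -
  \<comment> \<open>\<open>r + \<lambda> (a - r)\<close> has modulus at most
    \<open>R + \<Lambda> * (2 * R)\<close>; the extra 1 covers the displacement of \<Delta> from its
    limit.\<close>
  define B where "B = R + \<Lambda> * (2 * R) + 1"
  obtain K \<delta> where K: "K \<ge> 0" "\<delta> > 0" and ae: "AE t in lebesgue. regular_on (f t) (fx t) B K \<delta>"
    using f_regular[of B] by blast
  note ae = ae[unfolded regular_on_def]
  show ?thesis
  proof (rule exI[of _ "\<delta> * d0 / 2"], intro conjI exI[of _ "K / d0"] allI impI)
    show "\<delta> * d0 / 2 > 0" "K / d0 \<ge> 0" using K d0 by auto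
    fix \<epsilon> s u x
    assume \<epsilon>: "0 \<le> \<epsilon>" "\<epsilon> \<le> 1" and \<Delta>\<epsilon>: "\<forall>t\<le>u. \<bar>\<Delta> t - \<delta>m\<bar> \<le> \<epsilon>" and x: "piece g s u x"
    show "AE t in lebesgue. t \<in> {s<..<u} \<longrightarrow> \<bar>lam x t\<bar> \<le> \<Lambda> \<longrightarrow> (\<exists>D. (lam x has_real_derivative D) (at t) \<and>
      (0 \<le> lam x t \<and> lam x t \<le> 1 \<longrightarrow> D \<ge> \<delta> * d0 / 2 * (lam x t * (1 - lam x t)) - K / d0 * \<epsilon>) \<and>
      (lam x t \<le> 0 \<or> 1 \<le> lam x t \<longrightarrow> D \<le> \<delta> * d0 / 2 * (lam x t * (1 - lam x t)) + K / d0 * \<epsilon>))"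
      using lam_derivative[OF x] ae f_derivative
    proof eventually_elim
      case (elim t)
      show ?case
      proof (intro impI)
        assume t: "t \<in> {s<..<u}" and lt: "\<bar>lam x t\<bar> \<le> \<Lambda>"
        interpret C: strongly_concave_fun "f t" "fx t" B \<delta>
          by unfold_locales (use elim K in auto)
        let ?l = "lam x t" and ?d = "a t - r t"
        let ?y = "r t + ?l * ?d"
        define D where "D = (g t (x t) - f t (r t) - ?l * (f t (a t) - f t (r t))) / ?d"
        have der: "(lam x has_real_derivative D) (at t)" using elim(1) t unfolding D_def by blast
        have RB: "\<bar>a t\<bar> \<le> B" "\<bar>r t\<bar> \<le> B" "\<bar>?y\<bar> \<le> B - 1"
        proof -
          have "0 \<le> \<Lambda> * (2 * R)" using \<Lambda> R_pos by simp
          then show "\<bar>a t\<bar> \<le> B" "\<bar>r t\<bar> \<le> B" using a_bounded[of t] r_bounded[of t] unfolding B_def by linarith+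
          show "\<bar>?y\<bar> \<le> B - 1" using lam_abs_bound[OF lt] unfolding lam_eq B_def by simp
        qed
        have \<theta>: "\<bar>\<Delta> t - \<delta>m\<bar> \<le> \<epsilon>" using \<Delta>\<epsilon> t by simp
        have xy: "x t - \<Delta> t = ?y - (\<Delta> t - \<delta>m)" using lam_eq[of x t] by linarith
        have mB: "a t \<in> {- B..B}" "r t \<in> {- B..B}" "?y \<in> {- B..B}" "x t - \<Delta> t \<in> {- B..B}"
          using RB \<theta> \<epsilon> unfolding xy by (auto simp: abs_le_iff)
        have "\<bar>f t (x t - \<Delta> t) - f t ?y\<bar> \<le> K * \<bar>(x t - \<Delta> t) - ?y\<bar>" using elim(2) mB by blast
        also have "\<dots> \<le> K * \<epsilon>" using K \<theta> unfolding xy by (intro mult_left_mono) auto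
        finally have P: "\<bar>f t (x t - \<Delta> t) - f t ?y\<bar> \<le> K * \<epsilon>" .
        \<comment> \<open>\<open>Q\<close> is the pure chord defect at the shifted point,
          \<open>P\<close> the error of replacing \<open>\<Delta> t\<close> by
          \<open>\<delta>m\<close>.\<close>
        define P where "P = f t (x t - \<Delta> t) - f t ?y"
        define Q where "Q = f t ?y - f t (r t) - ?l * (f t (a t) - f t (r t))"
        have D: "D = Q / ?d + P / ?d"
          unfolding D_def P_def Q_def shifted_def by (simp add: diff_divide_distrib)
        have Pd: "\<bar>P / ?d\<bar> \<le> K / d0 * \<epsilon>"
        proof -
          have "\<bar>P\<bar> / ?d \<le> (K * \<epsilon>) / d0"
            using P separated[of t] d0 K \<epsilon> unfolding P_def by (intro frac_le) auto
          then show ?thesis using gap_pos[of t] by (simp add: abs_divide)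
        qed
        have in': "D \<ge> \<delta> * d0 / 2 * (?l * (1 - ?l)) - K / d0 * \<epsilon>" if "0 \<le> ?l" "?l \<le> 1"
        proof -
          have "Q \<ge> \<delta> / 2 * (?l * (1 - ?l) * ?d\<^sup>2)" unfolding Q_def by (rule C.chord_inside[OF mB(2,1) that])
          then have "\<delta> * d0 / 2 * (?l * (1 - ?l)) \<le> Q / ?d"
            using that K d0 separated[of t] by (intro divide_lower_bound) auto
          then show ?thesis using abs_le_D2[OF Pd] unfolding D by linarith
        qed
        have out: "D \<le> \<delta> * d0 / 2 * (?l * (1 - ?l)) + K / d0 * \<epsilon>" if "?l \<le> 0 \<or> 1 \<le> ?l"
        proof -
          have "Q \<le> \<delta> / 2 * (?l * (1 - ?l) * ?d\<^sup>2)" unfolding Q_def by (rule C.chord_outside[OF mB(2,1,3) that])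
          moreover have "?l * (1 - ?l) \<le> 0" using that by (auto simp: mult_le_0_iff)
          ultimately have "Q / ?d \<le> \<delta> * d0 / 2 * (?l * (1 - ?l))"
            using K d0 separated[of t] by (intro divide_upper_bound) auto
          then show ?thesis using abs_le_D1[OF Pd] unfolding D by linarith
        qed
        show "\<exists>D. (lam x has_real_derivative D) (at t) \<and>
          (0 \<le> ?l \<and> ?l \<le> 1 \<longrightarrow> D \<ge> \<delta> * d0 / 2 * (?l * (1 - ?l)) - K / d0 * \<epsilon>) \<and>
          (?l \<le> 0 \<or> 1 \<le> ?l \<longrightarrow> D \<le> \<delta> * d0 / 2 * (?l * (1 - ?l)) + K / d0 * \<epsilon>)"
          using der in' out by blast
      qed
    qed
  qed
qed

lemma \<Delta>_eventually_near: "\<epsilon> > 0 \<Longrightarrow> \<exists>T. \<forall>t\<le>T. \<bar>\<Delta> t - \<delta>m\<bar> \<le> \<epsilon>"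
  using tendstoD[OF \<Delta>_limit] unfolding eventually_at_bot_linorder dist_real_def by (meson less_imp_le)

text \<open>The logistic inequality reduced to a drift of fixed speed \<open>c\<close>: upward
  between the levels \<eta> and 1 - \<eta>, downward below -\<eta> and above 1 + \<eta>. The start
  \<open>s\<close> is not restricted, so the drift can act over arbitrarily long past
  intervals.\<close>

definition region :: "real \<Rightarrow> real \<Rightarrow> real \<Rightarrow> real \<Rightarrow> bool" where
  "region \<Lambda> \<eta> c T \<longleftrightarrow> c > 0 \<and> (\<forall>s u x. u \<le> T \<longrightarrow> piece g s u x \<longrightarrow>
    (AE t in lebesgue. t \<in> {s<..<u} \<longrightarrow> \<bar>lam x t\<bar> \<le> \<Lambda> \<longrightarrow> (\<exists>D. (lam x has_real_derivative D) (at t) \<and>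
      (\<eta> \<le> lam x t \<and> lam x t \<le> 1 - \<eta> \<longrightarrow> D \<ge> c) \<and> (lam x t \<le> - \<eta> \<or> 1 + \<eta> \<le> lam x t \<longrightarrow> D \<le> - c))))"

lemma region_exists:
  assumes \<Lambda>: "\<Lambda> \<ge> 1" and \<eta>: "0 < \<eta>" "\<eta> < 1 / 2"
  shows "\<exists>c T. region \<Lambda> \<eta> c T"
proof -
  obtain c1 c2 where c: "c1 > 0" "c2 \<ge> 0" and L: "\<And>\<epsilon> s u x. 0 \<le> \<epsilon> \<Longrightarrow> \<epsilon> \<le> 1 \<Longrightarrow> (\<forall>t\<le>u. \<bar>\<Delta> t - \<delta>m\<bar> \<le> \<epsilon>) \<Longrightarrow> piece g s u x \<Longrightarrow>
    (AE t in lebesgue. t \<in> {s<..<u} \<longrightarrow> \<bar>lam x t\<bar> \<le> \<Lambda> \<longrightarrow> (\<exists>D. (lam x has_real_derivative D) (at t) \<and>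
      (0 \<le> lam x t \<and> lam x t \<le> 1 \<longrightarrow> D \<ge> c1 * (lam x t * (1 - lam x t)) - c2 * \<epsilon>) \<and>
      (lam x t \<le> 0 \<or> 1 \<le> lam x t \<longrightarrow> D \<le> c1 * (lam x t * (1 - lam x t)) + c2 * \<epsilon>)))"
    using lam_logistic[OF \<Lambda>] by blast
  \<comment> \<open>Half of \<open>c1 * (\<eta> * (1 - \<eta>))\<close>, which bounds the modulus of
    the logistic term from below in all drift zones. The other half absorbs the error
    \<open>c2 * \<epsilon>\<close>.\<close>
  define c where "c = c1 * (\<eta> * (1 - \<eta>)) / 2"
  have cpos: "c > 0" using c \<eta> unfolding c_def by auto
  define \<epsilon> where "\<epsilon> = min 1 (c / (c2 + 1))"
  have \<epsilon>: "0 < \<epsilon>" "\<epsilon> \<le> 1" "c2 * \<epsilon> \<le> c"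
  proof -
    show "0 < \<epsilon>" "\<epsilon> \<le> 1" using cpos c unfolding \<epsilon>_def by auto
    have "c2 * \<epsilon> \<le> c2 * (c / (c2 + 1))" using c unfolding \<epsilon>_def by (intro mult_left_mono) auto
    also have "\<dots> \<le> c" using c cpos by (simp add: field_simps)
    finally show "c2 * \<epsilon> \<le> c" .
  qed
  obtain T where T: "\<forall>t\<le>T. \<bar>\<Delta> t - \<delta>m\<bar> \<le> \<epsilon>" using \<Delta>_eventually_near[OF \<epsilon>(1)] by blast
  have "region \<Lambda> \<eta> c T"
    unfolding region_def
  proof (intro conjI cpos allI impI)
    fix s u x assume u: "u \<le> T" and x: "piece g s u x"
    have "\<forall>t\<le>u. \<bar>\<Delta> t - \<delta>m\<bar> \<le> \<epsilon>" using T u by auto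
    from L[OF less_imp_le[OF \<epsilon>(1)] \<epsilon>(2) this x]
    show "AE t in lebesgue. t \<in> {s<..<u} \<longrightarrow> \<bar>lam x t\<bar> \<le> \<Lambda> \<longrightarrow> (\<exists>D. (lam x has_real_derivative D) (at t) \<and>
      (\<eta> \<le> lam x t \<and> lam x t \<le> 1 - \<eta> \<longrightarrow> D \<ge> c) \<and> (lam x t \<le> - \<eta> \<or> 1 + \<eta> \<le> lam x t \<longrightarrow> D \<le> - c))"
    proof eventually_elim
      case (elim t)
      show ?case
      proof (intro impI)
        assume "t \<in> {s<..<u}" "\<bar>lam x t\<bar> \<le> \<Lambda>"
        with elim obtain D where D: "(lam x has_real_derivative D) (at t)"
          "0 \<le> lam x t \<and> lam x t \<le> 1 \<longrightarrow> D \<ge> c1 * (lam x t * (1 - lam x t)) - c2 * \<epsilon>"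
          "lam x t \<le> 0 \<or> 1 \<le> lam x t \<longrightarrow> D \<le> c1 * (lam x t * (1 - lam x t)) + c2 * \<epsilon>" by blast
        have "D \<ge> c" if l: "\<eta> \<le> lam x t" "lam x t \<le> 1 - \<eta>"
        proof -
          have "0 \<le> (lam x t - \<eta>) * (1 - \<eta> - lam x t)" using l by (intro mult_nonneg_nonneg) auto
          then have "\<eta> * (1 - \<eta>) \<le> lam x t * (1 - lam x t)" by (simp add: algebra_simps)
          then have "c1 * (\<eta> * (1 - \<eta>)) \<le> c1 * (lam x t * (1 - lam x t))" using c by (intro mult_left_mono) auto
          then have "2 * c \<le> c1 * (lam x t * (1 - lam x t))" unfolding c_def by simp
          then show ?thesis using D(2) l \<eta> \<epsilon>(3) by simp
        qed
        moreover have "D \<le> - c" if l: "lam x t \<le> - \<eta> \<or> 1 + \<eta> \<le> lam x t"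
        proof -
          have "0 \<le> (lam x t + \<eta>) * (lam x t - 1 - \<eta>)"
            using l \<eta> by (auto intro: mult_nonneg_nonneg mult_nonpos_nonpos)
          then have "lam x t * (1 - lam x t) \<le> - (\<eta> * (1 + \<eta>))" by (simp add: algebra_simps)
          also have "\<dots> \<le> - (\<eta> * (1 - \<eta>))" using \<eta> by simp
          finally have "c1 * (lam x t * (1 - lam x t)) \<le> c1 * (- (\<eta> * (1 - \<eta>)))" using c by (intro mult_left_mono) auto
          then have "c1 * (lam x t * (1 - lam x t)) \<le> - 2 * c" unfolding c_def by simp
          moreover have "lam x t \<le> 0 \<or> 1 \<le> lam x t" using l \<eta> by auto
          ultimately show ?thesis using D(3) \<epsilon>(3) by linarith
        qed
        ultimately show "\<exists>D. (lam x has_real_derivative D) (at t) \<and>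
          (\<eta> \<le> lam x t \<and> lam x t \<le> 1 - \<eta> \<longrightarrow> D \<ge> c) \<and> (lam x t \<le> - \<eta> \<or> 1 + \<eta> \<le> lam x t \<longrightarrow> D \<le> - c)"
          using D(1) by blast
      qed
    qed
  qed
  then show ?thesis by blast
qed

lemma regionD:
  assumes "region \<Lambda> \<eta> c T" "u \<le> T" "piece g s u x"
  shows "AE t in lebesgue. t \<in> {s<..<u} \<longrightarrow> \<bar>lam x t\<bar> \<le> \<Lambda> \<longrightarrow> (\<exists>D. (lam x has_real_derivative D) (at t) \<and>
      (\<eta> \<le> lam x t \<and> lam x t \<le> 1 - \<eta> \<longrightarrow> D \<ge> c) \<and> (lam x t \<le> - \<eta> \<or> 1 + \<eta> \<le> lam x t \<longrightarrow> D \<le> - c))"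
  using assms unfolding region_def by blast

lemma region_pos: "region \<Lambda> \<eta> c T \<Longrightarrow> c > 0"
  unfolding region_def by blast

text \<open>Between \<eta> and \<open>l\<close> the drift is upward, so this strip cannot be crossed
  downward.\<close>

lemma lam_stays_above:
  assumes reg: "region \<Lambda> \<eta> c T" and \<Lambda>: "\<Lambda> \<ge> 1" and l: "0 < \<eta>" "\<eta> < l" "l \<le> 1 - \<eta>"
    and x: "solution_on g J x" and st: "s \<in> J" "t \<in> J" "s \<le> t" "t \<le> T" and s: "lam x s \<ge> l"
  shows "lam x t \<ge> l"
proof -
  have p: "piece g s t x"
    by (rule solution_on_piece[OF x interval_subset[OF solution_on_interval[OF x] st(1,2)]])
  have "l - lam x t \<le> 0"
  proof (rule lip_on_barrier[where c = s and d = t and w = "\<lambda>u. l - lam x u" and h = "l - \<eta>"])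
    show "lip_on s t (\<lambda>u. l - lam x u)" using lip_on_lam[OF p] by (intro lip_on_intros)
    show "AE u in lebesgue. u \<in> {s<..<t} \<longrightarrow> 0 < l - lam x u \<longrightarrow> l - lam x u < l - \<eta> \<longrightarrow>
        (\<exists>D\<le>0. ((\<lambda>u. l - lam x u) has_real_derivative D) (at u))"
      using regionD[OF reg st(4) p]
    proof eventually_elim
      case (elim u)
      show ?case
      proof (intro impI)
        assume u: "u \<in> {s<..<t}" "0 < l - lam x u" "l - lam x u < l - \<eta>"
        then have "\<bar>lam x u\<bar> \<le> \<Lambda>" "\<eta> \<le> lam x u \<and> lam x u \<le> 1 - \<eta>" using l \<Lambda> by auto
        with elim u(1) obtain D where D: "(lam x has_real_derivative D) (at u)" "D \<ge> c" by blast
        show "\<exists>D\<le>0. ((\<lambda>u. l - lam x u) has_real_derivative D) (at u)"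
          using DERIV_diff[OF DERIV_const[of l] D(1)] D(2) region_pos[OF reg]
          by (intro exI[of _ "0 - D"]) simp
      qed
    qed
  qed (use st s l in auto)
  then show ?thesis by simp
qed

text \<open>The strip of width \<eta> above the level must lie where the drift is downward. This
  holds for the level -2 \<eta>, whose strip ends at -\<eta>, and for any level from 1 + \<eta> on
  that leaves room below \<Lambda>.\<close>

lemma lam_stays_below:
  assumes reg: "region \<Lambda> \<eta> c T" and l: "l = - 2 * \<eta> \<and> \<Lambda> \<ge> 1 \<and> \<eta> < 1 / 2 \<or> 1 + \<eta> \<le> l \<and> l + \<eta> \<le> \<Lambda>" and \<eta>: "\<eta> > 0"
    and x: "solution_on g J x" and st: "s \<in> J" "t \<in> J" "s \<le> t" "t \<le> T" and s: "lam x s \<le> l"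
  shows "lam x t \<le> l"
proof -
  have p: "piece g s t x"
    by (rule solution_on_piece[OF x interval_subset[OF solution_on_interval[OF x] st(1,2)]])
  have "lam x t - l \<le> 0"
  proof (rule lip_on_barrier[where c = s and d = t and w = "\<lambda>u. lam x u - l" and h = \<eta>])
    show "lip_on s t (\<lambda>u. lam x u - l)" using lip_on_lam[OF p] by (intro lip_on_intros)
    show "AE u in lebesgue. u \<in> {s<..<t} \<longrightarrow> 0 < lam x u - l \<longrightarrow> lam x u - l < \<eta> \<longrightarrow>
        (\<exists>D\<le>0. ((\<lambda>u. lam x u - l) has_real_derivative D) (at u))"
      using regionD[OF reg st(4) p]
    proof eventually_elim
      case (elim u)
      show ?case
      proof (intro impI)
        assume u: "u \<in> {s<..<t}" "0 < lam x u - l" "lam x u - l < \<eta>"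
        then have "\<bar>lam x u\<bar> \<le> \<Lambda>" "lam x u \<le> - \<eta> \<or> 1 + \<eta> \<le> lam x u" using l \<eta> by (auto simp: abs_le_iff)
        with elim u(1) obtain D where D: "(lam x has_real_derivative D) (at u)" "D \<le> - c" by blast
        show "\<exists>D\<le>0. ((\<lambda>u. lam x u - l) has_real_derivative D) (at u)"
          using DERIV_diff[OF D(1) DERIV_const[of l]] D(2) region_pos[OF reg]
          by (intro exI[of _ "D - 0"]) simp
      qed
    qed
  qed (use st s \<eta> in auto)
  then show ?thesis by simp
qed

lemma lam_decreases:
  assumes reg: "region \<Lambda> \<eta> c T" and p: "piece g s t x" and st: "s \<le> t" "t \<le> T"
    and l: "\<And>u. u \<in> {s<..<t} \<Longrightarrow> \<bar>lam x u\<bar> \<le> \<Lambda> \<and> (lam x u \<le> - \<eta> \<or> 1 + \<eta> \<le> lam x u)"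
  shows "lam x t \<le> lam x s - c * (t - s)"
proof (rule lip_on_linear_decrease[OF st(1) lip_on_lam[OF p]])
  show "AE u in lebesgue. u \<in> {s<..<t} \<longrightarrow> (\<exists>D\<le>- c. (lam x has_real_derivative D) (at u))"
    using regionD[OF reg st(2) p] by eventually_elim (use l in blast)
qed

lemma lam_increases:
  assumes reg: "region \<Lambda> \<eta> c T" and p: "piece g s t x" and st: "s \<le> t" "t \<le> T" and \<Lambda>: "\<Lambda> \<ge> 1" and \<eta>: "\<eta> > 0"
    and l: "\<And>u. u \<in> {s<..<t} \<Longrightarrow> \<eta> \<le> lam x u \<and> lam x u \<le> 1 - \<eta>"
  shows "lam x t \<ge> lam x s + c * (t - s)"
proof -
  have "0 - lam x t \<le> 0 - lam x s - c * (t - s)"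
  proof (rule lip_on_linear_decrease[OF st(1), of "\<lambda>u. 0 - lam x u"])
    show "lip_on s t (\<lambda>u. 0 - lam x u)" using lip_on_lam[OF p] by (intro lip_on_intros)
    show "AE u in lebesgue. u \<in> {s<..<t} \<longrightarrow> (\<exists>D\<le>- c. ((\<lambda>u. 0 - lam x u) has_real_derivative D) (at u))"
      using regionD[OF reg st(2) p]
    proof eventually_elim
      case (elim u)
      show ?case
      proof
        assume u: "u \<in> {s<..<t}"
        then have "\<bar>lam x u\<bar> \<le> \<Lambda>" using l[OF u] \<eta> \<Lambda> by auto
        with elim u l[OF u] obtain D where D: "(lam x has_real_derivative D) (at u)" "D \<ge> c" by blast
        show "\<exists>D\<le>- c. ((\<lambda>u. 0 - lam x u) has_real_derivative D) (at u)"
          using DERIV_diff[OF DERIV_const[of 0] D(1)] D(2) by (intro exI[of _ "0 - D"]) simp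
      qed
    qed
  qed
  then show ?thesis by simp
qed

text \<open>Near \<open>a\<close> the chord slope exceeds the derivative, which makes solutions contract.\<close>

lemma contraction:
  "\<exists>\<eta> c T. 0 < \<eta> \<and> \<eta> < 1 / 4 \<and> c > 0 \<and> (\<forall>s t x y. s \<le> t \<longrightarrow> t \<le> T \<longrightarrow> piece g s t x \<longrightarrow> piece g s t y \<longrightarrow>
     (\<forall>u\<in>{s..t}. y u \<le> x u \<and> \<bar>lam x u - 1\<bar> \<le> 2 * \<eta> \<and> \<bar>lam y u - 1\<bar> \<le> 2 * \<eta>) \<longrightarrow>
     lam x t - lam y t \<le> exp (- c * (t - s)) * (lam x s - lam y s))"
proof -
  \<comment> \<open>Near 1 the coordinate is at most 2 in modulus; the last 1 covers the
    displacement of \<Delta>.\<close>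
  define B where "B = R + 2 * (2 * R) + 1"
  obtain K \<delta> where K: "K \<ge> 0" "\<delta> > 0" and ae: "AE t in lebesgue. regular_on (f t) (fx t) B K \<delta>"
    using f_regular[of B] by blast
  note ae = ae[unfolded regular_on_def]
  \<comment> \<open>The gain is \<open>\<delta> / 2\<close> times the gap. The choices of \<eta> and
    \<epsilon> spend \<open>\<delta> / 8\<close> of it each, on the distance from \<open>a\<close>
    and on the displacement of \<Delta>, which leaves \<open>\<delta> * d0 / 4\<close> as the rate
    \<open>c\<close>.\<close>
  define \<eta> where "\<eta> = min (1 / 8) (\<delta> / (16 * (K + 1)))"
  have \<eta>: "0 < \<eta>" "\<eta> < 1 / 4" "K * (2 * \<eta>) \<le> \<delta> / 8"
  proof -
    show "0 < \<eta>" "\<eta> < 1 / 4" using K unfolding \<eta>_def by auto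
    have "K * (2 * \<eta>) \<le> K * (2 * (\<delta> / (16 * (K + 1))))" using K unfolding \<eta>_def by (intro mult_left_mono) auto
    also have "\<dots> \<le> \<delta> / 8" using K by (simp add: field_simps)
    finally show "K * (2 * \<eta>) \<le> \<delta> / 8" .
  qed
  define \<epsilon> where "\<epsilon> = min 1 (\<delta> * d0 / (8 * (K + 1)))"
  have \<epsilon>: "0 < \<epsilon>" "\<epsilon> \<le> 1" "K * \<epsilon> \<le> \<delta> * d0 / 8"
  proof -
    show "0 < \<epsilon>" "\<epsilon> \<le> 1" using K d0 unfolding \<epsilon>_def by auto
    have "K * \<epsilon> \<le> K * (\<delta> * d0 / (8 * (K + 1)))" using K unfolding \<epsilon>_def by (intro mult_left_mono) auto
    also have "\<dots> \<le> \<delta> * d0 / 8" using K d0 by (simp add: field_simps)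
    finally show "K * \<epsilon> \<le> \<delta> * d0 / 8" .
  qed
  obtain T where T: "\<forall>t\<le>T. \<bar>\<Delta> t - \<delta>m\<bar> \<le> \<epsilon>" using \<Delta>_eventually_near[OF \<epsilon>(1)] by blast
  define c where "c = \<delta> * d0 / 4"
  have c: "c > 0" using K d0 unfolding c_def by simp
  have "lam x t - lam y t \<le> exp (- c * (t - s)) * (lam x s - lam y s)"
    if st: "s \<le> t" "t \<le> T" and px: "piece g s t x" and py: "piece g s t y"
      and h: "\<forall>u\<in>{s..t}. y u \<le> x u \<and> \<bar>lam x u - 1\<bar> \<le> 2 * \<eta> \<and> \<bar>lam y u - 1\<bar> \<le> 2 * \<eta>" for s t x y
  proof (rule lip_on_exponential_decrease[OF st(1), of "\<lambda>u. lam x u - lam y u"])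
    show "lip_on s t (\<lambda>u. lam x u - lam y u)"
      using lip_on_lam[OF px] lip_on_lam[OF py] by (rule lip_on_diff)
    show "AE u in lebesgue. u \<in> {s<..<t} \<longrightarrow>
        (\<exists>D\<le>- c * (lam x u - lam y u). ((\<lambda>u. lam x u - lam y u) has_real_derivative D) (at u))"
      using lam_derivative[OF px] lam_derivative[OF py] ae f_derivative
    proof eventually_elim
      case (elim u)
      show ?case
      proof
        assume u: "u \<in> {s<..<t}"
        interpret C: strongly_concave_fun "f u" "fx u" B \<delta>
          by unfold_locales (use elim K in auto)
        let ?d = "a u - r u"
        \<comment> \<open>The slope of the chord: it is the common linear term that the coordinate
          subtracts from both solutions.\<close>
        define S where "S = (f u (a u) - f u (r u)) / ?d"
        have hu: "y u \<le> x u" "\<bar>lam x u - 1\<bar> \<le> 2 * \<eta>" "\<bar>lam y u - 1\<bar> \<le> 2 * \<eta>" using h u by auto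
        have \<theta>: "\<bar>\<Delta> u - \<delta>m\<bar> \<le> \<epsilon>" using T u st by simp
        have mem: "z u - \<Delta> u \<in> {- B..B}" if "\<bar>lam z u - 1\<bar> \<le> 2 * \<eta>" for z
        proof -
          have "\<bar>lam z u\<bar> \<le> 2" using that \<eta> by linarith
          then have "\<bar>z u - \<delta>m\<bar> \<le> B - 1" using lam_abs_bound[of z u 2] unfolding B_def by simp
          then have "\<bar>z u - \<Delta> u\<bar> \<le> B" using \<theta> \<epsilon> by linarith
          then show ?thesis by (auto simp: abs_le_iff)
        qed
        have ar: "a u \<in> {- B..B}" "r u \<in> {- B..B}" "r u < a u"
          using a_bounded[of u] r_bounded[of u] R_pos gap_pos[of u] unfolding B_def by (auto simp: abs_le_iff)
        \<comment> \<open>The coordinate accounts for at most \<open>2 * \<eta>\<close> times the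
          gap, the displacement of \<Delta> for at most \<epsilon>.\<close>
        have near: "y u - \<Delta> u \<ge> a u - (2 * \<eta> * ?d + \<epsilon>)"
        proof -
          have "(1 - 2 * \<eta>) * ?d \<le> lam y u * ?d" using hu(3) gap_pos[of u] by (intro mult_right_mono) auto
          then show ?thesis using lam_eq[of y u] \<theta> by (simp add: algebra_simps abs_le_iff)
        qed
        have "f u (x u - \<Delta> u) - f u (y u - \<Delta> u) - ((x u - \<Delta> u) - (y u - \<Delta> u)) * S \<le>
            (K * (2 * \<eta> * ?d + \<epsilon>) - \<delta> / 2 * ?d) * ((x u - \<Delta> u) - (y u - \<Delta> u))"
          unfolding S_def
        proof (rule C.contraction_near[OF ar(2,1,3) mem[OF hu(3)] mem[OF hu(2)] _ near])
          show "\<bar>fx u z - fx u (a u)\<bar> \<le> K * \<bar>z - a u\<bar>" if "z \<in> {- B..B}" for z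
            using elim(3) that ar by blast
          show "0 \<le> 2 * \<eta> * ?d + \<epsilon>" using \<eta> \<epsilon> gap_pos[of u] by simp
        qed (use hu K in auto)
        also have "\<dots> \<le> (- c) * ((x u - \<Delta> u) - (y u - \<Delta> u))"
        proof (rule mult_right_mono)
          define e where "e = ?d"
          have e: "0 < e" "d0 \<le> e" using gap_pos[of u] separated[of u] unfolding e_def by auto
          have "K * (2 * \<eta>) * e \<le> \<delta> / 8 * e" using \<eta> e by (intro mult_right_mono) auto
          moreover have "\<delta> * d0 \<le> \<delta> * e" using K e by (intro mult_left_mono) auto
          moreover have "K * (2 * \<eta> * e + \<epsilon>) = K * (2 * \<eta>) * e + K * \<epsilon>" by (simp add: algebra_simps)
          ultimately show "K * (2 * \<eta> * ?d + \<epsilon>) - \<delta> / 2 * ?d \<le> - c"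
            using \<epsilon>(3) unfolding c_def e_def[symmetric] by linarith
        qed (use hu in simp)
        finally have main: "f u (x u - \<Delta> u) - f u (y u - \<Delta> u) - (x u - y u) * S \<le> - c * (x u - y u)" by simp
        define D where "D = (g u (x u) - f u (r u) - lam x u * (f u (a u) - f u (r u))) / ?d -
            (g u (y u) - f u (r u) - lam y u * (f u (a u) - f u (r u))) / ?d"
        have "((\<lambda>u. lam x u - lam y u) has_real_derivative D) (at u)"
          unfolding D_def using elim(1,2) u by (intro DERIV_diff) blast+
        moreover have xy: "x u - y u = (lam x u - lam y u) * ?d"
          using lam_eq[of x u] lam_eq[of y u] by (simp add: algebra_simps)
        have "D = (f u (x u - \<Delta> u) - f u (y u - \<Delta> u) - (x u - y u) * S) / ?d"
          unfolding D_def S_def xy shifted_def using gap_pos[of u] by (simp add: field_simps)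
        then have "D \<le> (- c * (x u - y u)) / ?d"
          using divide_right_mono[OF main, of ?d] gap_pos[of u] by simp
        then have "D \<le> - c * (lam x u - lam y u)" unfolding xy using gap_pos[of u] by simp
        ultimately show "\<exists>D\<le>- c * (lam x u - lam y u). ((\<lambda>u. lam x u - lam y u) has_real_derivative D) (at u)" by blast
      qed
    qed
  qed
  then show ?thesis using \<eta>(1,2) c by blast
qed


section \<open>The upper past solution and the solutions below it\<close>

lemma past_solution_bounded:
  assumes x: "solution_on g J x" and s: "{..s} \<subseteq> J"
  obtains C where "\<And>t. t \<le> s \<Longrightarrow> \<bar>x t\<bar> \<le> C"
proof
  fix t assume t: "t \<le> s"
  have tJ: "t \<in> J" "s \<in> J" using s t by auto
  have "x t \<le> \<rho>0 + 2 * M" by (rule past_solution_le[OF x]) (use s t in auto)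
  with solution_backward_lower[OF x tJ t]
  show "\<bar>x t\<bar> \<le> \<bar>\<rho>0 + 2 * M\<bar> + \<bar>min (x s) (- (\<rho>0 + 2 * M))\<bar>" by (rule abs_le_of_bounds)
qed

lemma past_lam_bounded:
  assumes x: "solution_on g J x" and s: "{..s} \<subseteq> J"
  obtains \<Lambda> where "\<Lambda> \<ge> 3" "\<And>t. t \<le> s \<Longrightarrow> \<bar>lam x t\<bar> \<le> \<Lambda>"
proof -
  obtain C where C: "\<And>t. t \<le> s \<Longrightarrow> \<bar>x t\<bar> \<le> C" using past_solution_bounded[OF assms] by blast
  show ?thesis
  \<comment> \<open>The floor 3 leaves room for the barrier at 1 + 2 \<eta> and its strip.\<close>
  proof (rule that[of "max 3 ((C + \<bar>\<delta>m\<bar> + R) / d0)"])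
    fix t assume "t \<le> s"
    then have "(\<bar>x t\<bar> + \<bar>\<delta>m\<bar> + R) / d0 \<le> (C + \<bar>\<delta>m\<bar> + R) / d0"
      using C d0 by (intro divide_right_mono) auto
    then show "\<bar>lam x t\<bar> \<le> max 3 ((C + \<bar>\<delta>m\<bar> + R) / d0)" using lam_bound[of x t] by linarith
  qed simp
qed

text \<open>The level 1 - \<eta> cannot be crossed downward in forward time, so a solution below it
  at \<open>t\<close> was below it before. It is therefore bounded above in the past, which suffices
  for a global past.\<close>

lemma past_global_of_lam:
  assumes reg: "region \<Lambda> \<eta> c T" and \<Lambda>: "\<Lambda> \<ge> 1" and \<eta>: "0 < \<eta>" "\<eta> < 1 / 2"
    and t: "t \<le> T" and l: "l < 1 - \<eta>"
  shows "{..t} \<subseteq> sol_dom g t (\<delta>m + r t + l * (a t - r t))"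
proof (rule past_global_if_bounded)
  let ?p = "\<delta>m + r t + l * (a t - r t)"
  let ?x = "sol g t ?p"
  have lt: "lam ?x t = l" using gap_pos[of t] unfolding lam_def sol_initial by simp
  fix u assume u: "u \<in> sol_dom g t ?p" "u \<le> t"
  have "lam ?x u < 1 - \<eta>"
  proof (rule ccontr)
    assume "\<not> lam ?x u < 1 - \<eta>"
    then have "lam ?x t \<ge> 1 - \<eta>"
      using \<eta> by (intro lam_stays_above[OF reg \<Lambda> \<eta>(1) _ _ solution_on_sol u(1) in_sol_dom u(2) t]) auto
    then show False using lt l by simp
  qed
  then have "lam ?x u * (a u - r u) \<le> 1 * (a u - r u)" using gap_pos[of u] \<eta> by (intro mult_right_mono) auto
  moreover define y where "y = ?x u"
  moreover define m where "m = lam ?x u * (a u - r u)"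
  ultimately have "m \<le> a u - r u" "y - \<delta>m = r u + m" using lam_eq[of ?x u] by simp_all
  then have "y \<le> \<bar>\<delta>m\<bar> + 3 * R" using gap_le[of u] r_bounded[of u] by linarith
  then show "?x u \<le> \<bar>\<delta>m\<bar> + 3 * R" unfolding y_def .
qed

lemma perturbed_upper_past_solution_exists: "\<exists>A aD. upper_past_solution g A aD"
proof -
  obtain c T where "region 1 (1 / 4) c T" using region_exists[of 1 "1 / 4"] by auto
  \<comment> \<open>\<open>l = 0\<close> starts the solution on the shifted repeller.\<close>
  from past_global_of_lam[OF this, of T 0] show ?thesis by (intro upper_past_solution_exists) simp
qed

text \<open>From below: the value with coordinate 1 - 2 \<eta> has a global past, so it is dominated
  by the upper solution. From above: a coordinate beyond 1 + 2 \<eta> would have been beyond it at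
  all earlier times, and the downward drift, followed backward, makes it unbounded.\<close>

lemma upper_past_solution_near:
  assumes up: "upper_past_solution g A aD" and \<eta>: "0 < \<eta>" "\<eta> < 1 / 4"
  shows "\<exists>T. \<forall>t\<le>T. t \<in> A \<and> \<bar>lam aD t - 1\<bar> \<le> 2 * \<eta>"
proof -
  have sol: "solution_on g A aD" by (rule upper_past_solutionD(2)[OF up])
  obtain s0 where "s0 \<in> A" using upper_past_solutionD(6)[OF up] by blast
  then have s0: "t \<in> A" if "t \<le> s0" for t using upper_past_solutionD(3)[OF up _ that] by blast
  have s0A: "{..s0} \<subseteq> A" using s0 by auto
  obtain \<Lambda> where \<Lambda>: "\<Lambda> \<ge> 3" "\<And>t. t \<le> s0 \<Longrightarrow> \<bar>lam aD t\<bar> \<le> \<Lambda>" using past_lam_bounded[OF sol s0A] by blast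
  obtain c T0 where reg: "region \<Lambda> \<eta> c T0" using region_exists[of \<Lambda> \<eta>] \<Lambda> \<eta> by auto
  have "t \<in> A \<and> \<bar>lam aD t - 1\<bar> \<le> 2 * \<eta>" if t: "t \<le> min s0 T0" for t
  proof -
    have tA: "t \<in> A" and tT: "t \<le> T0" using s0 t by auto
    have "\<delta>m + r t + (1 - 2 * \<eta>) * (a t - r t) \<le> aD t"
      by (rule upper_past_solutionD(5)[OF up tA past_global_of_lam[OF reg _ \<eta>(1) _ tT]]) (use \<Lambda> \<eta> in auto)
    then have "(1 - 2 * \<eta>) * (a t - r t) \<le> lam aD t * (a t - r t)" using lam_eq[of aD t] by linarith
    then have low: "1 - 2 * \<eta> \<le> lam aD t" using gap_pos[of t] by (simp add: mult_le_cancel_right)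
    have high: "lam aD t \<le> 1 + 2 * \<eta>"
    proof (rule ccontr)
      assume n: "\<not> lam aD t \<le> 1 + 2 * \<eta>"
      have big: "lam aD u > 1 + 2 * \<eta>" if u: "u \<le> t" for u
      proof (rule ccontr)
        assume "\<not> lam aD u > 1 + 2 * \<eta>"
        then have "lam aD t \<le> 1 + 2 * \<eta>"
          by (intro lam_stays_below[OF reg _ \<eta>(1) sol s0 tA u tT]) (use u t \<Lambda> \<eta> in auto)
        then show False using n by simp
      qed
      \<comment> \<open>The drift over this window is \<Lambda> + 1, so that a start of at most
        \<Lambda> would end at a negative value.\<close>
      define s where "s = t - (\<Lambda> + 1) / c"
      have st: "s \<le> t" "c * (t - s) = \<Lambda> + 1" using region_pos[OF reg] \<Lambda> unfolding s_def by auto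
      have "lam aD t \<le> lam aD s - c * (t - s)"
      proof (rule lam_decreases[OF reg _ st(1) tT])
        show "piece g s t aD" by (rule solution_on_piece[OF sol]) (use s0 t in auto)
        fix u assume "u \<in> {s<..<t}"
        then show "\<bar>lam aD u\<bar> \<le> \<Lambda> \<and> (lam aD u \<le> - \<eta> \<or> 1 + \<eta> \<le> lam aD u)"
          using \<Lambda>(2)[of u] big[of u] t \<eta> by auto
      qed
      moreover have "lam aD s \<le> \<Lambda>" using \<Lambda>(2)[of s] st t by (auto simp: abs_le_iff)
      ultimately show False using st(2) big[of t] \<eta> by linarith
    qed
    show ?thesis using tA low high by (simp add: abs_le_iff)
  qed
  then show ?thesis by blast
qed

lemma tendsto_of_lam:
  assumes near: "\<And>\<eta>. 0 < \<eta> \<Longrightarrow> \<eta> < \<eta>0 \<Longrightarrow> \<exists>T. \<forall>t\<le>T. \<bar>lam x t - l\<bar> \<le> 2 * \<eta>" and \<eta>0: "\<eta>0 > 0"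
  shows "((\<lambda>t. \<bar>x t - (r t + l * (a t - r t) + \<delta>m)\<bar>) \<longlongrightarrow> 0) at_bot"
proof (rule tendstoI)
  fix e :: real assume e: "e > 0"
  define \<eta> where "\<eta> = min (\<eta>0 / 2) (e / (8 * R))"
  have \<eta>: "0 < \<eta>" "\<eta> < \<eta>0" using e \<eta>0 R_pos unfolding \<eta>_def by auto
  have "2 * \<eta> * (2 * R) \<le> 2 * (e / (8 * R)) * (2 * R)" using R_pos unfolding \<eta>_def by (intro mult_right_mono) auto
  also have "\<dots> < e" using e R_pos by simp
  finally have small: "2 * \<eta> * (2 * R) < e" .
  obtain T where T: "\<forall>t\<le>T. \<bar>lam x t - l\<bar> \<le> 2 * \<eta>" using near[OF \<eta>] by blast
  have "dist \<bar>x t - (r t + l * (a t - r t) + \<delta>m)\<bar> 0 < e" if "t \<le> T" for t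
  proof -
    have "x t - (r t + l * (a t - r t) + \<delta>m) = (lam x t - l) * (a t - r t)"
      using lam_eq[of x t] by (simp add: left_diff_distrib)
    then have "\<bar>x t - (r t + l * (a t - r t) + \<delta>m)\<bar> = \<bar>lam x t - l\<bar> * \<bar>a t - r t\<bar>" by (simp add: abs_mult)
    also have "\<dots> \<le> 2 * \<eta> * (2 * R)"
      using T that gap_le[of t] gap_pos[of t] \<eta> by (intro mult_mono) auto
    finally show ?thesis using small by simp
  qed
  then show "eventually (\<lambda>t. dist \<bar>x t - (r t + l * (a t - r t) + \<delta>m)\<bar> 0 < e) at_bot"
    unfolding eventually_at_bot_linorder by blast
qed

lemma upper_past_solution_limit:
  assumes up: "upper_past_solution g A aD"
  shows "((\<lambda>t. \<bar>aD t - (a t + \<delta>m)\<bar>) \<longlongrightarrow> 0) at_bot"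
proof -
  have "((\<lambda>t. \<bar>aD t - (r t + 1 * (a t - r t) + \<delta>m)\<bar>) \<longlongrightarrow> 0) at_bot"
    by (rule tendsto_of_lam[of "1 / 4"]) (use upper_past_solution_near[OF up] in blast, simp)
  then show ?thesis by simp
qed

text \<open>The coordinate is trapped at ever earlier times: first above -2 \<eta>, then under 1 -
  \<eta>, then under 2 \<eta>. Each time it suffices to find one moment on the right side of the
  level, since the barriers carry this to all earlier times. Contraction towards \<open>aD\<close>
  is needed only for the middle level.\<close>

lemma past_solution_limit:
  assumes up: "upper_past_solution g A aD" and s: "s \<in> A" and x0: "x0 < aD s"
  shows "((\<lambda>t. \<bar>sol g s x0 t - (r t + \<delta>m)\<bar>) \<longlongrightarrow> 0) at_bot"
proof -
  define x where "x = sol g s x0"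
  define J where "J = sol_dom g s x0"
  have sol: "solution_on g J x" unfolding J_def x_def by (rule solution_on_sol)
  have sJ: "{..s} \<subseteq> J" unfolding J_def using upper_past_solutionD(4)[OF up s] x0 by simp
  have aD: "solution_on g A aD" by (rule upper_past_solutionD(2)[OF up])
  have less: "x t < aD t" if "t \<le> s" for t
  proof (rule solution_less_overlap[OF sol aD _ s])
    show "t \<in> A" using upper_past_solutionD(3)[OF up s that] .
  qed (use sJ that x0 in \<open>auto simp: x_def sol_initial\<close>)
  obtain \<Lambda> where \<Lambda>: "\<Lambda> \<ge> 3" "\<And>t. t \<le> s \<Longrightarrow> \<bar>lam x t\<bar> \<le> \<Lambda>" using past_lam_bounded[OF sol sJ] by blast
  obtain \<eta>c cc Tc where \<eta>c: "0 < \<eta>c" "\<eta>c < 1 / 4" "cc > 0"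
    and contr: "\<And>s t x y. s \<le> t \<Longrightarrow> t \<le> Tc \<Longrightarrow> piece g s t x \<Longrightarrow> piece g s t y \<Longrightarrow>
     (\<forall>u\<in>{s..t}. y u \<le> x u \<and> \<bar>lam x u - 1\<bar> \<le> 2 * \<eta>c \<and> \<bar>lam y u - 1\<bar> \<le> 2 * \<eta>c) \<Longrightarrow>
     lam x t - lam y t \<le> exp (- cc * (t - s)) * (lam x s - lam y s)"
    using contraction by blast
  obtain Ta where Ta: "\<And>t. t \<le> Ta \<Longrightarrow> t \<in> A \<and> \<bar>lam aD t - 1\<bar> \<le> 2 * \<eta>c"
    using upper_past_solution_near[OF up \<eta>c(1,2)] by blast
  have "\<exists>T. \<forall>t\<le>T. \<bar>lam x t - 0\<bar> \<le> 2 * \<eta>" if \<eta>: "0 < \<eta>" "\<eta> < \<eta>c" for \<eta>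
  proof -
    obtain c T0 where reg: "region \<Lambda> \<eta> c T0" using region_exists[of \<Lambda> \<eta>] \<Lambda> \<eta> \<eta>c by auto
    define T where "T = min (min T0 s) (min Ta Tc)"
    have T: "T \<le> T0" "T \<le> s" "T \<le> Ta" "T \<le> Tc" unfolding T_def by auto
    have J: "t \<in> J" if "t \<le> T" for t using that T sJ by auto
    have p: "piece g u t x" if "t \<le> T" for u t by (rule solution_on_piece[OF sol]) (use J that in auto)
    have lamL: "\<bar>lam x t\<bar> \<le> \<Lambda>" if "t \<le> T" for t using \<Lambda>(2) that T by simp
    \<comment> \<open>The drift over this window is 2 (\<Lambda> + 1), more than the width of the
      range of the coordinate.\<close>
    define w where "w = T - 2 * (\<Lambda> + 1) / c"
    have w: "w \<le> T" "c * (T - w) = 2 * (\<Lambda> + 1)" using region_pos[OF reg] \<Lambda> unfolding w_def by auto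
    \<comment> \<open>If there were no such time, downward drift on all of \<open>{w..T}\<close>
      would leave the range of the coordinate.\<close>
    obtain t1 where t1: "t1 \<le> T" "lam x t1 > - 2 * \<eta>"
    proof (rule ccontr)
      assume no: "\<not> thesis"
      have neg: "lam x t \<le> - 2 * \<eta>" if "t \<le> T" for t using no \<open>\<And>t. t \<le> T \<Longrightarrow> - 2 * \<eta> < lam x t \<Longrightarrow> thesis\<close> that by force
      have "lam x T \<le> lam x w - c * (T - w)"
      proof (rule lam_decreases[OF reg p w(1) T(1)])
        fix u assume "u \<in> {w<..<T}"
        then show "\<bar>lam x u\<bar> \<le> \<Lambda> \<and> (lam x u \<le> - \<eta> \<or> 1 + \<eta> \<le> lam x u)"
          using lamL[of u] neg[of u] \<eta> by auto
      qed simp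
      then show False using w lamL[of T] lamL[of w] \<Lambda> by (simp add: abs_le_iff)
    qed
    have low: "lam x t \<ge> - 2 * \<eta>" if t: "t \<le> t1" for t
    proof (rule ccontr)
      assume "\<not> lam x t \<ge> - 2 * \<eta>"
      then have "lam x t1 \<le> - 2 * \<eta>"
        by (intro lam_stays_below[OF reg _ \<eta>(1) sol J J t]) (use t t1 T \<Lambda> \<eta> \<eta>c in auto)
      then show False using t1 by simp
    qed
    \<comment> \<open>Otherwise \<open>x\<close> and \<open>aD\<close> both stay near coordinate 1
      in the whole past. Their difference \<open>m\<close> at \<open>T\<close> is positive and
      contracts forward, so it would have to be arbitrarily large earlier, although it is bounded by
      1.\<close>
    obtain t2 where t2: "t2 \<le> T" "lam x t2 < 1 - \<eta>"
    proof (rule ccontr)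
      assume no: "\<not> thesis"
      have above: "lam x t \<ge> 1 - \<eta>" if "t \<le> T" for t using no \<open>\<And>t. t \<le> T \<Longrightarrow> lam x t < 1 - \<eta> \<Longrightarrow> thesis\<close> that by force
      have l12: "\<bar>lam aD u - 1\<bar> \<le> 2 * \<eta>c" "\<bar>lam x u - 1\<bar> \<le> 2 * \<eta>c" "lam x u < lam aD u" if "u \<le> T" for u
      proof -
        show 1: "\<bar>lam aD u - 1\<bar> \<le> 2 * \<eta>c" using Ta that T by simp
        show 2: "lam x u < lam aD u" using less[of u] that T lam_less_iff by simp
        show "\<bar>lam x u - 1\<bar> \<le> 2 * \<eta>c" using 1 2 above[OF that] \<eta> by (simp add: abs_le_iff)
      qed
      \<comment> \<open>Now fix the remaining quantities of that contradiction.\<close>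
      define m where "m = lam aD T - lam x T"
      have m: "m > 0" using l12(3)[of T] unfolding m_def by simp
      define v where "v = T - 1 / (m * cc)"
      have v: "v \<le> T" using m \<eta>c unfolding v_def by simp
      have ev: "exp (cc * (T - v)) > 1 / m"
      proof -
        have "cc * (T - v) = 1 / m" using m \<eta>c unfolding v_def by simp
        then show ?thesis using exp_ge_add_one_self[of "cc * (T - v)"] by linarith
      qed
      have "m \<le> exp (- cc * (T - v)) * (lam aD v - lam x v)"
        unfolding m_def
      proof (rule contr[OF v T(4)])
        show "piece g v T aD" by (rule solution_on_piece[OF aD]) (use Ta T in auto)
        show "piece g v T x" by (rule p) simp
        show "\<forall>u\<in>{v..T}. x u \<le> aD u \<and> \<bar>lam aD u - 1\<bar> \<le> 2 * \<eta>c \<and> \<bar>lam x u - 1\<bar> \<le> 2 * \<eta>c"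
          using l12 less T by (auto intro: less_imp_le)
      qed
      also have "\<dots> \<le> exp (- cc * (T - v)) * 1"
        using l12[OF v] \<eta>c above[OF v] \<eta> by (intro mult_left_mono) (auto simp: abs_le_iff)
      finally have "exp (cc * (T - v)) * m \<le> exp (cc * (T - v)) * exp (- cc * (T - v))" by (intro mult_left_mono) auto
      also have "\<dots> = 1" by (simp flip: exp_add)
      finally show False using ev m by (simp add: field_simps)
    qed
    have below1: "lam x t < 1 - \<eta>" if t: "t \<le> t2" for t
    proof (rule ccontr)
      assume "\<not> lam x t < 1 - \<eta>"
      then have "lam x t2 \<ge> 1 - \<eta>"
        by (intro lam_stays_above[OF reg _ \<eta>(1) _ _ sol J J t]) (use t t2 T \<Lambda> \<eta> \<eta>c in auto)
      then show False using t2 by simp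
    qed
    \<comment> \<open>Otherwise the coordinate stays between 2 \<eta> and 1 - \<eta> up to
      \<open>t2\<close>, where the upward drift exhausts its range.\<close>
    obtain t3 where t3: "t3 \<le> t2" "lam x t3 < 2 * \<eta>"
    proof (rule ccontr)
      assume no: "\<not> thesis"
      have above: "lam x t \<ge> 2 * \<eta>" if "t \<le> t2" for t using no \<open>\<And>t. t \<le> t2 \<Longrightarrow> lam x t < 2 * \<eta> \<Longrightarrow> thesis\<close> that by force
      define w where "w = t2 - 2 * (\<Lambda> + 1) / c"
      have w: "w \<le> t2" "c * (t2 - w) = 2 * (\<Lambda> + 1)" using region_pos[OF reg] \<Lambda> unfolding w_def by auto
      have "lam x t2 \<ge> lam x w + c * (t2 - w)"
      proof (rule lam_increases[OF reg p w(1)])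
        fix u assume "u \<in> {w<..<t2}"
        then show "\<eta> \<le> lam x u \<and> lam x u \<le> 1 - \<eta>" using above[of u] below1[of u] \<eta> by auto
      qed (use t2 T \<Lambda> \<eta> in auto)
      then show False using w lamL[of t2] lamL[of w] t2 \<Lambda> by (simp add: abs_le_iff)
    qed
    have high: "lam x t < 2 * \<eta>" if t: "t \<le> t3" for t
    proof (rule ccontr)
      assume "\<not> lam x t < 2 * \<eta>"
      then have "lam x t3 \<ge> 2 * \<eta>"
        by (intro lam_stays_above[OF reg _ \<eta>(1) _ _ sol J J t]) (use t t2 t3 T \<Lambda> \<eta> \<eta>c in auto)
      then show False using t3 by simp
    qed
    have "\<bar>lam x t - 0\<bar> \<le> 2 * \<eta>" if "t \<le> min t1 t3" for t
      using low[of t] high[of t] that by linarith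
    then show ?thesis by blast
  qed
  from tendsto_of_lam[OF this \<eta>c(1)] show ?thesis unfolding x_def by simp
qed

text \<open>The perturbed solutions start within 2 \<eta> of coordinate 1, are kept there by the
  barriers 1 - 2 \<eta> and 1 + 2 \<eta>, and approach \<open>aD\<close> at the rate of
  \<open>contraction\<close>. The bound depends on \<open>t - s\<close> only, so it tends to 0 as
  the initial time recedes.\<close>

lemma upper_past_solution_pullback:
  assumes up: "upper_past_solution g A aD"
  shows "locally_pullback_attractive g A aD"
proof -
  have aD: "solution_on g A aD" by (rule upper_past_solutionD(2)[OF up])
  obtain \<eta> cc Tc where \<eta>: "0 < \<eta>" "\<eta> < 1 / 4" "cc > 0"
    and contr: "\<And>s t x y. s \<le> t \<Longrightarrow> t \<le> Tc \<Longrightarrow> piece g s t x \<Longrightarrow> piece g s t y \<Longrightarrow>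
     (\<forall>u\<in>{s..t}. y u \<le> x u \<and> \<bar>lam x u - 1\<bar> \<le> 2 * \<eta> \<and> \<bar>lam y u - 1\<bar> \<le> 2 * \<eta>) \<Longrightarrow>
     lam x t - lam y t \<le> exp (- cc * (t - s)) * (lam x s - lam y s)"
    using contraction by blast
  \<comment> \<open>Half of \<eta> is used, so that the solution itself stays within \<eta> and the
    perturbation may use up the other \<eta>.\<close>
  obtain Ta where Ta: "\<And>t. t \<le> Ta \<Longrightarrow> t \<in> A \<and> \<bar>lam aD t - 1\<bar> \<le> \<eta>"
    using upper_past_solution_near[OF up, of "\<eta> / 2"] \<eta> by auto
  obtain c T0 where reg: "region 3 \<eta> c T0" using region_exists[of 3 \<eta>] \<eta> by auto
  define s0 where "s0 = min T0 (min Ta Tc)"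
  have s0: "s0 \<le> T0" "s0 \<le> Ta" "s0 \<le> Tc" unfolding s0_def by auto
  \<comment> \<open>In the coordinate a shift by \<delta> is divided by the gap, hence amounts to at
    most \<eta> at every starting time.\<close>
  define \<delta> where "\<delta> = \<eta> * d0"
  have \<delta>: "\<delta> > 0" using \<eta> d0 unfolding \<delta>_def by simp
  have main: "{s..s0} \<subseteq> sol_dom g s (aD s + \<sigma>) \<and>
      (\<forall>t\<in>{s..s0}. \<bar>aD t - sol g s (aD s + \<sigma>) t\<bar> \<le> exp (- cc * (t - s)) * (2 * R))"
    if \<sigma>: "\<sigma> \<in> {\<delta>, - \<delta>}" and s: "s \<le> s0" for \<sigma> s
  proof -
    let ?J = "sol_dom g s (aD s + \<sigma>)" and ?y = "sol g s (aD s + \<sigma>)"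
    have nearA: "\<bar>lam aD t - 1\<bar> \<le> \<eta>" "t \<in> A" if "t \<le> s0" for t using Ta that s0 by auto
    define q where "q = \<sigma> / (a s - r s)"
    have lys: "lam ?y s = lam aD s + q"
      unfolding lam_def sol_initial q_def by (simp add: add_divide_distrib diff_divide_distrib)
    have "\<bar>q\<bar> = \<delta> / (a s - r s)" using \<sigma> \<delta> gap_pos[of s] unfolding q_def by auto
    also have "\<dots> \<le> \<delta> / d0" using separated[of s] d0 \<delta> by (intro divide_left_mono) auto
    also have "\<dots> = \<eta>" using d0 unfolding \<delta>_def by simp
    finally have \<sigma>\<eta>: "\<bar>q\<bar> \<le> \<eta>" .
    have near: "\<bar>lam ?y t - 1\<bar> \<le> 2 * \<eta>" if t: "t \<in> ?J" "s \<le> t" "t \<le> s0" for t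
    proof -
      have tT: "t \<le> T0" using t s0 by simp
      have s1: "1 - 2 * \<eta> \<le> lam ?y s" "lam ?y s \<le> 1 + 2 * \<eta>"
        using \<sigma>\<eta> nearA(1)[OF s] unfolding lys by (auto simp: abs_le_iff)
      have "1 - 2 * \<eta> \<le> lam ?y t"
        by (rule lam_stays_above[OF reg _ \<eta>(1) _ _ solution_on_sol in_sol_dom t(1,2) tT s1(1)]) (use \<eta> in auto)
      moreover have "lam ?y t \<le> 1 + 2 * \<eta>"
        by (rule lam_stays_below[OF reg _ \<eta>(1) solution_on_sol in_sol_dom t(1,2) tT s1(2)]) (use \<eta> in auto)
      ultimately show ?thesis by (simp add: abs_le_iff)
    qed
    \<comment> \<open>A positive coordinate bounds the solution from below, which is all that
      forward continuation needs.\<close>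
    have "\<exists>\<epsilon>>0. {s..s0 + \<epsilon>} \<subseteq> ?J"
    proof (rule forward_if_bounded[OF maximal_solution_sol in_sol_dom s])
      fix t assume t: "t \<in> ?J" "s \<le> t" "t \<le> s0"
      have "0 \<le> lam ?y t" using near[OF t] \<eta> by (simp add: abs_le_iff)
      then have "0 \<le> lam ?y t * (a t - r t)" using gap_pos[of t] by simp
      then show "- \<bar>\<delta>m\<bar> - R \<le> ?y t" using lam_eq[of ?y t] r_bounded[of t] by linarith
    qed
    then have dom: "{s..s0} \<subseteq> ?J" by auto
    moreover have "\<bar>aD t - ?y t\<bar> \<le> exp (- cc * (t - s)) * (2 * R)" if t: "t \<in> {s..s0}" for t
    proof -
      have pa: "piece g s t aD" by (rule solution_on_piece[OF aD]) (use nearA t in auto)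
      have py: "piece g s t ?y" by (rule solution_on_piece[OF solution_on_sol]) (use dom t in auto)
      have uA: "u \<in> A" "u \<in> ?J" "\<bar>lam aD u - 1\<bar> \<le> 2 * \<eta>" "\<bar>lam ?y u - 1\<bar> \<le> 2 * \<eta>" if "u \<in> {s..t}" for u
      proof -
        have u: "u \<in> ?J" "s \<le> u" "u \<le> s0" using dom that t by auto
        show "u \<in> A" "u \<in> ?J" "\<bar>lam ?y u - 1\<bar> \<le> 2 * \<eta>" using nearA(2)[OF u(3)] near[OF u] u by auto
        show "\<bar>lam aD u - 1\<bar> \<le> 2 * \<eta>" using nearA(1)[OF u(3)] \<eta> by linarith
      qed
      have "\<bar>lam aD t - lam ?y t\<bar> \<le> exp (- cc * (t - s)) * 1"
      proof (cases "\<sigma> = \<delta>")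
        case True
        have le: "aD u \<le> ?y u" if "u \<in> {s..t}" for u
          by (rule solution_le_overlap[OF aD solution_on_sol _ in_sol_dom]) (use uA[OF that] nearA(2)[OF s] True \<delta> in \<open>auto simp: sol_initial\<close>)
        have "lam ?y t - lam aD t \<le> exp (- cc * (t - s)) * (lam ?y s - lam aD s)"
          by (rule contr[OF _ _ py pa]) (use le uA t s0 in auto)
        also have "\<dots> \<le> exp (- cc * (t - s)) * 1"
          using \<sigma>\<eta> \<eta> unfolding lys by (intro mult_left_mono) (auto simp: abs_le_iff)
        finally show ?thesis using le[of t] lam_less_iff[of ?y t aD] t by auto
      next
        case False
        then have \<sigma>: "\<sigma> = - \<delta>" using \<sigma> by auto
        have le: "?y u \<le> aD u" if "u \<in> {s..t}" for u
          by (rule solution_le_overlap[OF solution_on_sol aD in_sol_dom]) (use uA[OF that] nearA(2)[OF s] \<sigma> \<delta> in \<open>auto simp: sol_initial\<close>)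
        have "lam aD t - lam ?y t \<le> exp (- cc * (t - s)) * (lam aD s - lam ?y s)"
          by (rule contr[OF _ _ pa py]) (use le uA t s0 in auto)
        also have "\<dots> \<le> exp (- cc * (t - s)) * 1"
          using \<sigma>\<eta> \<eta> unfolding lys by (intro mult_left_mono) (auto simp: abs_le_iff)
        finally show ?thesis using le[of t] lam_less_iff[of aD t ?y] t by auto
      qed
      moreover have "aD t - ?y t = (lam aD t - lam ?y t) * (a t - r t)"
        using lam_eq[of aD t] lam_eq[of ?y t] by (simp add: left_diff_distrib)
      then have "\<bar>aD t - ?y t\<bar> = \<bar>lam aD t - lam ?y t\<bar> * \<bar>a t - r t\<bar>" by (simp add: abs_mult)
      ultimately show ?thesis using gap_pos[of t] gap_le[of t] by (simp add: mult_mono)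
    qed
    ultimately show ?thesis by blast
  qed
  have lim: "((\<lambda>s. \<bar>aD t - sol g s (aD s + \<sigma>) t\<bar>) \<longlongrightarrow> 0) at_bot" if \<sigma>: "\<sigma> \<in> {\<delta>, - \<delta>}" and t: "t \<le> s0" for \<sigma> t
  proof (rule Lim_null_comparison)
    show "eventually (\<lambda>s. norm \<bar>aD t - sol g s (aD s + \<sigma>) t\<bar> \<le> exp (- cc * (t - s)) * (2 * R)) at_bot"
      unfolding eventually_at_bot_linorder using main[OF \<sigma>] t by (intro exI[of _ t]) auto
    have "filterlim (\<lambda>s. - cc * (t - s)) at_bot at_bot"
      unfolding filterlim_at_bot eventually_at_bot_linorder
    proof (intro allI exI impI)
      fix Z s assume "s \<le> (Z + cc * t) / cc"
      then have "s * cc \<le> Z + cc * t" using \<eta> by (simp add: pos_le_divide_eq)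
      then show "- cc * (t - s) \<le> Z" by (simp add: algebra_simps)
    qed
    from tendsto_mult_left_zero[OF filterlim_compose[OF exp_at_bot this], of "2 * R"]
    show "((\<lambda>s. exp (- cc * (t - s)) * (2 * R)) \<longlongrightarrow> 0) at_bot" .
  qed
  show ?thesis
    unfolding locally_pullback_attractive_def
  proof (intro conjI)
    show "A = UNIV \<or> (\<exists>\<beta>. A = {..<\<beta>})" using up unfolding upper_past_solution_def by blast
    show "\<exists>s0\<in>A. \<exists>\<delta>>0. \<forall>\<sigma>\<in>{\<delta>, - \<delta>}. (\<forall>s\<le>s0. {s..s0} \<subseteq> sol_dom g s (aD s + \<sigma>)) \<and>
        (\<forall>t\<le>s0. ((\<lambda>s. \<bar>aD t - sol g s (aD s + \<sigma>) t\<bar>) \<longlongrightarrow> 0) at_bot)"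
    proof (intro bexI[of _ s0] exI[of _ \<delta>] conjI ballI allI impI \<delta>)
      show "s0 \<in> A" using Ta s0 by simp
    qed (use main lim in blast)+
  qed (rule aD)
qed

end

section \<open>The conditions (f1)--(f7)\<close>

lemma SUP_distinct_pairs_le:
  assumes "(SUP (x1, x2)\<in>distinct_pairs j. ereal (h x1 x2)) \<le> ereal l"
    and "u \<in> {- real j..real j}" "v \<in> {- real j..real j}" "u \<noteq> v"
  shows "h u v \<le> l"
proof -
  have "(u, v) \<in> distinct_pairs j" using assms(2-4) unfolding distinct_pairs_def by auto
  then have "(case (u, v) of (x1, x2) \<Rightarrow> ereal (h x1 x2)) \<le> (SUP (x1, x2)\<in>distinct_pairs j. ereal (h x1 x2))"
    by (rule SUP_upper)
  also note assms(1)
  finally show ?thesis by simp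
qed

lemma cond_f3_lipschitz:
  assumes "cond_f3 h"
  shows "\<exists>L\<ge>0. AE t in lebesgue. \<forall>u\<in>{- real j..real j}. \<forall>v\<in>{- real j..real j}. \<bar>h t u - h t v\<bar> \<le> L * \<bar>u - v\<bar>"
proof -
  obtain l where "AE t in lebesgue.
      (SUP (x1, x2)\<in>distinct_pairs j. ereal (\<bar>h t x2 - h t x1\<bar> / \<bar>x2 - x1\<bar>)) \<le> ereal l"
    using assms unfolding cond_f3_def by blast
  \<comment> \<open>For \<open>j = 0\<close> the supremum is over the empty set, so \<open>l\<close>
    may be negative.\<close>
  then have "AE t in lebesgue. \<forall>u\<in>{- real j..real j}. \<forall>v\<in>{- real j..real j}. \<bar>h t u - h t v\<bar> \<le> max l 0 * \<bar>u - v\<bar>"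
  proof eventually_elim
    case (elim t)
    show ?case
    proof (intro ballI)
      fix u v assume uv: "u \<in> {- real j..real j}" "v \<in> {- real j..real j}"
      show "\<bar>h t u - h t v\<bar> \<le> max l 0 * \<bar>u - v\<bar>"
      proof (cases "u = v")
        case False
        have "\<bar>h t u - h t v\<bar> / \<bar>u - v\<bar> \<le> l"
          using SUP_distinct_pairs_le[OF elim uv(2,1)] False by auto
        then have "\<bar>h t u - h t v\<bar> / \<bar>u - v\<bar> \<le> max l 0" by simp
        then show ?thesis using False by (simp add: pos_divide_le_eq)
      qed simp
    qed
  qed
  then show ?thesis by (intro exI[of _ "max l 0"]) simp
qed

lemma cond_f4_derivative:
  assumes "cond_f4 f"
  shows "AE t in lebesgue. \<forall>x. (f t has_real_derivative partial_x f t x) (at x)"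
  using assms unfolding cond_f4_def
proof eventually_elim
  case (elim t)
  show ?case
  proof
    fix x
    obtain D where "(f t has_vector_derivative D) (at x)" using elim unfolding C1_differentiable_on_def by blast
    then have d: "(f t has_real_derivative D) (at x)" by (simp add: has_real_derivative_iff_has_vector_derivative)
    then show "(f t has_real_derivative partial_x f t x) (at x)"
      unfolding partial_x_def using DERIV_imp_deriv[OF d] by simp
  qed
qed

lemma cond_f7_slope:
  assumes "cond_f7 f"
  shows "\<exists>\<delta>>0. AE t in lebesgue. \<forall>u\<in>{- real j..real j}. \<forall>v\<in>{- real j..real j}.
    u \<le> v \<longrightarrow> partial_x f t v - partial_x f t u \<le> - \<delta> * (v - u)"
proof -
  obtain \<delta> where \<delta>: "\<delta> > 0" and "AE t in lebesgue. (SUP (x1, x2)\<in>distinct_pairs j.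
      ereal ((partial_x f t x2 - partial_x f t x1) / (x2 - x1))) < ereal (- \<delta>)"
    using assms unfolding cond_f7_def by blast
  from this(2) have "AE t in lebesgue. \<forall>u\<in>{- real j..real j}. \<forall>v\<in>{- real j..real j}.
    u \<le> v \<longrightarrow> partial_x f t v - partial_x f t u \<le> - \<delta> * (v - u)"
  proof eventually_elim
    case (elim t)
    show ?case
    proof (intro ballI impI)
      fix u v assume uv: "u \<in> {- real j..real j}" "v \<in> {- real j..real j}" "u \<le> v"
      show "partial_x f t v - partial_x f t u \<le> - \<delta> * (v - u)"
      proof (cases "u = v")
        case False
        then have "(partial_x f t v - partial_x f t u) / (v - u) \<le> - \<delta>"
          using SUP_distinct_pairs_le[OF less_imp_le[OF elim] uv(1,2)] by auto
        then show ?thesis using False uv by (simp add: pos_divide_le_eq)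
      qed simp
    qed
  qed
  with \<delta> show ?thesis by blast
qed

lemma conditions_regular:
  assumes "conditions_f1_f7 f"
  shows "\<exists>K\<ge>0. \<exists>\<delta>>0. AE t in lebesgue. regular_on (f t) (partial_x f t) B K \<delta>"
proof -
  note c = assms[unfolded conditions_f1_f7_def]
  \<comment> \<open>The extra 1 keeps \<open>u + 1\<close> inside the ball for the mean value
    argument below.\<close>
  obtain j :: nat where j: "\<bar>B\<bar> + 1 \<le> real j" using real_arch_simple by blast
  obtain m where "AE t in lebesgue. (SUP x\<in>{- real j..real j}. ereal \<bar>f t x\<bar>) \<le> ereal m"
    using c unfolding cond_f2_def by blast
  then have m: "AE t in lebesgue. \<forall>x\<in>{- real j..real j}. \<bar>f t x\<bar> \<le> m"
    by eventually_elim (simp add: SUP_le_iff)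
  obtain L1 where L1: "L1 \<ge> 0" "AE t in lebesgue. \<forall>u\<in>{- real j..real j}. \<forall>v\<in>{- real j..real j}. \<bar>f t u - f t v\<bar> \<le> L1 * \<bar>u - v\<bar>"
    using cond_f3_lipschitz c by blast
  obtain L2 where L2: "L2 \<ge> 0" "AE t in lebesgue. \<forall>u\<in>{- real j..real j}. \<forall>v\<in>{- real j..real j}.
      \<bar>partial_x f t u - partial_x f t v\<bar> \<le> L2 * \<bar>u - v\<bar>"
    using cond_f3_lipschitz[of "partial_x f"] c unfolding cond_f5_def by blast
  obtain \<delta> where \<delta>: "\<delta> > 0" "AE t in lebesgue. \<forall>u\<in>{- real j..real j}. \<forall>v\<in>{- real j..real j}.
    u \<le> v \<longrightarrow> partial_x f t v - partial_x f t u \<le> - \<delta> * (v - u)"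
    using cond_f7_slope c by blast
  have f4: "AE t in lebesgue. \<forall>x. (f t has_real_derivative partial_x f t x) (at x)"
    using c by (intro cond_f4_derivative) simp
  \<comment> \<open>The derivative itself is not bounded by assumption. The mean value theorem on
    \<open>{u..u + 1}\<close> bounds it by \<open>2 * \<bar>m\<bar>\<close> at some point, and its
    Lipschitz constant \<open>L2\<close> transports this to \<open>u\<close>.\<close>
  define K where "K = 2 * \<bar>m\<bar> + L1 + L2"
  have "AE t in lebesgue. regular_on (f t) (partial_x f t) B K \<delta>"
    using m L1(2) L2(2) \<delta>(2) f4
  proof eventually_elim
    case (elim t)
    show ?case
      unfolding regular_on_def
    proof (intro ballI conjI impI)
      fix u assume u: "u \<in> {- B..B}"
      then have uj: "u \<in> {- real j..real j}" "u + 1 \<in> {- real j..real j}" using j by auto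
      have fm: "\<bar>f t u\<bar> \<le> m" "\<bar>f t (u + 1)\<bar> \<le> m" using elim(1) uj by blast+
      then show "\<bar>f t u\<bar> \<le> K" using L1 L2 unfolding K_def by linarith
      obtain z where z: "u < z" "z < u + 1" "f t (u + 1) - f t u = (u + 1 - u) * partial_x f t z"
        using MVT2[of u "u + 1" "f t" "partial_x f t"] elim(5) by auto
      have zj: "z \<in> {- real j..real j}" using z uj by auto
      have "\<bar>partial_x f t u - partial_x f t z\<bar> \<le> L2 * \<bar>u - z\<bar>" using elim(3) uj zj by blast
      also have "\<dots> \<le> L2 * 1" using z L2 by (intro mult_left_mono) auto
      finally show "\<bar>partial_x f t u\<bar> \<le> K" using z(3) fm L1 unfolding K_def by (simp add: abs_le_iff)
      fix v assume v: "v \<in> {- B..B}"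
      then have vj: "v \<in> {- real j..real j}" using j by auto
      have K: "L1 * \<bar>u - v\<bar> \<le> K * \<bar>u - v\<bar>" "L2 * \<bar>u - v\<bar> \<le> K * \<bar>u - v\<bar>"
        unfolding K_def using L1 L2 by (auto intro!: mult_right_mono)
      show "\<bar>f t u - f t v\<bar> \<le> K * \<bar>u - v\<bar>" using elim(2) uj vj K(1) by (meson order_trans)
      show "\<bar>partial_x f t u - partial_x f t v\<bar> \<le> K * \<bar>u - v\<bar>" using elim(3) uj vj K(2) by (meson order_trans)
      show "partial_x f t v - partial_x f t u \<le> - \<delta> * (v - u)" if "u \<le> v" using elim(4) uj vj that by blast
    qed
  qed
  moreover have "K \<ge> 0" using L1 L2 unfolding K_def by simp
  ultimately show ?thesis using \<delta>(1) by blast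
qed

lemma cond_f6_dissipation:
  assumes "cond_f6 f"
  shows "\<exists>\<rho>>0. \<exists>\<kappa>>0. AE t in lebesgue. \<forall>x. \<bar>x\<bar> \<ge> \<rho> \<longrightarrow> f t x \<le> - \<kappa> * x\<^sup>2"
proof -
  obtain S \<delta> where S: "- S \<in> null_sets lebesgue" and \<delta>: "\<delta> > 0"
    and top: "Limsup at_top (\<lambda>x. SUP t\<in>S. ereal (f t x / x\<^sup>2)) < ereal (- \<delta>)"
    and bot: "Limsup at_bot (\<lambda>x. SUP t\<in>S. ereal (f t x / x\<^sup>2)) < ereal (- \<delta>)"
    using assms unfolding cond_f6_def by blast
  obtain N1 where N1: "\<And>x. x \<ge> N1 \<Longrightarrow> (SUP t\<in>S. ereal (f t x / x\<^sup>2)) < ereal (- \<delta>)"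
    using Limsup_lessD[OF top] unfolding eventually_at_top_linorder by blast
  obtain N2 where N2: "\<And>x. x \<le> N2 \<Longrightarrow> (SUP t\<in>S. ereal (f t x / x\<^sup>2)) < ereal (- \<delta>)"
    using Limsup_lessD[OF bot] unfolding eventually_at_bot_linorder by blast
  \<comment> \<open>Beyond both thresholds; the 1 excludes \<open>x = 0\<close> for the division by
    the square.\<close>
  define \<rho> where "\<rho> = \<bar>N1\<bar> + \<bar>N2\<bar> + 1"
  have "AE t in lebesgue. t \<in> S" using AE_not_in[OF S] by simp
  then have "AE t in lebesgue. \<forall>x. \<bar>x\<bar> \<ge> \<rho> \<longrightarrow> f t x \<le> - \<delta> * x\<^sup>2"
  proof eventually_elim
    case (elim t)
    show ?case
    proof (intro allI impI)
      fix x assume x: "\<bar>x\<bar> \<ge> \<rho>"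
      have "x \<ge> N1 \<or> x \<le> N2" using x unfolding \<rho>_def by linarith
      then have "(SUP t\<in>S. ereal (f t x / x\<^sup>2)) < ereal (- \<delta>)" using N1 N2 by blast
      moreover have "ereal (f t x / x\<^sup>2) \<le> (SUP t\<in>S. ereal (f t x / x\<^sup>2))" using elim by (rule SUP_upper)
      ultimately have "ereal (f t x / x\<^sup>2) < ereal (- \<delta>)" by (rule le_less_trans[rotated])
      then have "f t x / x\<^sup>2 \<le> - \<delta>" by simp
      moreover have "x\<^sup>2 > 0" using x unfolding \<rho>_def by auto
      ultimately show "f t x \<le> - \<delta> * x\<^sup>2" by (simp add: pos_divide_le_eq)
    qed
  qed
  moreover have "\<rho> > 0" unfolding \<rho>_def by simp
  ultimately show ?thesis using \<delta> by blast
qed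

lemma conditions_concave_equation:
  assumes "conditions_f1_f7 f"
  shows "\<exists>\<rho> \<kappa>. concave_equation f (partial_x f) \<rho> \<kappa>"
proof -
  note c = assms[unfolded conditions_f1_f7_def]
  obtain \<rho> \<kappa> where \<rho>: "\<rho> > 0" "\<kappa> > 0" "AE t in lebesgue. \<forall>x. \<bar>x\<bar> \<ge> \<rho> \<longrightarrow> f t x \<le> - \<kappa> * x\<^sup>2"
    using cond_f6_dissipation c by blast
  have "concave_equation f (partial_x f) \<rho> \<kappa>"
  proof
    fix x :: "real \<Rightarrow> real" assume x: "x \<in> borel_measurable lebesgue"
    have "(\<lambda>t. t) \<in> borel_measurable lebesgue" by (simp add: measurable_completion)
    \<comment> \<open>A Borel function of two variables composed with a Lebesgue measurable curve is
      Lebesgue measurable; joint Lebesgue measurability would not be enough here.\<close>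
    then have "(\<lambda>t. (t, x t)) \<in> borel_measurable lebesgue" using x by (rule borel_measurable_Pair)
    moreover have "(\<lambda>(t, x). f t x) \<in> borel_measurable borel" using c unfolding cond_f1_def by blast
    ultimately have "(\<lambda>t. (\<lambda>(t, x). f t x) (t, x t)) \<in> borel_measurable lebesgue" by (rule measurable_compose)
    then show "(\<lambda>t. f t (x t)) \<in> borel_measurable lebesgue" by simp
  next
    show "AE t in lebesgue. \<forall>x. (f t has_real_derivative partial_x f t x) (at x)"
      using c by (intro cond_f4_derivative) simp
  qed (use \<rho> conditions_regular[OF assms] in auto)
  then show ?thesis by blast
qed

section \<open>The equation in the future\<close>

lemma shifted_rev_field: "shifted (rev_field f) (rv \<Delta>) = rev_field (shifted f \<Delta>)"
  unfolding shifted_def rev_field_def rv_def by (auto intro!: ext arg_cong[where f = "f _"])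

context past_perturbation
begin

text \<open>Reversal exchanges the two reference solutions: \<open>rv r\<close> lies above
  \<open>rv a\<close>. The derivative of the field changes sign and so does its argument, hence it
  is again strictly decreasing with the same modulus.\<close>

lemma past_perturbation_rev_field:
  assumes top: "(\<Delta> \<longlongrightarrow> \<delta>p) at_top"
  shows "past_perturbation (rev_field f) (\<lambda>t x. - fx (- t) (- x)) \<rho>0 \<kappa>0 (rv \<Delta>) (rv r) (rv a) (- \<delta>p) M d0 R"
proof -
  have r: "dissipative (rev_field f) \<rho>0 \<kappa>0" by (rule F.dissipative_rev_field)
  interpret RF: dissipative "rev_field f" \<rho>0 \<kappa>0 by (rule r)
  show ?thesis
  proof
    show "AE t in lebesgue. \<forall>x. (rev_field f t has_real_derivative - fx (- t) (- x)) (at x)"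
      using AE_lebesgue_reflect[OF f_derivative]
    proof eventually_elim
      case (elim t)
      show ?case
      proof
        fix x
        have "((\<lambda>x. f (- t) (- x)) has_real_derivative fx (- t) (- x) * (- 1)) (at x)"
          by (rule DERIV_chain2[OF elim[rule_format]]) (auto intro!: derivative_eq_intros)
        then show "(rev_field f t has_real_derivative - fx (- t) (- x)) (at x)"
          unfolding rev_field_def[abs_def] by simp
      qed
    qed
  next
    fix B
    obtain K \<delta> where K: "K \<ge> 0" "\<delta> > 0" and ae: "AE t in lebesgue. regular_on (f t) (fx t) B K \<delta>"
      using f_regular[of B] by blast
    note ae = ae[unfolded regular_on_def]
    have "AE t in lebesgue. regular_on (rev_field f t) (\<lambda>x. - fx (- t) (- x)) B K \<delta>"
      using AE_lebesgue_reflect[OF ae]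
    proof eventually_elim
      case (elim t)
      show ?case
        unfolding regular_on_def
      proof (intro ballI conjI impI)
        fix u assume u: "u \<in> {- B..B}"
        then have u': "- u \<in> {- B..B}" by auto
        show "\<bar>rev_field f t u\<bar> \<le> K" "\<bar>- fx (- t) (- u)\<bar> \<le> K"
          using elim u' unfolding rev_field_def by simp_all
        fix v assume v: "v \<in> {- B..B}"
        then have v': "- v \<in> {- B..B}" by auto
        have *: "\<bar>f (- t) (- u) - f (- t) (- v)\<bar> \<le> K * \<bar>- u - - v\<bar>"
          "\<bar>fx (- t) (- u) - fx (- t) (- v)\<bar> \<le> K * \<bar>- u - - v\<bar>" using elim u' v' by blast+
        have e: "\<bar>- u - - v\<bar> = \<bar>u - v\<bar>" by linarith
        show "\<bar>rev_field f t u - rev_field f t v\<bar> \<le> K * \<bar>u - v\<bar>"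
          using *(1) unfolding rev_field_def e .
        show "\<bar>- fx (- t) (- u) - - fx (- t) (- v)\<bar> \<le> K * \<bar>u - v\<bar>"
          using *(2) unfolding e by linarith
        assume "u \<le> v"
        then have "- v \<le> - u" by simp
        then have "fx (- t) (- u) - fx (- t) (- v) \<le> - \<delta> * (- u - - v)" using elim u' v' by blast
        then show "- fx (- t) (- v) - - fx (- t) (- u) \<le> - \<delta> * (v - u)" by simp
      qed
    qed
    then show "\<exists>K\<ge>0. \<exists>\<delta>>0. AE t in lebesgue. regular_on (rev_field f t) (\<lambda>x. - fx (- t) (- x)) B K \<delta>"
      using K by blast
  next
    show "rv \<Delta> \<in> borel_measurable lebesgue"
      unfolding rv_def[abs_def] using measurable_lebesgue_reflect[OF \<Delta>_measurable] by (rule borel_measurable_uminus)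
    show "AE t in lebesgue. \<bar>rv \<Delta> t\<bar> \<le> M"
      using AE_lebesgue_reflect[OF \<Delta>_bounded] unfolding rv_def by simp
    show "(rv \<Delta> \<longlongrightarrow> - \<delta>p) at_bot"
      unfolding filterlim_at_bot_mirror rv_def using top by (simp add: tendsto_minus)
    show "solution_on (rev_field f) UNIV (rv r)" "solution_on (rev_field f) UNIV (rv a)"
      using F.solution_on_rv[OF r_solution] F.solution_on_rv[OF a_solution] by simp_all
    show "\<bar>rv r t\<bar> \<le> R" "\<bar>rv a t\<bar> \<le> R" "rv r t - rv a t \<ge> d0" for t
      using r_bounded[of "- t"] a_bounded[of "- t"] separated[of "- t"] unfolding rv_def by auto
  qed (fact RF.superposition_measurable RF.dissipation \<rho>0 \<kappa>0 M d0)+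
qed

end

context caratheodory
begin

lemma locally_pullback_repulsive_rv:
  assumes pb: "locally_pullback_attractive (rev_field g) (uminus ` J) (rv r)"
  shows "locally_pullback_repulsive g J r"
proof -
  obtain s0 \<delta> where s0: "s0 \<in> uminus ` J" and \<delta>: "\<delta> > 0"
    and dom: "\<And>\<sigma> s. \<sigma> \<in> {\<delta>, - \<delta>} \<Longrightarrow> s \<le> s0 \<Longrightarrow> {s..s0} \<subseteq> sol_dom (rev_field g) s (rv r s + \<sigma>)"
    and lim: "\<And>\<sigma> t. \<sigma> \<in> {\<delta>, - \<delta>} \<Longrightarrow> t \<le> s0 \<Longrightarrow>
        ((\<lambda>s. \<bar>rv r t - sol (rev_field g) s (rv r s + \<sigma>) t\<bar>) \<longlongrightarrow> 0) at_bot"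
    using pb unfolding locally_pullback_attractive_def by blast
  have J: "J = UNIV \<or> (\<exists>\<alpha>. J = {\<alpha><..})"
    using pb unfolding locally_pullback_attractive_def
    by (metis image_uminus_greaterThan image_uminus_lessThan surj_uminus uminus_uminus_image)
  have sol: "solution_on g J r"
    using pb solution_on_rv_iff unfolding locally_pullback_attractive_def by blast
  have eq: "rv r (- s) + - \<sigma> = - (r s + \<sigma>)" for s \<sigma> unfolding rv_def by simp
  have dom': "{- s0..s} \<subseteq> sol_dom g s (r s + \<sigma>)" if \<sigma>: "\<sigma> \<in> {\<delta>, - \<delta>}" and s: "s \<ge> - s0" for \<sigma> s
  proof -
    have "- \<sigma> \<in> {\<delta>, - \<delta>}" "- s \<le> s0" using \<sigma> s by auto
    from dom[OF this] have "{- s..s0} \<subseteq> uminus ` sol_dom g s (r s + \<sigma>)" unfolding eq sol_rev_field(1) .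
    from image_mono[OF this, of uminus] show ?thesis by simp
  qed
  have lim': "((\<lambda>s. \<bar>r t - sol g s (r s + \<sigma>) t\<bar>) \<longlongrightarrow> 0) at_top" if \<sigma>: "\<sigma> \<in> {\<delta>, - \<delta>}" and t: "t \<ge> - s0" for \<sigma> t
  proof -
    have "- \<sigma> \<in> {\<delta>, - \<delta>}" "- t \<le> s0" using \<sigma> t by auto
    from lim[OF this]
    have "((\<lambda>s. \<bar>rv r (- t) - sol (rev_field g) (- s) (rv r (- s) + - \<sigma>) (- t)\<bar>) \<longlongrightarrow> 0) at_top"
      unfolding filterlim_at_bot_mirror .
    moreover have "eventually (\<lambda>s. \<bar>rv r (- t) - sol (rev_field g) (- s) (rv r (- s) + - \<sigma>) (- t)\<bar> =
        \<bar>r t - sol g s (r s + \<sigma>) t\<bar>) at_top"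
      unfolding eventually_at_top_linorder
    proof (intro exI[of _ t] allI impI)
      fix s assume "t \<le> s"
      then have "t \<in> sol_dom g s (r s + \<sigma>)" using dom'[OF \<sigma>, of s] t by auto
      then have "sol (rev_field g) (- s) (rv r (- s) + - \<sigma>) (- t) = - sol g s (r s + \<sigma>) t"
        unfolding eq by (rule sol_rev_field(2))
      then show "\<bar>rv r (- t) - sol (rev_field g) (- s) (rv r (- s) + - \<sigma>) (- t)\<bar> = \<bar>r t - sol g s (r s + \<sigma>) t\<bar>"
        unfolding rv_def by simp
    qed
    ultimately show ?thesis by (simp add: tendsto_cong)
  qed
  have "- s0 \<in> J" using s0 by auto
  then show ?thesis
    unfolding locally_pullback_repulsive_def using J sol \<delta> dom' lim' by blast
qed

end

locale transition = past_perturbation +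
  fixes \<delta>p :: real
  assumes \<Delta>_limit_future: "(\<Delta> \<longlongrightarrow> \<delta>p) at_top"
begin

text \<open>Every result on the past is available for the reversed equation under
  \<open>Rev\<close>, and reads as a result on the future.\<close>

sublocale Rev: past_perturbation "rev_field f" "\<lambda>t x. - fx (- t) (- x)" \<rho>0 \<kappa>0 "rv \<Delta>" "rv r" "rv a" "- \<delta>p" M d0 R
  by (rule past_perturbation_rev_field[OF \<Delta>_limit_future])

lemma lower_future_solution_iff:
  "lower_future_solution g J rD \<longleftrightarrow> upper_past_solution Rev.g (uminus ` J) (rv rD)"
  unfolding shifted_rev_field by (rule upper_past_solution_rv[symmetric])

lemma lower_future_solution_exists: "\<exists>J rD. lower_future_solution g J rD"
proof -
  obtain A aD where "upper_past_solution Rev.g A aD" using Rev.perturbed_upper_past_solution_exists by blast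
  then have "lower_future_solution g (uminus ` A) (rv aD)" unfolding lower_future_solution_iff by simp
  then show ?thesis by blast
qed

lemma lower_future_solution_limit:
  assumes "lower_future_solution g J rD"
  shows "((\<lambda>t. \<bar>rD t - (r t + \<delta>p)\<bar>) \<longlongrightarrow> 0) at_top"
proof -
  have "((\<lambda>t. \<bar>rv rD t - (rv r t + - \<delta>p)\<bar>) \<longlongrightarrow> 0) at_bot"
    using assms unfolding lower_future_solution_iff by (rule Rev.upper_past_solution_limit)
  then have "((\<lambda>t. \<bar>- rD t - (- r t + - \<delta>p)\<bar>) \<longlongrightarrow> 0) at_top"
    unfolding filterlim_at_bot_mirror rv_def by simp
  moreover have "\<bar>- rD t - (- r t + - \<delta>p)\<bar> = \<bar>rD t - (r t + \<delta>p)\<bar>" for t by linarith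
  ultimately show ?thesis by (simp only:)
qed

lemma future_solution_limit:
  assumes low: "lower_future_solution g J rD" and s: "s \<in> J" and x0: "x0 > rD s"
  shows "((\<lambda>t. \<bar>sol g s x0 t - (a t + \<delta>p)\<bar>) \<longlongrightarrow> 0) at_top"
proof -
  have "((\<lambda>t. \<bar>sol Rev.g (- s) (- x0) t - (rv a t + - \<delta>p)\<bar>) \<longlongrightarrow> 0) at_bot"
    by (rule Rev.past_solution_limit[OF low[unfolded lower_future_solution_iff]]) (use s x0 in \<open>auto simp: rv_def\<close>)
  then have "((\<lambda>t. \<bar>sol (rev_field g) (- s) (- x0) (- t) - (rv a (- t) + - \<delta>p)\<bar>) \<longlongrightarrow> 0) at_top"
    unfolding filterlim_at_bot_mirror shifted_rev_field .
  moreover have "eventually (\<lambda>t. \<bar>sol (rev_field g) (- s) (- x0) (- t) - (rv a (- t) + - \<delta>p)\<bar> =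
      \<bar>sol g s x0 t - (a t + \<delta>p)\<bar>) at_top"
  proof -
    \<comment> \<open>The reversal formula for \<open>sol\<close> holds on the domain only, which
      therefore has to contain a future half-line.\<close>
    have "bounded_in_future (sol_dom g s x0) (sol g s x0)"
      using low s x0 unfolding lower_future_solution_def by auto
    then obtain T where T: "{T..} \<subseteq> sol_dom g s x0" unfolding bounded_in_future_def by blast
    show ?thesis
      unfolding eventually_at_top_linorder
    proof (intro exI[of _ T] allI impI)
      fix t assume "T \<le> t"
      then have "sol (rev_field g) (- s) (- x0) (- t) = - sol g s x0 t" using T by (intro sol_rev_field(2)) auto
      then show "\<bar>sol (rev_field g) (- s) (- x0) (- t) - (rv a (- t) + - \<delta>p)\<bar> = \<bar>sol g s x0 t - (a t + \<delta>p)\<bar>"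
        unfolding rv_def by simp
    qed
  qed
  ultimately show ?thesis by (simp add: tendsto_cong)
qed

lemma lower_future_solution_pullback:
  assumes "lower_future_solution g J rD"
  shows "locally_pullback_repulsive g J rD"
  using Rev.upper_past_solution_pullback[OF assms[unfolded lower_future_solution_iff]]
  unfolding shifted_rev_field by (rule locally_pullback_repulsive_rv)

lemma lower_future_solution_UNIV:
  assumes "lower_future_solution g J rD" and x: "solution_on g UNIV x"
  shows "J = UNIV" and "\<And>t. rD t \<le> x t"
proof -
  have "solution_on Rev.g UNIV (rv x)" using solution_on_rv[OF x] unfolding shifted_rev_field by simp
  note u = Rev.upper_past_solution_UNIV[OF assms(1)[unfolded lower_future_solution_iff] this]
  show "J = UNIV" using u(1) by (metis surj_uminus uminus_uminus_image)
  show "rD t \<le> x t" for t using u(2)[of "- t"] by (simp add: rv_def)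
qed

text \<open>A global past bounds from above; a global future bounds from below, by reversal. So
  every global solution is bounded.\<close>

lemma global_solution_bounded:
  assumes x: "solution_on g UNIV x"
  shows "\<bar>x t\<bar> \<le> \<rho>0 + 2 * M"
proof -
  have "solution_on Rev.g UNIV (rv x)" using solution_on_rv[OF x] unfolding shifted_rev_field by simp
  from Rev.past_solution_le[OF this, of "- t"] past_solution_le[OF x, of t]
  show ?thesis by (simp add: rv_def)
qed

end


section \<open>Hyperbolicity\<close>

text \<open>The derivative along \<open>y\<close> is the limit of difference quotients with
  increments 1 / (n + 1), up to the null set where \<open>h t\<close> fails to be
  differentiable.\<close>

lemma derivative_measurable:
  fixes h hx :: "real \<Rightarrow> real \<Rightarrow> real"
  assumes meas: "\<And>x. x \<in> borel_measurable lebesgue \<Longrightarrow> (\<lambda>t. h t (x t)) \<in> borel_measurable lebesgue"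
    and der: "AE t in lebesgue. \<forall>x. (h t has_real_derivative hx t x) (at x)"
    and y: "y \<in> borel_measurable lebesgue"
  shows "(\<lambda>t. hx t (y t)) \<in> borel_measurable lebesgue"
proof -
  define q where "q n t = (h t (y t + inverse (real (Suc n))) - h t (y t)) / inverse (real (Suc n))" for n t
  have "q n \<in> borel_measurable lebesgue" for n
    unfolding q_def using y
    by (intro borel_measurable_divide borel_measurable_diff borel_measurable_const meas borel_measurable_add)
  then have "(\<lambda>t. lim (\<lambda>n. q n t)) \<in> borel_measurable lebesgue" by (rule borel_measurable_lim_metric)
  moreover have "AE t in lebesgue. lim (\<lambda>n. q n t) = hx t (y t)"
    using der
  proof eventually_elim
    case (elim t)
    have "((\<lambda>e. (h t (y t + e) - h t (y t)) / e) \<longlongrightarrow> hx t (y t)) (at 0)"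
      using elim by (intro DERIV_D) blast
    then have "(\<lambda>n. q n t) \<longlonglongrightarrow> hx t (y t)"
      unfolding q_def using LIMSEQ_inverse_real_of_nat
      by (simp add: LIMSEQ_SEQ_conv[symmetric])
    then show ?case by (rule limI)
  qed
  ultimately show ?thesis by (rule borel_measurable_AE)
qed

lemma (in caratheodory) global_solution_measurable:
  assumes "solution_on g UNIV x"
  shows "x \<in> borel_measurable lebesgue"
proof -
  have "isCont x t" for t
  proof -
    have "continuous_on {t - 1..t + 1} x" using solution_on_continuous[OF assms] by simp
    then show ?thesis by (rule continuous_on_interior) simp
  qed
  then have "continuous_on UNIV x" by (simp add: continuous_at_imp_continuous_on)
  then have "x \<in> borel_measurable borel" by (rule borel_measurable_continuous_onI)
  then show ?thesis by (simp add: measurable_completion)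
qed

lemma interval_integral_lebesgue:
  fixes p :: "real \<Rightarrow> real"
  assumes p: "p \<in> borel_measurable lebesgue" and K: "AE t in lebesgue. \<bar>p t\<bar> \<le> K" and st: "s \<le> t"
  shows "(LINT l=ereal s..ereal t|lebesgue. p l) = integral {s..t} p"
proof -
  have "set_integrable lebesgue {s<..<t} p"
    unfolding set_integrable_def
    by (rule integrableI_bounded_set_indicator[OF _ p, of _ K])
      (use K in \<open>auto simp: emeasure_lborel_Ioo st elim!: eventually_mono\<close>)
  then have "(LINT x:{s<..<t}|lebesgue. p x) = integral {s<..<t} p" by (rule set_lebesgue_integral_eq_integral)
  then show ?thesis
    using st unfolding interval_lebesgue_integral_def integral_open_interval_real by simp
qed

lemma interval_integral_lebesgue_reverse:
  assumes "t \<le> s"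
  shows "(LINT l=ereal s..ereal t|lebesgue. p l) = - (LINT l=ereal t..ereal s|lebesgue. p l)"
  using assms unfolding interval_lebesgue_integral_def
  by (cases "s = t") (auto simp: set_lebesgue_integral_def)

text \<open>The product of the two exponentials is 1, while the product of the bounds is
  \<open>k1 * k2 * exp (- (k1 * k2))\<close>, which is less than 1. The exponents are to be made to
  add up to \<open>k1 * k2\<close> through the length of the time interval.\<close>

lemma exp_product_contradiction:
  fixes I k1 k2 \<beta> :: real
  assumes "k1 \<ge> 1" "k2 \<ge> 1" "exp I \<le> k1 * exp (- \<beta>1)" "exp (- I) \<le> k2 * exp (- \<beta>2)" "\<beta>1 + \<beta>2 = k1 * k2"
  shows False
proof -
  have "exp I * exp (- I) \<le> (k1 * exp (- \<beta>1)) * (k2 * exp (- \<beta>2))" using assms by (intro mult_mono) auto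
  also have "\<dots> = k1 * k2 * (exp (- \<beta>1) * exp (- \<beta>2))" by (simp add: mult_ac)
  also have "exp (- \<beta>1) * exp (- \<beta>2) = exp (- (k1 * k2))"
    unfolding assms(5)[symmetric] exp_add[symmetric] by simp
  finally have "1 \<le> k1 * k2 * exp (- (k1 * k2))" by (simp flip: exp_add)
  then have "exp (k1 * k2) \<le> k1 * k2" by (simp add: exp_minus field_simps)
  then show False using exp_ge_add_one_self[of "k1 * k2"] by linarith
qed

text \<open>Needed to see that the two members of an attractor-repeller pair are different
  functions.\<close>

lemma not_attractive_and_repulsive:
  assumes "hyperbolic_attractive g b" "hyperbolic_repulsive g b"
  shows False
proof -
  obtain k1 \<beta>1 where 1: "k1 \<ge> 1" "\<beta>1 > 0" "\<And>s t. t \<ge> s \<Longrightarrow>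
        exp (LINT l=ereal s..ereal t|lebesgue. partial_x g l (b l)) \<le> k1 * exp (- \<beta>1 * (t - s))"
    using assms(1) unfolding hyperbolic_attractive_def by blast
  obtain k2 \<beta>2 where 2: "k2 \<ge> 1" "\<beta>2 > 0" "\<And>s t. t \<le> s \<Longrightarrow>
        exp (LINT l=ereal s..ereal t|lebesgue. partial_x g l (b l)) \<le> k2 * exp (\<beta>2 * (t - s))"
    using assms(2) unfolding hyperbolic_repulsive_def by blast
  define \<tau> where "\<tau> = k1 * k2 / (\<beta>1 + \<beta>2)"
  have \<tau>: "\<tau> > 0" "\<beta>1 * \<tau> + \<beta>2 * \<tau> = k1 * k2"
  proof -
    have p: "\<beta>1 + \<beta>2 > 0" using 1 2 by simp
    show "\<tau> > 0" unfolding \<tau>_def using p 1 2 by (intro divide_pos_pos mult_pos_pos) auto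
    have "(\<beta>1 + \<beta>2) * \<tau> = k1 * k2" unfolding \<tau>_def using p by simp
    then show "\<beta>1 * \<tau> + \<beta>2 * \<tau> = k1 * k2" by (simp only: distrib_right)
  qed
  let ?I = "LINT l=ereal 0..ereal \<tau>|lebesgue. partial_x g l (b l)"
  have "exp ?I \<le> k1 * exp (- (\<beta>1 * \<tau>))" using 1(3)[of 0 \<tau>] \<tau> by simp
  moreover have "exp (- ?I) \<le> k2 * exp (- (\<beta>2 * \<tau>))"
    using 2(3)[of 0 \<tau>] \<tau> interval_integral_lebesgue_reverse[of 0 \<tau> "\<lambda>l. partial_x g l (b l)"] by simp
  ultimately show False using exp_product_contradiction[OF 1(1) 2(1) _ _ \<tau>(2)] by blast
qed

lemma integral_bound_AE:
  fixes p :: "real \<Rightarrow> real"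
  assumes p: "p \<in> borel_measurable lebesgue" and K: "AE t in lebesgue. \<bar>p t\<bar> \<le> K" and st: "s \<le> t"
  shows "\<bar>integral {s..t} p\<bar> \<le> K * (t - s)"
proof -
  have i: "(p has_integral integral {s..t} p) {s..t}" using bounded_measurable_integrable[OF p K] by blast
  have c: "((\<lambda>_. k) has_integral (t - s) * k) {s..t}" for k
    using has_integral_const_real[of k s t] st by simp
  have "integral {s..t} p \<le> (t - s) * K"
    by (rule has_integral_AE_le[OF i c]) (use K in eventually_elim, auto)
  moreover have "(t - s) * (- K) \<le> integral {s..t} p"
    by (rule has_integral_AE_le[OF c i]) (use K in eventually_elim, auto)
  ultimately show ?thesis by (simp add: abs_le_iff algebra_simps)
qed

text \<open>If \<open>a - r\<close> were small at \<open>s\<close>, then attraction to \<open>a\<close> would keep it small from then on, and the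
  derivatives along \<open>a\<close> and along \<open>r\<close> would be too close to have means of opposite signs.\<close>

lemma attractor_repeller_separated:
  assumes eq: "concave_equation f (partial_x f) \<rho> \<kappa>" and pair: "attractor_repeller_pair f a r"
  shows "\<exists>d0>0. \<forall>t. a t - r t \<ge> d0"
proof -
  interpret concave_equation f "partial_x f" \<rho> \<kappa> by (rule eq)
  have up: "upper_past_solution f UNIV a" and att: "hyperbolic_attractive f a" and rep: "hyperbolic_repulsive f r"
    using pair unfolding attractor_repeller_pair_def by auto
  have sa: "solution_on f UNIV a" "bounded (range a)" and sr: "solution_on f UNIV r" "bounded (range r)"
    using att rep unfolding hyperbolic_attractive_def hyperbolic_repulsive_def bounded_solution_def by auto
  have ra: "r t \<le> a t" for t by (rule F.upper_past_solution_UNIV(2)[OF up sr(1)])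
  obtain Ra Rr where Ra: "\<And>t. \<bar>a t\<bar> \<le> Ra" and Rr: "\<And>t. \<bar>r t\<bar> \<le> Rr"
    using sa(2) sr(2) unfolding bounded_iff by auto
  define R where "R = max Ra Rr"
  have R: "a t \<in> {- R..R}" "r t \<in> {- R..R}" for t
    using Ra[of t] Rr[of t] unfolding R_def by (auto simp: abs_le_iff)
  obtain K \<delta> where K: "K \<ge> 0" and ae: "AE t in lebesgue. regular_on (f t) (partial_x f t) R K \<delta>"
    using f_regular[of R] by blast
  note ae = ae[unfolded regular_on_def]
  define pa where "pa l = partial_x f l (a l)" for l
  define pr where "pr l = partial_x f l (r l)" for l
  have pam: "pa \<in> borel_measurable lebesgue" and prm: "pr \<in> borel_measurable lebesgue"
    unfolding pa_def pr_def
    by (rule derivative_measurable[OF f_measurable f_derivative]; simp add: F.global_solution_measurable sa sr)+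
  have paK: "AE t in lebesgue. \<bar>pa t\<bar> \<le> K" and prK: "AE t in lebesgue. \<bar>pr t\<bar> \<le> K"
    using ae unfolding pa_def pr_def by (eventually_elim, use R in blast)+
  obtain k1 \<beta>1 where 1: "k1 \<ge> 1" "\<beta>1 > 0" and
    att': "\<And>s t. t \<ge> s \<Longrightarrow> exp (LINT l=ereal s..ereal t|lebesgue. partial_x f l (a l)) \<le> k1 * exp (- \<beta>1 * (t - s))"
    using att unfolding hyperbolic_attractive_def by blast
  obtain k2 \<beta>2 where 2: "k2 \<ge> 1" "\<beta>2 > 0" and
    rep': "\<And>s t. t \<le> s \<Longrightarrow> exp (LINT l=ereal s..ereal t|lebesgue. partial_x f l (r l)) \<le> k2 * exp (\<beta>2 * (t - s))"
    using rep unfolding hyperbolic_repulsive_def by blast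
  have A: "exp (integral {s..t} pa) \<le> k1 * exp (- \<beta>1 * (t - s))" if "s \<le> t" for s t
    using att'[OF that] interval_integral_lebesgue[OF pam paK that] unfolding pa_def by simp
  have Rp: "exp (- integral {s..t} pr) \<le> k2 * exp (- (\<beta>2 * (t - s)))" if "s \<le> t" for s t
    using rep'[OF that] interval_integral_lebesgue[OF prm prK that] interval_integral_lebesgue_reverse[OF that, of "\<lambda>l. partial_x f l (r l)"]
    unfolding pr_def by (simp add: algebra_simps)
  \<comment> \<open>Within distance \<eta> the derivative of the field varies by at most half of the
    attraction exponent.\<close>
  define \<eta> where "\<eta> = \<beta>1 / (2 * (K + 1))"
  have \<eta>: "\<eta> > 0" "K * \<eta> \<le> \<beta>1 / 2" using 1 K unfolding \<eta>_def by (auto simp: field_simps)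
  \<comment> \<open>The factor \<open>k1\<close> leaves room for the transient growth that the
    attraction estimate permits.\<close>
  have "a s - r s \<ge> \<eta> / k1" for s
  proof (rule ccontr)
    assume n: "\<not> a s - r s \<ge> \<eta> / k1"
    define d where "d t = a t - r t" for t
    have d0: "d t \<ge> 0" for t using ra unfolding d_def by simp
    define P where "P t = integral {s..t} pa" for t
    \<comment> \<open>Integrating factor of the linearization along \<open>a\<close>, with half of
      the exponent given away for the nonlinearity.\<close>
    define E where "E t = exp (0 - P t - \<beta>1 / 2 * (t - s))" for t
    have Epos: "E u > 0" for u unfolding E_def by simp
    have E1: "1 / E u \<le> k1 * exp (- (\<beta>1 / 2 * (u - s)))" if "s \<le> u" for u
    proof -
      have "1 / E u = exp (P u) * exp (\<beta>1 / 2 * (u - s))"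
      proof -
        have "(exp (P u) * exp (\<beta>1 / 2 * (u - s))) * E u = 1"
          unfolding E_def by (simp flip: exp_add)
        then show ?thesis using Epos[of u] by (simp add: field_simps)
      qed
      also have "\<dots> \<le> (k1 * exp (- \<beta>1 * (u - s))) * exp (\<beta>1 / 2 * (u - s))"
        unfolding P_def using A[OF that] by (intro mult_right_mono) auto
      also have "\<dots> = k1 * exp (- (\<beta>1 / 2 * (u - s)))"
        by (simp add: mult.assoc flip: exp_add)
      finally show ?thesis .
    qed
    have decay: "d t * E t \<le> d s" if st: "s \<le> t" for t
    proof -
      have lP: "lip_on s t P"
      proof (rule lip_onI[where L = K])
        fix u v assume uv: "s \<le> u" "u < v" "v \<le> t"
        have "integral {s..u} pa + integral {u..v} pa = integral {s..v} pa"
          using uv by (intro Henstock_Kurzweil_Integration.integral_combine bounded_measurable_integrable[OF pam paK]) auto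
        then show "\<bar>P v - P u\<bar> \<le> K * (v - u)"
          using integral_bound_AE[OF pam paK, of u v] uv unfolding P_def by simp
      qed
      have ld: "lip_on s t d" unfolding d_def
        using F.solution_on_lip_on[OF sa(1)] F.solution_on_lip_on[OF sr(1)] by (intro lip_on_diff) auto
      have lE: "lip_on s t E" unfolding E_def
        by (intro lip_on_exp lip_on_diff lip_on_mult lip_on_const lip_on_ident lP)
      have dP: "AE u in lebesgue. \<forall>c<u. ((\<lambda>u. integral {c..u} pa) has_real_derivative pa u) (at u)"
        using bounded_measurable_integrable[OF pam paK] by (rule integral_derivative_AE)
      \<comment> \<open>A bootstrap: the product is nonincreasing only where
        \<open>d \<le> \<eta>\<close>, and this holds as long as the product is below
        \<open>\<eta> / k1\<close>. The barrier lemma asks for no more than that strip.\<close>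
      have "d t * E t - d s \<le> 0"
      proof (rule lip_on_barrier[OF st, where w = "\<lambda>u. d u * E u - d s" and h = "\<eta> / k1 - d s"])
        show "lip_on s t (\<lambda>u. d u * E u - d s)" using ld lE by (intro lip_on_intros)
        show "d s * E s - d s \<le> 0" unfolding E_def P_def by simp
        show "\<eta> / k1 - d s > 0" using n unfolding d_def by simp
        have "piece f s t a" "piece f s t r" using F.solution_on_piece[OF sa(1)] F.solution_on_piece[OF sr(1)] by auto
        from this[THEN piece_derivative] dP ae f_derivative
        show "AE u in lebesgue. u \<in> {s<..<t} \<longrightarrow> 0 < d u * E u - d s \<longrightarrow> d u * E u - d s < \<eta> / k1 - d s \<longrightarrow>
            (\<exists>D\<le>0. ((\<lambda>u. d u * E u - d s) has_real_derivative D) (at u))"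
        proof eventually_elim
          case (elim u)
          show ?case
          proof (intro impI)
            assume u: "u \<in> {s<..<t}" and small: "d u * E u - d s < \<eta> / k1 - d s"
            have "d u = (d u * E u) * (1 / E u)" using Epos[of u] by simp
            also have "\<dots> \<le> (\<eta> / k1) * (k1 * exp (- (\<beta>1 / 2 * (u - s))))"
              using small E1[of u] u Epos[of u] d0[of u] \<eta> 1 by (intro mult_mono) auto
            also have "\<dots> = \<eta> * exp (- (\<beta>1 / 2 * (u - s)))" using 1 by simp
            also have "\<dots> \<le> \<eta> * 1" using \<eta> 1 u by (intro mult_left_mono) auto
            finally have du: "d u \<le> \<eta>" by simp
            have fd: "f u (a u) - f u (r u) \<le> (pa u + \<beta>1 / 2) * d u"
            proof (cases "r u = a u")
              case False
              then have lt: "r u < a u" using ra[of u] by simp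
              obtain z where z: "r u < z" "z < a u" "f u (a u) - f u (r u) = (a u - r u) * partial_x f u z"
                using MVT2[OF lt, of "f u" "partial_x f u"] elim(5) by blast
              have zR: "z \<in> {- R..R}" using z R[of u] by auto
              have "\<bar>partial_x f u z - partial_x f u (a u)\<bar> \<le> K * \<bar>z - a u\<bar>" using elim(4) zR R[of u] by blast
              also have "\<dots> \<le> K * \<eta>" using K z du unfolding d_def by (intro mult_left_mono) auto
              finally have "partial_x f u z \<le> pa u + \<beta>1 / 2" using \<eta> unfolding pa_def by linarith
              then have "(a u - r u) * partial_x f u z \<le> (a u - r u) * (pa u + \<beta>1 / 2)"
                using lt by (intro mult_left_mono) auto
              then show ?thesis unfolding z(3) d_def by (simp add: mult.commute)
            qed (simp add: d_def)
            have dd: "(d has_real_derivative f u (a u) - f u (r u)) (at u)"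
              unfolding d_def using elim(1,2) u by (intro DERIV_diff) auto
            have dP': "(P has_real_derivative pa u) (at u)" unfolding P_def using elim(3) u by simp
            have dE: "(E has_real_derivative E u * (- pa u - \<beta>1 / 2)) (at u)"
              unfolding E_def using dP' by (auto intro!: derivative_eq_intros)
            have "((\<lambda>u. d u * E u - d s) has_real_derivative
                (f u (a u) - f u (r u)) * E u + (E u * (- pa u - \<beta>1 / 2)) * d u - 0) (at u)"
              by (intro DERIV_diff DERIV_mult DERIV_const dd dE)
            moreover have "(f u (a u) - f u (r u)) * E u + (E u * (- pa u - \<beta>1 / 2)) * d u - 0 =
                E u * (f u (a u) - f u (r u) - (pa u + \<beta>1 / 2) * d u)" by (simp add: algebra_simps)
            moreover have "E u * (f u (a u) - f u (r u) - (pa u + \<beta>1 / 2) * d u) \<le> 0"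
              using fd Epos[of u] by (intro mult_nonneg_nonpos) auto
            ultimately show "\<exists>D\<le>0. ((\<lambda>u. d u * E u - d s) has_real_derivative D) (at u)" by metis
          qed
        qed
      qed
      then show ?thesis by simp
    qed
    have small: "d t \<le> \<eta>" if st: "s \<le> t" for t
    proof -
      have "d t = (d t * E t) * (1 / E t)" using Epos[of t] by simp
      also have "\<dots> \<le> (\<eta> / k1) * (k1 * exp (- (\<beta>1 / 2 * (t - s))))"
        using decay[OF st] n E1[OF st] Epos[of t] d0[of t] \<eta> 1 unfolding d_def[symmetric]
        by (intro mult_mono) auto
      also have "\<dots> = \<eta> * exp (- (\<beta>1 / 2 * (t - s)))" using 1 by simp
      also have "\<dots> \<le> \<eta> * 1" using \<eta> 1 st by (intro mult_left_mono) auto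
      finally show ?thesis by simp
    qed
    \<comment> \<open>With \<open>d \<le> \<eta>\<close> from \<open>s\<close> on, attraction along
      \<open>a\<close> passes to \<open>r\<close> with exponent \<open>\<beta>1 / 2\<close>, against
      repulsion with exponent \<open>\<beta>2\<close>. Over this length the two exponents add up to
      \<open>k1 * k2\<close>.\<close>
    define \<tau> where "\<tau> = k1 * k2 / (\<beta>1 / 2 + \<beta>2)"
    have \<tau>: "\<tau> > 0" "\<beta>1 / 2 * \<tau> + \<beta>2 * \<tau> = k1 * k2"
    proof -
      have p: "\<beta>1 / 2 + \<beta>2 > 0" using 1 2 by simp
      show "\<tau> > 0" unfolding \<tau>_def using p 1 2 by (intro divide_pos_pos mult_pos_pos) auto
      have "(\<beta>1 / 2 + \<beta>2) * \<tau> = k1 * k2" unfolding \<tau>_def using p by simp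
      then show "\<beta>1 / 2 * \<tau> + \<beta>2 * \<tau> = k1 * k2" by (simp only: distrib_right)
    qed
    define t where "t = s + \<tau>"
    have st: "s \<le> t" "t - s = \<tau>" using \<tau> unfolding t_def by auto
    have "(pr has_integral integral {s..t} pr) {s..t}" using bounded_measurable_integrable[OF prm prK] by blast
    moreover have "((\<lambda>u. pa u + \<beta>1 / 2) has_integral integral {s..t} pa + (t - s) * (\<beta>1 / 2)) {s..t}"
    proof (rule has_integral_add)
      show "(pa has_integral integral {s..t} pa) {s..t}" using bounded_measurable_integrable[OF pam paK] by blast
      show "((\<lambda>u. \<beta>1 / 2) has_integral (t - s) * (\<beta>1 / 2)) {s..t}"
        using has_integral_const_real[of "\<beta>1 / 2" s t] st by simp
    qed
    moreover have "AE u in lebesgue. u \<in> {s..t} \<longrightarrow> pr u \<le> pa u + \<beta>1 / 2"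
      using ae
    proof eventually_elim
      case (elim u)
      show ?case
      proof
        assume u: "u \<in> {s..t}"
        have "\<bar>partial_x f u (r u) - partial_x f u (a u)\<bar> \<le> K * \<bar>r u - a u\<bar>" using elim R[of u] by blast
        also have "\<dots> \<le> K * \<eta>" using K small[of u] d0[of u] u unfolding d_def by (intro mult_left_mono) auto
        finally show "pr u \<le> pa u + \<beta>1 / 2" using \<eta> unfolding pa_def pr_def by linarith
      qed
    qed
    ultimately have "integral {s..t} pr \<le> integral {s..t} pa + (t - s) * (\<beta>1 / 2)" by (rule has_integral_AE_le)
    then have "exp (integral {s..t} pr) \<le> exp (integral {s..t} pa) * exp ((t - s) * (\<beta>1 / 2))" by (simp flip: exp_add)
    also have "\<dots> \<le> (k1 * exp (- \<beta>1 * (t - s))) * exp ((t - s) * (\<beta>1 / 2))" using A[OF st(1)] by (intro mult_right_mono) auto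
    also have "\<dots> = k1 * exp (- (\<beta>1 / 2 * \<tau>))"
      unfolding st(2) by (simp add: mult.assoc flip: exp_add)
    finally show False
      using exp_product_contradiction[OF 1(1) 2(1) _ _ \<tau>(2)] Rp[OF st(1)] unfolding st(2) by blast
  qed
  moreover have "\<eta> / k1 > 0" using \<eta> 1 by simp
  ultimately show ?thesis by blast
qed


section \<open>Transfer of exponents to the perturbed equation\<close>

text \<open>The integrands differ by at most \<epsilon> outside \<open>{- T..T}\<close>; inside, the
  crude bound \<open>2 * K\<close> over a length of at most \<open>2 * T\<close> costs a constant
  that does not depend on \<open>s\<close> and \<open>t\<close>.\<close>

lemma integral_difference_bound:
  fixes p q :: "real \<Rightarrow> real"
  assumes p: "p \<in> borel_measurable lebesgue" "AE t in lebesgue. \<bar>p t\<bar> \<le> K"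
    and q: "q \<in> borel_measurable lebesgue" "AE t in lebesgue. \<bar>q t\<bar> \<le> K"
    and close: "AE t in lebesgue. \<bar>t\<bar> \<ge> T \<longrightarrow> \<bar>p t - q t\<bar> \<le> \<epsilon>"
    and nonneg: "T \<ge> 0" "\<epsilon> \<ge> 0" "K \<ge> 0" and st: "s \<le> t"
  shows "\<bar>integral {s..t} p - integral {s..t} q\<bar> \<le> \<epsilon> * (t - s) + 4 * K * T"
proof -
  define m where "m l = \<epsilon> + (if l \<in> {- T..T} then 2 * K else 0)" for l
  have di: "((\<lambda>l. p l - q l) has_integral integral {s..t} p - integral {s..t} q) {s..t}"
    by (intro has_integral_diff integrable_integral bounded_measurable_integrable[OF p] bounded_measurable_integrable[OF q])
  define c where "c = max s (- T)"
  define e where "e = min t T"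
  have Int: "{- T..T} \<inter> {s..t} = {c..e}" unfolding c_def e_def by auto
  define I where "I = integral {c..e} (\<lambda>_. 2 * K)"
  have "((\<lambda>l. if l \<in> {- T..T} then 2 * K else 0) has_integral I) {s..t}"
    unfolding has_integral_restrict_Int Int I_def by (intro integrable_integral integrable_const_ivl)
  moreover have "((\<lambda>l. \<epsilon>) has_integral (t - s) * \<epsilon>) {s..t}"
    using has_integral_const_real[of \<epsilon> s t] st by simp
  ultimately have mi: "(m has_integral (t - s) * \<epsilon> + I) {s..t}"
    unfolding m_def by (intro has_integral_add)
  have I: "I \<le> 4 * K * T"
  proof (cases "c \<le> e")
    case True
    then have "I = (e - c) * (2 * K)" unfolding I_def by simp
    also have "\<dots> \<le> (2 * T) * (2 * K)" using nonneg unfolding c_def e_def by (intro mult_right_mono) auto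
    finally show ?thesis by (simp add: mult_ac)
  next
    case False
    then show ?thesis unfolding I_def using nonneg by simp
  qed
  have ae: "AE l in lebesgue. \<bar>p l - q l\<bar> \<le> m l"
    using p(2) q(2) close
  proof eventually_elim
    case (elim l)
    show ?case
    proof (cases "l \<in> {- T..T}")
      case True
      then show ?thesis using elim(1,2) nonneg unfolding m_def by auto
    next
      case False
      then have "\<bar>l\<bar> \<ge> T" by auto
      then show ?thesis using elim(3) False unfolding m_def by auto
    qed
  qed
  have "integral {s..t} p - integral {s..t} q \<le> (t - s) * \<epsilon> + I"
    by (rule has_integral_AE_le[OF di mi]) (use ae in eventually_elim, auto simp: abs_le_iff)
  moreover have "- (integral {s..t} p - integral {s..t} q) \<le> (t - s) * \<epsilon> + I"
    by (rule has_integral_AE_le[OF has_integral_neg[OF di] mi]) (use ae in eventually_elim, auto simp: abs_le_iff)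
  ultimately show ?thesis using I by (simp add: abs_le_iff mult.commute)
qed

context transition
begin

lemma partial_x_eq:
  "AE t in lebesgue. \<forall>x. partial_x f t x = fx t x \<and> partial_x g t x = fx t (x - \<Delta> t) \<and>
     (g t has_real_derivative partial_x g t x) (at x)"
  using f_derivative
proof eventually_elim
  case (elim t)
  show ?case
  proof (intro allI conjI)
    fix x
    show "partial_x f t x = fx t x" unfolding partial_x_def using elim DERIV_imp_deriv by blast
    have "((\<lambda>x. f t (x - \<Delta> t)) has_real_derivative fx t (x - \<Delta> t) * 1) (at x)"
      by (rule DERIV_chain2[OF elim[rule_format]]) (auto intro!: derivative_eq_intros)
    then have d: "(g t has_real_derivative fx t (x - \<Delta> t)) (at x)" unfolding shifted_def[abs_def] by simp
    then show eq: "partial_x g t x = fx t (x - \<Delta> t)" unfolding partial_x_def by (rule DERIV_imp_deriv)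
    show "(g t has_real_derivative partial_x g t x) (at x)" using d unfolding eq .
  qed
qed

text \<open>The derivative of the shifted field along \<open>b\<close> is that of \<open>f\<close>
  along \<open>b - \<Delta>\<close>, and \<open>b - \<Delta> - z\<close> tends to 0 at both ends,
  although \<Delta> may have different limits there. Only a bounded time interval contributes more
  than \<epsilon>.\<close>

lemma linearization_close:
  assumes b: "solution_on g UNIV b" and z: "solution_on f UNIV z" "\<And>t. \<bar>z t\<bar> \<le> R"
    and past: "((\<lambda>t. \<bar>b t - (z t + \<delta>m)\<bar>) \<longlongrightarrow> 0) at_bot"
    and future: "((\<lambda>t. \<bar>b t - (z t + \<delta>p)\<bar>) \<longlongrightarrow> 0) at_top" and \<epsilon>: "\<epsilon> > 0"
  shows "\<exists>C\<ge>0. \<forall>s t. s \<le> t \<longrightarrow>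
    \<bar>(LINT l=ereal s..ereal t|lebesgue. partial_x g l (b l)) - (LINT l=ereal s..ereal t|lebesgue. partial_x f l (z l))\<bar>
      \<le> \<epsilon> * (t - s) + C"
proof -
  \<comment> \<open>Covers \<open>b - \<Delta>\<close>, of modulus at most
    \<open>\<rho>0 + 2 * M + M\<close>, and \<open>z\<close>.\<close>
  define B where "B = \<rho>0 + 3 * M + R"
  obtain K \<delta> where K: "K \<ge> 0" and ae: "AE t in lebesgue. regular_on (f t) (fx t) B K \<delta>"
    using f_regular[of B] by blast
  note ae = ae[unfolded regular_on_def]
  define p where "p l = partial_x g l (b l)" for l
  define q where "q l = partial_x f l (z l)" for l
  define e where "e = \<epsilon> / (K + 1)"
  have e: "e > 0" "K * e \<le> \<epsilon>" using \<epsilon> K unfolding e_def by (auto simp: field_simps)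
  have ev: "eventually (\<lambda>t. \<bar>b t - \<Delta> t - z t\<bar> \<le> e) F"
    if l: "((\<lambda>t. \<bar>b t - (z t + \<delta>)\<bar>) \<longlongrightarrow> 0) F" "(\<Delta> \<longlongrightarrow> \<delta>) F" for F \<delta>
  proof -
    have "eventually (\<lambda>t. \<bar>b t - (z t + \<delta>)\<bar> < e / 2) F"
      using tendstoD[OF l(1), of "e / 2"] e by (simp add: dist_real_def)
    moreover have "eventually (\<lambda>t. \<bar>\<Delta> t - \<delta>\<bar> < e / 2) F"
      using tendstoD[OF l(2), of "e / 2"] e by (simp add: dist_real_def)
    ultimately show ?thesis by eventually_elim linarith
  qed
  obtain T1 where T1: "\<And>t. t \<le> T1 \<Longrightarrow> \<bar>b t - \<Delta> t - z t\<bar> \<le> e"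
    using ev[OF past \<Delta>_limit] unfolding eventually_at_bot_linorder by blast
  obtain T2 where T2: "\<And>t. t \<ge> T2 \<Longrightarrow> \<bar>b t - \<Delta> t - z t\<bar> \<le> e"
    using ev[OF future \<Delta>_limit_future] unfolding eventually_at_top_linorder by blast
  define T where "T = max \<bar>T1\<bar> \<bar>T2\<bar>"
  have T: "T \<ge> 0" "\<bar>b t - \<Delta> t - z t\<bar> \<le> e" if "\<bar>t\<bar> \<ge> T" for t
  proof -
    show "T \<ge> 0" unfolding T_def by simp
    have "t \<le> T1 \<or> t \<ge> T2" using that unfolding T_def by linarith
    then show "\<bar>b t - \<Delta> t - z t\<bar> \<le> e" using T1 T2 by blast
  qed
  have T0: "T \<ge> 0" unfolding T_def by simp
  have main: "AE t in lebesgue. \<bar>p t\<bar> \<le> K \<and> \<bar>q t\<bar> \<le> K \<and> (\<bar>t\<bar> \<ge> T \<longrightarrow> \<bar>p t - q t\<bar> \<le> \<epsilon>)"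
    using ae partial_x_eq \<Delta>_bounded
  proof eventually_elim
    case (elim t)
    have "\<bar>b t - \<Delta> t\<bar> \<le> B" "\<bar>z t\<bar> \<le> B"
      using global_solution_bounded[OF b, of t] elim(3) z(2)[of t] M \<rho>0 R_pos unfolding B_def by linarith+
    then have mem: "b t - \<Delta> t \<in> {- B..B}" "z t \<in> {- B..B}" by (auto simp: abs_le_iff)
    have pq: "p t = fx t (b t - \<Delta> t)" "q t = fx t (z t)" using elim(2) unfolding p_def q_def by auto
    have "\<bar>p t - q t\<bar> \<le> K * \<bar>b t - \<Delta> t - z t\<bar>" unfolding pq using elim(1) mem by blast
    moreover have "K * \<bar>b t - \<Delta> t - z t\<bar> \<le> \<epsilon>" if "\<bar>t\<bar> \<ge> T"
      using mult_left_mono[OF T(2)[OF that] K] e(2) by linarith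
    ultimately have "\<bar>t\<bar> \<ge> T \<longrightarrow> \<bar>p t - q t\<bar> \<le> \<epsilon>" by (meson order_trans)
    moreover have "\<bar>p t\<bar> \<le> K" "\<bar>q t\<bar> \<le> K" unfolding pq using elim(1) mem by blast+
    ultimately show ?case by blast
  qed
  have pm: "p \<in> borel_measurable lebesgue"
    unfolding p_def
  proof (rule derivative_measurable[OF superposition_measurable _ global_solution_measurable[OF b]])
    show "AE t in lebesgue. \<forall>x. (g t has_real_derivative partial_x g t x) (at x)"
      using partial_x_eq by eventually_elim blast
  qed
  have qm: "q \<in> borel_measurable lebesgue"
    unfolding q_def
  proof (rule derivative_measurable[OF f_measurable _ F.global_solution_measurable[OF z(1)]])
    show "AE t in lebesgue. \<forall>x. (f t has_real_derivative partial_x f t x) (at x)"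
      using partial_x_eq f_derivative by eventually_elim simp
  qed
  have pK: "AE t in lebesgue. \<bar>p t\<bar> \<le> K" and qK: "AE t in lebesgue. \<bar>q t\<bar> \<le> K"
    and pq: "AE t in lebesgue. \<bar>t\<bar> \<ge> T \<longrightarrow> \<bar>p t - q t\<bar> \<le> \<epsilon>"
    using main by (eventually_elim, blast)+
  show ?thesis
  proof (intro exI[of _ "4 * K * T"] conjI allI impI)
    show "4 * K * T \<ge> 0" using K T0 by simp
    fix s t :: real assume st: "s \<le> t"
    show "\<bar>(LINT l=ereal s..ereal t|lebesgue. partial_x g l (b l)) - (LINT l=ereal s..ereal t|lebesgue. partial_x f l (z l))\<bar>
        \<le> \<epsilon> * (t - s) + 4 * K * T"
      using integral_difference_bound[OF pm pK qm qK pq T0 less_imp_le[OF \<epsilon>] K st]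
      unfolding interval_integral_lebesgue[OF pm pK st, symmetric] interval_integral_lebesgue[OF qm qK st, symmetric]
      unfolding p_def q_def .
  qed
qed

text \<open>With \<epsilon> equal to half of the exponent the other half survives, and the additive
  constant \<open>C\<close> turns into the factor \<open>exp C\<close>.\<close>

lemma hyperbolic_attractive_transfer:
  assumes b: "bounded_solution g b" and att: "hyperbolic_attractive f a"
    and past: "((\<lambda>t. \<bar>b t - (a t + \<delta>m)\<bar>) \<longlongrightarrow> 0) at_bot"
    and future: "((\<lambda>t. \<bar>b t - (a t + \<delta>p)\<bar>) \<longlongrightarrow> 0) at_top"
  shows "hyperbolic_attractive g b"
proof -
  obtain k \<beta> where k: "k \<ge> 1" "\<beta> > 0" and
    A: "\<And>s t. t \<ge> s \<Longrightarrow> exp (LINT l=ereal s..ereal t|lebesgue. partial_x f l (a l)) \<le> k * exp (- \<beta> * (t - s))"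
    using att unfolding hyperbolic_attractive_def by blast
  have bs: "solution_on g UNIV b" using b unfolding bounded_solution_def by blast
  obtain C where C: "C \<ge> 0" "\<And>s t. s \<le> t \<Longrightarrow>
    \<bar>(LINT l=ereal s..ereal t|lebesgue. partial_x g l (b l)) - (LINT l=ereal s..ereal t|lebesgue. partial_x f l (a l))\<bar>
      \<le> \<beta> / 2 * (t - s) + C"
    using linearization_close[OF bs a_solution a_bounded past future, of "\<beta> / 2"] k by auto
  have "exp (LINT l=ereal s..ereal t|lebesgue. partial_x g l (b l)) \<le> (k * exp C) * exp (- (\<beta> / 2) * (t - s))"
    if st: "s \<le> t" for s t
  proof -
    have "exp (LINT l=ereal s..ereal t|lebesgue. partial_x g l (b l)) \<le>
        exp (LINT l=ereal s..ereal t|lebesgue. partial_x f l (a l)) * exp (\<beta> / 2 * (t - s) + C)"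
      using C(2)[OF st] by (simp add: abs_le_iff flip: exp_add)
    also have "\<dots> \<le> (k * exp (- \<beta> * (t - s))) * exp (\<beta> / 2 * (t - s) + C)"
      using A[OF st] by (intro mult_right_mono) auto
    also have "\<dots> = k * exp (C + - (\<beta> / 2) * (t - s))"
      by (simp add: mult.assoc flip: exp_add)
    also have "\<dots> = (k * exp C) * exp (- (\<beta> / 2) * (t - s))" by (simp only: exp_add mult.assoc)
    finally show ?thesis .
  qed
  moreover have "k * exp C \<ge> 1" using k C mult_mono[of 1 k 1 "exp C"] by simp
  moreover have "\<beta> / 2 > 0" using k by simp
  ultimately show ?thesis using b unfolding hyperbolic_attractive_def by blast
qed

lemma hyperbolic_repulsive_transfer:
  assumes b: "bounded_solution g b" and rep: "hyperbolic_repulsive f r"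
    and past: "((\<lambda>t. \<bar>b t - (r t + \<delta>m)\<bar>) \<longlongrightarrow> 0) at_bot"
    and future: "((\<lambda>t. \<bar>b t - (r t + \<delta>p)\<bar>) \<longlongrightarrow> 0) at_top"
  shows "hyperbolic_repulsive g b"
proof -
  obtain k \<beta> where k: "k \<ge> 1" "\<beta> > 0" and
    A: "\<And>s t. t \<le> s \<Longrightarrow> exp (LINT l=ereal s..ereal t|lebesgue. partial_x f l (r l)) \<le> k * exp (\<beta> * (t - s))"
    using rep unfolding hyperbolic_repulsive_def by blast
  have bs: "solution_on g UNIV b" using b unfolding bounded_solution_def by blast
  obtain C where C: "C \<ge> 0" "\<And>s t. s \<le> t \<Longrightarrow>
    \<bar>(LINT l=ereal s..ereal t|lebesgue. partial_x g l (b l)) - (LINT l=ereal s..ereal t|lebesgue. partial_x f l (r l))\<bar>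
      \<le> \<beta> / 2 * (t - s) + C"
    using linearization_close[OF bs r_solution r_bounded past future, of "\<beta> / 2"] k by auto
  have "exp (LINT l=ereal s..ereal t|lebesgue. partial_x g l (b l)) \<le> (k * exp C) * exp (\<beta> / 2 * (t - s))"
    if st: "t \<le> s" for s t
  proof -
    have "exp (LINT l=ereal s..ereal t|lebesgue. partial_x g l (b l)) \<le>
        exp (LINT l=ereal s..ereal t|lebesgue. partial_x f l (r l)) * exp (\<beta> / 2 * (s - t) + C)"
      unfolding interval_integral_lebesgue_reverse[OF st]
      using C(2)[OF st] by (simp add: abs_le_iff flip: exp_add)
    also have "\<dots> \<le> (k * exp (\<beta> * (t - s))) * exp (\<beta> / 2 * (s - t) + C)"
      using A[OF st] by (intro mult_right_mono) auto
    also have "\<dots> = k * exp (C + \<beta> / 2 * (t - s))"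
      by (simp add: mult.assoc flip: exp_add) (simp add: field_simps)
    also have "\<dots> = (k * exp C) * exp (\<beta> / 2 * (t - s))" by (simp only: exp_add mult.assoc)
    finally show ?thesis .
  qed
  moreover have "k * exp C \<ge> 1" using k C mult_mono[of 1 k 1 "exp C"] by simp
  moreover have "\<beta> / 2 > 0" using k by simp
  ultimately show ?thesis using b unfolding hyperbolic_repulsive_def by blast
qed

text \<open>Once the two are ordered strictly at one time they are so always. Then \<open>rD\<close>
  is a solution below \<open>aD\<close> and \<open>aD\<close> one above \<open>rD\<close>, so the
  limit statements for such solutions show that \<open>aD\<close> follows \<open>a\<close>, and
  \<open>rD\<close> follows \<open>r\<close>, at both ends.\<close>

lemma different_global_solutions:
  assumes up: "upper_past_solution g UNIV aD" and low: "lower_future_solution g UNIV rD"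
    and ne: "aD \<noteq> rD" and att: "hyperbolic_attractive f a" and rep: "hyperbolic_repulsive f r"
  shows "uniformly_separated aD rD" and "attractor_repeller_pair g aD rD"
proof -
  have sa: "solution_on g UNIV aD" by (rule upper_past_solutionD(2)[OF up])
  have sr: "solution_on g UNIV rD"
    using low maximal_solutionD unfolding lower_future_solution_def by blast
  have le: "rD t \<le> aD t" for t by (rule upper_past_solution_UNIV(2)[OF up sr])
  obtain s where "aD s \<noteq> rD s" using ne by auto
  then have s: "rD s < aD s" using le[of s] by simp
  have less: "rD t < aD t" for t using solution_less[OF sr sa _ _ s] by simp
  have a_past: "((\<lambda>t. \<bar>aD t - (a t + \<delta>m)\<bar>) \<longlongrightarrow> 0) at_bot" by (rule upper_past_solution_limit[OF up])
  have r_past: "((\<lambda>t. \<bar>rD t - (r t + \<delta>m)\<bar>) \<longlongrightarrow> 0) at_bot"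
    using past_solution_limit[OF up _ s] sol_extends(2)[OF sr] by simp
  have r_future: "((\<lambda>t. \<bar>rD t - (r t + \<delta>p)\<bar>) \<longlongrightarrow> 0) at_top" by (rule lower_future_solution_limit[OF low])
  have a_future: "((\<lambda>t. \<bar>aD t - (a t + \<delta>p)\<bar>) \<longlongrightarrow> 0) at_top"
    using future_solution_limit[OF low _ s] sol_extends(2)[OF sa] by simp
  have bnd: "bounded_solution g x" if "solution_on g UNIV x" for x
    unfolding bounded_solution_def using that global_solution_bounded[OF that]
    by (auto intro!: boundedI)
  show "attractor_repeller_pair g aD rD"
    unfolding attractor_repeller_pair_def
    using up low hyperbolic_attractive_transfer[OF bnd[OF sa] att a_past a_future]
      hyperbolic_repulsive_transfer[OF bnd[OF sr] rep r_past r_future] by blast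
  \<comment> \<open>Each solution ends up within \<open>d0 / 4\<close> of its reference, so half of
    the original gap remains at both ends; on the compact middle part the gap attains a positive
    minimum.\<close>
  have ev: "eventually (\<lambda>t. aD t - rD t \<ge> d0 / 2) F"
    if l: "((\<lambda>t. \<bar>aD t - (a t + \<delta>)\<bar>) \<longlongrightarrow> 0) F" "((\<lambda>t. \<bar>rD t - (r t + \<delta>)\<bar>) \<longlongrightarrow> 0) F" for F \<delta>
  proof -
    have "eventually (\<lambda>t. \<bar>aD t - (a t + \<delta>)\<bar> < d0 / 4) F" "eventually (\<lambda>t. \<bar>rD t - (r t + \<delta>)\<bar> < d0 / 4) F"
      using tendstoD[OF l(1), of "d0 / 4"] tendstoD[OF l(2), of "d0 / 4"] d0 by (simp_all add: dist_real_def)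
    then show ?thesis
    proof eventually_elim
      case (elim t)
      then show ?case using separated[of t] by linarith
    qed
  qed
  obtain T1 where T1: "\<And>t. t \<le> T1 \<Longrightarrow> aD t - rD t \<ge> d0 / 2"
    using ev[OF a_past r_past] unfolding eventually_at_bot_linorder by blast
  obtain T2 where T2: "\<And>t. t \<ge> T2 \<Longrightarrow> aD t - rD t \<ge> d0 / 2"
    using ev[OF a_future r_future] unfolding eventually_at_top_linorder by blast
  define S where "S = {min T1 T2..max T1 T2}"
  have "compact S" "S \<noteq> {}" unfolding S_def by auto
  moreover have "continuous_on S (\<lambda>t. aD t - rD t)"
    unfolding S_def by (intro continuous_on_diff solution_on_continuous[OF sa] solution_on_continuous[OF sr]) auto
  ultimately obtain u where u: "u \<in> S" "\<And>t. t \<in> S \<Longrightarrow> aD u - rD u \<le> aD t - rD t"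
    using continuous_attains_inf[of S "\<lambda>t. aD t - rD t"] by blast
  define c where "c = min (d0 / 2) (aD u - rD u)"
  have c: "c > 0" using d0 less[of u] unfolding c_def by simp
  have "ereal c \<le> ereal (aD t - rD t)" for t
  proof -
    consider "t \<le> T1" | "t \<ge> T2" | "t \<in> S" unfolding S_def by force
    then have "c \<le> aD t - rD t"
    proof cases
      case 1 then show ?thesis using T1[of t] unfolding c_def by simp
    next
      case 2 then show ?thesis using T2[of t] unfolding c_def by simp
    next
      case 3 then show ?thesis using u(2)[of t] unfolding c_def by simp
    qed
    then show ?thesis by simp
  qed
  then have "ereal c \<le> (INF t. ereal (aD t - rD t))" by (intro INF_greatest)
  moreover have "0 < ereal c" using c by simp
  ultimately show "uniformly_separated aD rD" unfolding uniformly_separated_def by (rule order.strict_trans2[rotated])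
qed

end

lemma uniformly_separated_neq: "uniformly_separated a r \<Longrightarrow> a \<noteq> r"
  unfolding uniformly_separated_def by auto

text \<open>The claims after existence are made for every choice of special solutions and domains.
  Values outside a domain are irrelevant, so the two functions are compared only when both domains
  are the whole line.\<close>

theorem theorem4p4:
  fixes f :: "real \<Rightarrow> real \<Rightarrow> real"
    and \<Delta> a r :: "real \<Rightarrow> real"
    and \<delta>m \<delta>p :: real
  assumes "conditions_f1_f7 f"
    and "L_infinity \<Delta>"
    and "(\<Delta> \<longlongrightarrow> \<delta>m) at_bot"
    and "(\<Delta> \<longlongrightarrow> \<delta>p) at_top"
    and "attractor_repeller_pair f a r"
  shows
    "((\<exists>A a\<^sub>\<Delta>. upper_past_solution (shifted f \<Delta>) A a\<^sub>\<Delta>) \<and>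
      (\<exists>R r\<^sub>\<Delta>. lower_future_solution (shifted f \<Delta>) R r\<^sub>\<Delta>)) \<and>
     (\<forall>A a\<^sub>\<Delta> R r\<^sub>\<Delta>.
        upper_past_solution (shifted f \<Delta>) A a\<^sub>\<Delta> \<and> lower_future_solution (shifted f \<Delta>) R r\<^sub>\<Delta> \<longrightarrow>
        (((\<lambda>t. \<bar>a\<^sub>\<Delta> t - (a t + \<delta>m)\<bar>) \<longlongrightarrow> 0) at_bot \<and>
         (\<forall>s x0. s \<in> A \<and> x0 < a\<^sub>\<Delta> s \<longrightarrow>
            ((\<lambda>t. \<bar>sol (shifted f \<Delta>) s x0 t - (r t + \<delta>m)\<bar>) \<longlongrightarrow> 0) at_bot) \<and>
         ((\<lambda>t. \<bar>r\<^sub>\<Delta> t - (r t + \<delta>p)\<bar>) \<longlongrightarrow> 0) at_top \<and>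
         (\<forall>s x0. s \<in> R \<and> x0 > r\<^sub>\<Delta> s \<longrightarrow>
            ((\<lambda>t. \<bar>sol (shifted f \<Delta>) s x0 t - (a t + \<delta>p)\<bar>) \<longlongrightarrow> 0) at_top)) \<and>
        (locally_pullback_attractive (shifted f \<Delta>) A a\<^sub>\<Delta> \<and>
         locally_pullback_repulsive (shifted f \<Delta>) R r\<^sub>\<Delta>) \<and>
        ((A = UNIV \<and> R = UNIV \<and> uniformly_separated a\<^sub>\<Delta> r\<^sub>\<Delta> \<longleftrightarrow>
            A = UNIV \<and> R = UNIV \<and> a\<^sub>\<Delta> \<noteq> r\<^sub>\<Delta>) \<and>
         (A = UNIV \<and> R = UNIV \<and> a\<^sub>\<Delta> \<noteq> r\<^sub>\<Delta> \<longleftrightarrow>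
            A = UNIV \<and> R = UNIV \<and> attractor_repeller_pair (shifted f \<Delta>) a\<^sub>\<Delta> r\<^sub>\<Delta>)) \<and>
        ((\<nexists>b. hyperbolic_solution (shifted f \<Delta>) b) \<longrightarrow>
           (\<forall>b b'. bounded_solution (shifted f \<Delta>) b \<and> bounded_solution (shifted f \<Delta>) b' \<longrightarrow>
              b = b') \<and>
           (\<forall>b. bounded_solution (shifted f \<Delta>) b \<longrightarrow>
              A = UNIV \<and> R = UNIV \<and> b = a\<^sub>\<Delta> \<and> b = r\<^sub>\<Delta>)))"
proof -
  have att: "hyperbolic_attractive f a" and rep: "hyperbolic_repulsive f r"
    using assms(5) unfolding attractor_repeller_pair_def by auto
  then have sols: "solution_on f UNIV a" "solution_on f UNIV r" "bounded (range a)" "bounded (range r)"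
    unfolding hyperbolic_attractive_def hyperbolic_repulsive_def bounded_solution_def by auto
  obtain Ra Rr where R: "\<And>t. \<bar>a t\<bar> \<le> Ra" "\<And>t. \<bar>r t\<bar> \<le> Rr"
    using sols(3,4) unfolding bounded_iff by auto
  obtain M where M: "AE t in lebesgue. \<bar>\<Delta> t\<bar> \<le> M" using assms(2) unfolding L_infinity_def by blast
  obtain \<rho> \<kappa> where eq: "concave_equation f (partial_x f) \<rho> \<kappa>"
    using conditions_concave_equation[OF assms(1)] by blast
  obtain d0 where d0: "d0 > 0" "\<And>t. a t - r t \<ge> d0"
    using attractor_repeller_separated[OF eq assms(5)] by blast
  interpret E: concave_equation f "partial_x f" \<rho> \<kappa> by (rule eq)
  interpret transition f "partial_x f" \<rho> \<kappa> \<Delta> a r \<delta>m "max M 0" d0 "max Ra Rr" \<delta>p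
  proof
    show "AE t in lebesgue. \<bar>\<Delta> t\<bar> \<le> max M 0" using M by eventually_elim simp
    show "\<bar>a t\<bar> \<le> max Ra Rr" "\<bar>r t\<bar> \<le> max Ra Rr" for t using R[of t] by auto
  qed (use assms(2-4) sols(1,2) d0 in \<open>auto simp: L_infinity_def\<close>)
  have main: "((((\<lambda>t. \<bar>aD t - (a t + \<delta>m)\<bar>) \<longlongrightarrow> 0) at_bot \<and>
         (\<forall>s x0. s \<in> A \<and> x0 < aD s \<longrightarrow> ((\<lambda>t. \<bar>sol g s x0 t - (r t + \<delta>m)\<bar>) \<longlongrightarrow> 0) at_bot) \<and>
         ((\<lambda>t. \<bar>rD t - (r t + \<delta>p)\<bar>) \<longlongrightarrow> 0) at_top \<and>
         (\<forall>s x0. s \<in> J \<and> x0 > rD s \<longrightarrow> ((\<lambda>t. \<bar>sol g s x0 t - (a t + \<delta>p)\<bar>) \<longlongrightarrow> 0) at_top)) \<and>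
        (locally_pullback_attractive g A aD \<and> locally_pullback_repulsive g J rD) \<and>
        ((A = UNIV \<and> J = UNIV \<and> uniformly_separated aD rD \<longleftrightarrow> A = UNIV \<and> J = UNIV \<and> aD \<noteq> rD) \<and>
         (A = UNIV \<and> J = UNIV \<and> aD \<noteq> rD \<longleftrightarrow> A = UNIV \<and> J = UNIV \<and> attractor_repeller_pair g aD rD)) \<and>
        ((\<nexists>b. hyperbolic_solution g b) \<longrightarrow>
           (\<forall>b b'. bounded_solution g b \<and> bounded_solution g b' \<longrightarrow> b = b') \<and>
           (\<forall>b. bounded_solution g b \<longrightarrow> A = UNIV \<and> J = UNIV \<and> b = aD \<and> b = rD)))"
    if up: "upper_past_solution g A aD" and low: "lower_future_solution g J rD" for A aD J rD
  proof -
    have diff: "uniformly_separated aD rD" "attractor_repeller_pair g aD rD"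
      if "A = UNIV" "J = UNIV" "aD \<noteq> rD"
      using different_global_solutions[OF _ _ that(3) att rep] up low that(1,2) by auto
    \<comment> \<open>If the two functions coincided, one solution would be attractive and repulsive
      at once.\<close>
    have pair: "aD \<noteq> rD" if "attractor_repeller_pair g aD rD"
      using that not_attractive_and_repulsive unfolding attractor_repeller_pair_def by metis
    have unique: "A = UNIV \<and> J = UNIV \<and> b = aD \<and> b = rD"
      if no: "\<nexists>b. hyperbolic_solution g b" and b: "bounded_solution g b" for b
    proof -
      have sb: "solution_on g UNIV b" using b unfolding bounded_solution_def by blast
      note A = upper_past_solution_UNIV[OF up sb] and J = lower_future_solution_UNIV[OF low sb]
      \<comment> \<open>If they differed, they would form a pair, and \<open>aD\<close> would be
        hyperbolic. Equality then squeezes \<open>b\<close>, which lies between them.\<close>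
      have "aD = rD"
      proof (rule ccontr)
        assume "aD \<noteq> rD"
        then have "hyperbolic_attractive g aD"
          using diff(2) A(1) J(1) unfolding attractor_repeller_pair_def by blast
        then show False using no unfolding hyperbolic_solution_def by blast
      qed
      moreover have "b = aD"
      proof
        fix t show "b t = aD t" using A(2)[of t] J(2)[of t] \<open>aD = rD\<close> by simp
      qed
      ultimately show ?thesis using A(1) J(1) by simp
    qed
    show ?thesis
    proof (intro conjI allI impI; (elim conjE)?)
      show "((\<lambda>t. \<bar>aD t - (a t + \<delta>m)\<bar>) \<longlongrightarrow> 0) at_bot" by (rule upper_past_solution_limit[OF up])
      show "((\<lambda>t. \<bar>sol g s x0 t - (r t + \<delta>m)\<bar>) \<longlongrightarrow> 0) at_bot" if "s \<in> A" "x0 < aD s" for s x0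
        by (rule past_solution_limit[OF up that])
      show "((\<lambda>t. \<bar>rD t - (r t + \<delta>p)\<bar>) \<longlongrightarrow> 0) at_top" by (rule lower_future_solution_limit[OF low])
      show "((\<lambda>t. \<bar>sol g s x0 t - (a t + \<delta>p)\<bar>) \<longlongrightarrow> 0) at_top" if "s \<in> J" "x0 > rD s" for s x0
        by (rule future_solution_limit[OF low that])
      show "locally_pullback_attractive g A aD" by (rule upper_past_solution_pullback[OF up])
      show "locally_pullback_repulsive g J rD" by (rule lower_future_solution_pullback[OF low])
      show "A = UNIV \<and> J = UNIV \<and> uniformly_separated aD rD \<longleftrightarrow> A = UNIV \<and> J = UNIV \<and> aD \<noteq> rD"
        using diff(1) uniformly_separated_neq by blast
      show "A = UNIV \<and> J = UNIV \<and> aD \<noteq> rD \<longleftrightarrow> A = UNIV \<and> J = UNIV \<and> attractor_repeller_pair g aD rD"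
        using diff(2) pair by blast
      show "b = b'" if "\<nexists>b. hyperbolic_solution g b" "bounded_solution g b" "bounded_solution g b'" for b b'
        using unique[OF that(1,2)] unique[OF that(1,3)] by simp
      show "A = UNIV" "J = UNIV" "b = aD" "b = rD" if "\<nexists>b. hyperbolic_solution g b" "bounded_solution g b" for b
        using unique[OF that] by blast+
    qed
  qed
  show ?thesis
    by (rule conjI[OF conjI[OF perturbed_upper_past_solution_exists lower_future_solution_exists]],
        intro allI impI, erule conjE, rule main; assumption)
qed

end
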